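(* Let $X$ be a standard Markov process on $E$. Suppose that $X$ has the Inversion Property with characteristics $(I,h,v)$. Let $D\subset E_h=\{x\in E: 0<h(x)<\infty\}$ be an open set. Then the Kelvin transform $\mathcal K f(x)=h(x)\,f(I(x))$ has the following properties: (i) If $f$ is regular harmonic on $D$ and $f=0$ on $D^c$, then $\mathcal K f$ is regular harmonic on $I(D)$. (ii) If $f$ is superharmonic on $D$, then $\mathcal K f$ is superharmonic on $I(D)$.
   Context: State space: $S\subset\mathbb R^n$ is an unbounded locally compact set with $0\in S$, and $E=S\cup\{\infty\}$ is its Alexandroff one-point compactification, with its Borel $\sigma$-field. Write $\mathring S$ for the interior of $S$, $\mathring E=\mathring S\setminus\{0\}$ ("the interior of $E$") and $\partial E=E\setminus\mathring E=\partial S\cup\{0,\infty\}$. Process: $X=((X_t)_{t\ge0},(\mathbb P_x)_{x\in E})$ is a standard Markov process on $E$ (in the sense of Blumenthal and Getoor): strong Markov, right-continuous with left limits, quasi-left-continuous on $[0,\zeta)$, where $\zeta=\inf\{s>0: X_s\notin\mathring S\setminus\{0\}\}$ is the lifetime. $X$ is absorbed at $\partial S\cup\{0,\infty\}$: it is sent to $0$ when it leaves $\mathring S\setminus\{0\}$ through $\partial S\cup\{0\}$ and to $\infty$ otherwise. $X$ is irreducible: from any point of $\mathring S\setminus\{0\}$ it reaches any nonempty open subset of $E$ with positive probability. Excessive functions and Doob transform: a Borel function $h\ge 0$ on $E$ is excessive if $\mathbb E_xh(X_t)\le h(x)$ for all $x,t$ and $\lim_{t\to0+}\mathbb E_xh(X_t)=h(x)$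 for all $x$. The Doob $h$-transform $X^h$ is the (sub-)Markov process with semigroup $P^h_t(x,dy)=\frac{h(y)}{h(x)}Q^h_t(x,dy)$ for $x\in E_h$ and $0$ for $x\notin E_h$, where $Q^h_t$ is the semigroup of $X$ killed on exiting $E_h$. Inversion Property: $X$ has the Inversion Property with characteristics $(I,h,v)$ if $I\neq\mathrm{Id}$ is an involution of $E$, $h\ge0$ is an $X$-excessive function on $E$ with $0<h<\infty$ in the interior of $E$, $v$ is a positive continuous function and, for every $x\in E$, the process $(I(X_{\gamma_t}),t\ge0)$ with $X_0=x$ has the same law as $(X^h_t,t\ge0)$ with $X^h_0=I(x)$. Here $\gamma_t$ is the inverse of the additive functional $A_t=\int_0^tv^{-1}(X_s)\,ds$, and $X^h$ is killed when it exits the interior of $E$. Harmonicity: $\tau_B=\inf\{s>0:X_s\notin B\}$ is the first exit time from $B$. A Borel function $f$ is superharmonic on an open set $D$ if for every bounded open set $B\subset\bar B\subset D$ and all $x\in B$, $\mathbb E_x(f(X_{\tau_B}),\tau_B<\infty)\le f(x)$. It is regular harmonic on $D$ if $\mathbb E_x(f(X_{\tau_D}),\tau_D<\infty)=f(x)$ for $x\in D$. Functions considered in connection with the Kelvin transform are, by convention, taken equal to $0$ on $\partial E$.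
   Formalization: The involution I of E is taken to be continuous (so that I(D) is open), and "bounded open B with closure in D" is read as open B with closure in E contained in D; this differs only if infinity lies in D or I(D), where the norm-bounded version of (ii) fails for signed f. *)

theory Defs
  imports "HOL-Probability.Probability"
begin

text \<open>
  The one-point compactification of \<open>S\<close> lives on the option type: \<open>Some y\<close> is the point
  \<open>y \<in> S\<close> and \<open>None\<close> is the point at infinity. Functions on \<open>E\<close> are total functions on the
  option type, of which only the values on \<^term>\<open>topspace (E_top S)\<close> matter.
\<close>

definition state_space :: "(real ^ 'n) set \<Rightarrow> bool" where
  "state_space S \<longleftrightarrow> \<not> bounded S \<and> locally compact S \<and> 0 \<in> S"

definition E_top :: "(real ^ 'n) set \<Rightarrow> (real ^ 'n) option topology" where
  "E_top S = Alexandroff_compactification (top_of_set S)"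

definition E_set :: "(real ^ 'n) set \<Rightarrow> (real ^ 'n) option set" where
  "E_set S = topspace (E_top S)"

definition E_borel :: "(real ^ 'n) set \<Rightarrow> (real ^ 'n) option measure" where
  "E_borel S = sigma (E_set S) {U. openin (E_top S) U}"

definition E_int :: "(real ^ 'n) set \<Rightarrow> (real ^ 'n) option set" where
  "E_int S = Some ` (interior S - {0})"

definition E_bd :: "(real ^ 'n) set \<Rightarrow> (real ^ 'n) option set" where
  "E_bd S = E_set S - E_int S"

lemma E_set_eq: "E_set S = insert None (Some ` S)"
  by (simp add: E_set_def E_top_def)

lemma E_bd_eq:
  assumes "0 \<in> S"
  shows "E_bd S = Some ` (S - interior S) \<union> {Some 0, None}"
  using assms interior_subset[of S] by (auto simp: E_bd_def E_set_eq E_int_def)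

text \<open>
  A process is a family \<open>X t\<close> of \<open>E\<close>-valued maps, \<open>t \<ge> 0\<close>, on a measurable space \<open>M\<close>, together
  with probability measures \<open>P x\<close> on \<open>M\<close>, \<open>x \<in> E\<close>. Random times take values in
  \<open>[0, \<infinity>]\<close>, rendered as \<^typ>\<open>ennreal\<close>.
\<close>

definition exit_time :: "(real \<Rightarrow> 'w \<Rightarrow> 'e) \<Rightarrow> 'e set \<Rightarrow> 'w \<Rightarrow> ennreal" where
  "exit_time X B \<omega> = Inf {ennreal s | s. 0 < s \<and> X s \<omega> \<notin> B}"

abbreviation lifetime ::
  "(real ^ 'n) set \<Rightarrow> (real \<Rightarrow> 'w \<Rightarrow> (real ^ 'n) option) \<Rightarrow> 'w \<Rightarrow> ennreal" where
  "lifetime S X \<equiv> exit_time X (E_int S)"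

definition at_time :: "(real \<Rightarrow> 'w \<Rightarrow> 'e) \<Rightarrow> ('w \<Rightarrow> ennreal) \<Rightarrow> 'w \<Rightarrow> 'e" where
  "at_time X T \<omega> = X (enn2real (T \<omega>)) \<omega>"

definition natural_filtration ::
  "'w measure \<Rightarrow> 'e measure \<Rightarrow> (real \<Rightarrow> 'w \<Rightarrow> 'e) \<Rightarrow> real \<Rightarrow> 'w measure" where
  "natural_filtration M N X t =
     sigma (space M) (\<Union>s\<in>{0..t}. {X s -` A \<inter> space M | A. A \<in> sets N})"

text \<open>
  The right-continuous, \<open>Q\<close>-complete augmentation of the natural filtration, where \<open>Q = P x\<close>.
  The index \<open>\<infinity>\<close> yields the completion of \<open>Q\<close>.
\<close>

definition augmented_filtration ::
  "'w measure \<Rightarrow> 'e measure \<Rightarrow> (real \<Rightarrow> 'w \<Rightarrow> 'e) \<Rightarrow> ennreal \<Rightarrow> 'w measure" where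
  "augmented_filtration Q N X t =
     sigma (space Q)
       {A \<in> sets (completion Q). \<forall>u::real. t < ennreal u \<longrightarrow>
          (\<exists>B \<in> sets (natural_filtration Q N X u).
             (A - B) \<union> (B - A) \<in> null_sets (completion Q))}"

definition strong_markov ::
  "(real ^ 'n) set \<Rightarrow> ((real ^ 'n) option \<Rightarrow> 'w measure)
     \<Rightarrow> (real \<Rightarrow> 'w \<Rightarrow> (real ^ 'n) option) \<Rightarrow> bool" where
  "strong_markov S P X \<longleftrightarrow>
     (\<forall>x\<in>E_set S. \<forall>T.
        stopping_time (augmented_filtration (P x) (E_borel S) X) T \<longrightarrow>
        (\<forall>L \<in> sets (filtration.pre_sigma (space (P x))
                     (augmented_filtration (P x) (E_borel S) X) T).
         \<forall>A \<in> sets (E_borel S). \<forall>t\<ge>0.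
           emeasure (completion (P x))
             {\<omega> \<in> L. T \<omega> < \<infinity> \<and> X (enn2real (T \<omega>) + t) \<omega> \<in> A}
           = (\<integral>\<^sup>+\<omega>\<in>{\<omega> \<in> L. T \<omega> < \<infinity>}.
                emeasure (P (at_time X T \<omega>)) {\<omega>' \<in> space (P (at_time X T \<omega>)). X t \<omega>' \<in> A}
              \<partial>completion (P x))))"

definition quasi_left_continuous ::
  "(real ^ 'n) set \<Rightarrow> ((real ^ 'n) option \<Rightarrow> 'w measure)
     \<Rightarrow> (real \<Rightarrow> 'w \<Rightarrow> (real ^ 'n) option) \<Rightarrow> bool" where
  "quasi_left_continuous S P X \<longleftrightarrow>
     (\<forall>x\<in>E_set S. \<forall>T :: nat \<Rightarrow> 'w \<Rightarrow> ennreal.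
        (\<forall>n. stopping_time (augmented_filtration (P x) (E_borel S) X) (T n)) \<longrightarrow>
        (\<forall>\<omega>\<in>space (P x). incseq (\<lambda>n. T n \<omega>)) \<longrightarrow>
        (AE \<omega> in P x. (SUP n. T n \<omega>) < lifetime S X \<omega> \<longrightarrow>
           limitin (E_top S) (\<lambda>n. at_time X (T n) \<omega>)
             (at_time X (\<lambda>\<omega>. SUP n. T n \<omega>) \<omega>) sequentially))"

text \<open>
  Starting on the boundary, the process does not move. Otherwise it is frozen from its lifetime on,
  at \<open>0\<close> or at \<open>\<infinity>\<close>. A continuous exit is governed by the left limit: an exit through
  \<open>\<partial>S \<union> {0}\<close> leads to \<open>0\<close>, an explosion to \<open>\<infinity>\<close>. When the process leaves by a jump from an
  interior point, the place to which it would have jumped is only recorded by its final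
  position, \<open>0\<close> or \<open>\<infinity>\<close>.
\<close>

definition absorbed ::
  "(real ^ 'n) set \<Rightarrow> ((real ^ 'n) option \<Rightarrow> 'w measure)
     \<Rightarrow> (real \<Rightarrow> 'w \<Rightarrow> (real ^ 'n) option) \<Rightarrow> bool" where
  "absorbed S P X \<longleftrightarrow>
     (\<forall>x\<in>E_bd S. AE \<omega> in P x. \<forall>t\<ge>0. X t \<omega> = x) \<and>
     (\<forall>x\<in>E_int S. AE \<omega> in P x. lifetime S X \<omega> < \<infinity> \<longrightarrow>
        at_time X (lifetime S X) \<omega> \<in> {Some 0, None} \<and>
        (\<forall>t\<ge>0. lifetime S X \<omega> \<le> ennreal t \<longrightarrow> X t \<omega> = at_time X (lifetime S X) \<omega>) \<and>
        (\<forall>l\<in>E_bd S.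
           limitin (E_top S) (\<lambda>s. X s \<omega>) l (at_left (enn2real (lifetime S X \<omega>))) \<longrightarrow>
           at_time X (lifetime S X) \<omega> = (if l = None then None else Some 0)))"

definition irreducible_process ::
  "(real ^ 'n) set \<Rightarrow> ((real ^ 'n) option \<Rightarrow> 'w measure)
     \<Rightarrow> (real \<Rightarrow> 'w \<Rightarrow> (real ^ 'n) option) \<Rightarrow> bool" where
  "irreducible_process S P X \<longleftrightarrow>
     (\<forall>x\<in>E_int S. \<forall>U. openin (E_top S) U \<and> U \<noteq> {} \<longrightarrow>
        0 < emeasure (completion (P x)) {\<omega> \<in> space (P x). \<exists>t\<ge>0. X t \<omega> \<in> U})"

definition standard_process ::
  "(real ^ 'n) set \<Rightarrow> 'w measure \<Rightarrow> ((real ^ 'n) option \<Rightarrow> 'w measure)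
     \<Rightarrow> (real \<Rightarrow> 'w \<Rightarrow> (real ^ 'n) option) \<Rightarrow> bool" where
  "standard_process S M P X \<longleftrightarrow>
     (\<forall>x\<in>E_set S. prob_space (P x) \<and> sets (P x) = sets M) \<and>
     (\<forall>t\<ge>0. X t \<in> measurable M (E_borel S)) \<and>
     (\<forall>t\<ge>0. \<forall>A\<in>sets (E_borel S).
        (\<lambda>x. emeasure (P x) {\<omega> \<in> space M. X t \<omega> \<in> A}) \<in> borel_measurable (E_borel S)) \<and>
     (\<forall>x\<in>E_set S. AE \<omega> in P x. X 0 \<omega> = x) \<and>
     (\<forall>x\<in>E_set S. AE \<omega> in P x. \<forall>t\<ge>0.
        limitin (E_top S) (\<lambda>s. X s \<omega>) (X t \<omega>) (at_right t)) \<and>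
     (\<forall>x\<in>E_set S. AE \<omega> in P x. \<forall>t>0. ennreal t < lifetime S X \<omega> \<longrightarrow>
        (\<exists>l. limitin (E_top S) (\<lambda>s. X s \<omega>) l (at_left t))) \<and>
     strong_markov S P X \<and>
     quasi_left_continuous S P X \<and>
     absorbed S P X \<and>
     irreducible_process S P X"

definition excessive ::
  "(real ^ 'n) set \<Rightarrow> ((real ^ 'n) option \<Rightarrow> 'w measure)
     \<Rightarrow> (real \<Rightarrow> 'w \<Rightarrow> (real ^ 'n) option) \<Rightarrow> ((real ^ 'n) option \<Rightarrow> ennreal) \<Rightarrow> bool" where
  "excessive S P X h \<longleftrightarrow>
     h \<in> borel_measurable (E_borel S) \<and>
     (\<forall>x\<in>E_set S. \<forall>t\<ge>0. (\<integral>\<^sup>+\<omega>. h (X t \<omega>) \<partial>P x) \<le> h x) \<and>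
     (\<forall>x\<in>E_set S. ((\<lambda>t. \<integral>\<^sup>+\<omega>. h (X t \<omega>) \<partial>P x) \<longlongrightarrow> h x) (at_right 0))"

definition E_h :: "(real ^ 'n) set \<Rightarrow> ((real ^ 'n) option \<Rightarrow> ennreal) \<Rightarrow> (real ^ 'n) option set" where
  "E_h S h = {x \<in> E_set S. 0 < h x \<and> h x < \<infinity>}"

text \<open>The semigroup of \<open>X\<close> killed on exiting \<open>U\<close>, as an operator on functions.\<close>

definition killed_semigroup ::
  "('e \<Rightarrow> 'w measure) \<Rightarrow> (real \<Rightarrow> 'w \<Rightarrow> 'e) \<Rightarrow> 'e set
     \<Rightarrow> real \<Rightarrow> ('e \<Rightarrow> ennreal) \<Rightarrow> 'e \<Rightarrow> ennreal" where
  "killed_semigroup P X U t g x =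
     (\<integral>\<^sup>+\<omega>\<in>{\<omega>. ennreal t < exit_time X U \<omega>}. g (X t \<omega>) \<partial>completion (P x))"

text \<open>
  The semigroup \<open>P\<^sup>h\<^sub>t g (x) = h(x)\<inverse> Q\<^sup>h\<^sub>t (h g) (x)\<close> of the Doob transform, with \<open>Q\<^sup>h\<close> killed on
  exiting \<open>E_h\<close>; the Doob transform is killed, in addition, on exiting \<open>U\<close>.
  The choice \<open>U = E\<close> gives the Doob transform itself.
\<close>

definition doob_semigroup ::
  "(real ^ 'n) set \<Rightarrow> ((real ^ 'n) option \<Rightarrow> 'w measure)
     \<Rightarrow> (real \<Rightarrow> 'w \<Rightarrow> (real ^ 'n) option) \<Rightarrow> ((real ^ 'n) option \<Rightarrow> ennreal)
     \<Rightarrow> (real ^ 'n) option set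
     \<Rightarrow> real \<Rightarrow> ((real ^ 'n) option \<Rightarrow> ennreal) \<Rightarrow> (real ^ 'n) option \<Rightarrow> ennreal" where
  "doob_semigroup S P X h U t g x =
     (if x \<in> E_h S h
      then killed_semigroup P X (E_h S h \<inter> U) t (\<lambda>y. h y * g y) x / h x
      else 0)"

text \<open>
  Finite-dimensional distributions of the (sub-)Markov process with semigroup \<open>K\<close>, started at
  time \<open>s\<close> in \<open>x\<close>: the probability to be alive and in \<open>A\<close> at time \<open>t\<close>, for all \<open>(t, A)\<close> in
  the list, whose times increase.
\<close>

primrec semigroup_fdd ::
  "(real \<Rightarrow> ('e \<Rightarrow> ennreal) \<Rightarrow> 'e \<Rightarrow> ennreal) \<Rightarrow> (real \<times> 'e set) list \<Rightarrow> real \<Rightarrow> 'e \<Rightarrow> ennreal"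
where
  "semigroup_fdd K [] s x = 1"
| "semigroup_fdd K (p # ps) s x =
     K (fst p - s) (\<lambda>y. indicator (snd p) y * semigroup_fdd K ps (fst p) y) x"

text \<open>
  The function \<open>v\<close> is given on the interior of \<open>E\<close> only (it typically vanishes or explodes at
  \<open>0\<close> and \<open>\<infinity>\<close>), so the additive functional does not grow after the lifetime.
\<close>

definition additive_functional ::
  "(real ^ 'n) set \<Rightarrow> (real \<Rightarrow> 'w \<Rightarrow> (real ^ 'n) option) \<Rightarrow> ((real ^ 'n) option \<Rightarrow> real)
     \<Rightarrow> ennreal \<Rightarrow> 'w \<Rightarrow> ennreal" where
  "additive_functional S X v u \<omega> =
     (\<integral>\<^sup>+s\<in>{s. 0 \<le> s \<and> ennreal s \<le> u \<and> ennreal s < lifetime S X \<omega>}.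
        ennreal (1 / v (X s \<omega>)) \<partial>lborel)"

definition inverse_functional ::
  "(real ^ 'n) set \<Rightarrow> (real \<Rightarrow> 'w \<Rightarrow> (real ^ 'n) option) \<Rightarrow> ((real ^ 'n) option \<Rightarrow> real)
     \<Rightarrow> real \<Rightarrow> 'w \<Rightarrow> ennreal" where
  "inverse_functional S X v t \<omega> = Inf {u. ennreal t < additive_functional S X v u \<omega>}"

text \<open>
  As \<open>E\<close> is a topological space, an involution of \<open>E\<close> is a continuous one. The processes
  \<open>I (X\<^bsub>\<gamma> t\<^esub>)\<close>, with lifetime \<open>A\<^sub>\<zeta>\<close>, and \<open>X\<^sup>h\<close>, killed when it exits the interior of \<open>E\<close>, have the
  same law: their finite-dimensional distributions before death agree.
\<close>

definition inversion_property ::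
  "(real ^ 'n) set \<Rightarrow> ((real ^ 'n) option \<Rightarrow> 'w measure)
     \<Rightarrow> (real \<Rightarrow> 'w \<Rightarrow> (real ^ 'n) option)
     \<Rightarrow> ((real ^ 'n) option \<Rightarrow> (real ^ 'n) option) \<Rightarrow> ((real ^ 'n) option \<Rightarrow> ennreal)
     \<Rightarrow> ((real ^ 'n) option \<Rightarrow> real) \<Rightarrow> bool" where
  "inversion_property S P X I h v \<longleftrightarrow>
     continuous_map (E_top S) (E_top S) I \<and>
     (\<forall>x\<in>E_set S. I (I x) = x) \<and>
     (\<exists>x\<in>E_set S. I x \<noteq> x) \<and>
     excessive S P X h \<and>
     (\<forall>x\<in>E_int S. 0 < h x \<and> h x < \<infinity>) \<and>
     continuous_map (subtopology (E_top S) (E_int S)) euclideanreal v \<and>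
     (\<forall>x\<in>E_int S. 0 < v x) \<and>
     (\<forall>x\<in>E_set S. \<forall>ps.
        sorted (map fst ps) \<and> (\<forall>(t, A)\<in>set ps. 0 \<le> t \<and> A \<in> sets (E_borel S)) \<longrightarrow>
        emeasure (completion (P x))
          {\<omega> \<in> space (P x). \<forall>(t, A)\<in>set ps.
             ennreal t < additive_functional S X v (lifetime S X \<omega>) \<omega> \<and>
             I (at_time X (inverse_functional S X v t) \<omega>) \<in> A}
        = semigroup_fdd (doob_semigroup S P X h (E_int S)) ps 0 (I x))"

text \<open>
  Functions are extended real valued and may change sign; the expectation is the difference of the
  integrals of the positive and of the negative part, and exists unless both are infinite.
\<close>

definition has_expectation :: "'w measure \<Rightarrow> ('w \<Rightarrow> ereal) \<Rightarrow> bool" where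
  "has_expectation Q g \<longleftrightarrow>
     (\<integral>\<^sup>+\<omega>. e2ennreal (g \<omega>) \<partial>Q) < \<infinity> \<or> (\<integral>\<^sup>+\<omega>. e2ennreal (- g \<omega>) \<partial>Q) < \<infinity>"

definition ereal_expectation :: "'w measure \<Rightarrow> ('w \<Rightarrow> ereal) \<Rightarrow> ereal" where
  "ereal_expectation Q g =
     enn2ereal (\<integral>\<^sup>+\<omega>. e2ennreal (g \<omega>) \<partial>Q) - enn2ereal (\<integral>\<^sup>+\<omega>. e2ennreal (- g \<omega>) \<partial>Q)"

definition exit_value :: "(real \<Rightarrow> 'w \<Rightarrow> 'e) \<Rightarrow> ('e \<Rightarrow> ereal) \<Rightarrow> 'e set \<Rightarrow> 'w \<Rightarrow> ereal" where
  "exit_value X f B \<omega> =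
     (if exit_time X B \<omega> < \<infinity> then f (at_time X (exit_time X B) \<omega>) else 0)"

text \<open>
  The sets \<open>B\<close> are relatively compact in \<open>D\<close>, with closures taken in \<open>E\<close>. Unless \<open>D\<close> contains the
  point at infinity, these are the bounded open sets \<open>B\<close> with closure contained in \<open>D\<close>, see
  \<open>compactly_contained_iff_bounded\<close> below. If \<open>D\<close> is a neighbourhood of infinity, boundedness in
  \<open>\<real>\<^sup>n\<close> would not be preserved by \<open>I\<close>.
\<close>

definition compactly_contained ::
  "(real ^ 'n) set \<Rightarrow> (real ^ 'n) option set \<Rightarrow> (real ^ 'n) option set \<Rightarrow> bool" where
  "compactly_contained S B D \<longleftrightarrow>
     compactin (E_top S) (E_top S closure_of B) \<and> E_top S closure_of B \<subseteq> D"

definition superharmonic ::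
  "(real ^ 'n) set \<Rightarrow> ((real ^ 'n) option \<Rightarrow> 'w measure)
     \<Rightarrow> (real \<Rightarrow> 'w \<Rightarrow> (real ^ 'n) option) \<Rightarrow> ((real ^ 'n) option \<Rightarrow> ereal)
     \<Rightarrow> (real ^ 'n) option set \<Rightarrow> bool" where
  "superharmonic S P X f D \<longleftrightarrow>
     f \<in> borel_measurable (E_borel S) \<and> openin (E_top S) D \<and>
     (\<forall>B. openin (E_top S) B \<and> compactly_contained S B D \<longrightarrow>
        (\<forall>x\<in>B. has_expectation (completion (P x)) (exit_value X f B) \<and>
               ereal_expectation (completion (P x)) (exit_value X f B) \<le> f x))"

definition regular_harmonic ::
  "(real ^ 'n) set \<Rightarrow> ((real ^ 'n) option \<Rightarrow> 'w measure)
     \<Rightarrow> (real \<Rightarrow> 'w \<Rightarrow> (real ^ 'n) option) \<Rightarrow> ((real ^ 'n) option \<Rightarrow> ereal)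
     \<Rightarrow> (real ^ 'n) option set \<Rightarrow> bool" where
  "regular_harmonic S P X f D \<longleftrightarrow>
     f \<in> borel_measurable (E_borel S) \<and> openin (E_top S) D \<and>
     (\<forall>x\<in>D. has_expectation (completion (P x)) (exit_value X f D) \<and>
            ereal_expectation (completion (P x)) (exit_value X f D) = f x)"

definition kelvin_transform ::
  "('e \<Rightarrow> 'e) \<Rightarrow> ('e \<Rightarrow> ennreal) \<Rightarrow> ('e \<Rightarrow> ereal) \<Rightarrow> 'e \<Rightarrow> ereal" where
  "kelvin_transform I h f x = enn2ereal (h x) * f (I x)"

lemma compactly_contained_iff_bounded:
  fixes S :: "(real ^ 'n) set"
  assumes B: "B \<subseteq> E_set S" and D: "None \<notin> D"
  shows "compactly_contained S B D \<longleftrightarrow>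
         E_top S closure_of B \<subseteq> D \<and> bounded (Some -` B)"
proof
  assume cc: "compactly_contained S B D"
  then have sub: "E_top S closure_of B \<subseteq> D"
    by (simp add: compactly_contained_def)
  with D have "None \<notin> E_top S closure_of B"
    by blast
  moreover have "None \<in> topspace (E_top S)"
    by (simp add: E_top_def)
  ultimately obtain U where U: "openin (E_top S) U" "None \<in> U" "U \<inter> B = {}"
    unfolding in_closure_of by blast
  then obtain C where C: "compactin (top_of_set S) C" "U = insert None (Some ` (S - C))"
    unfolding E_top_def openin_Alexandroff_compactification by auto
  from C have "compact C"
    by (simp add: compactin_subtopology)
  moreover have "Some -` B \<subseteq> C"
    using U(3) B unfolding C(2) E_set_eq by auto
  ultimately have "bounded (Some -` B)"
    using bounded_subset compact_imp_bounded by blast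
  with sub show "E_top S closure_of B \<subseteq> D \<and> bounded (Some -` B)" ..
next
  assume "E_top S closure_of B \<subseteq> D \<and> bounded (Some -` B)"
  moreover have "compact_space (E_top S)"
    unfolding E_top_def by (rule compact_space_Alexandroff_compactification)
  ultimately show "compactly_contained S B D"
    by (simp add: compactly_contained_def closedin_compact_space)
qed

end

theory Submission
  imports Defs
begin

text \<open>
  Write \<open>G\<close> for the interior of \<open>S\<close> without \<open>0\<close>, and let \<open>x \<in> G\<close>, \<open>y = I x\<close>. As \<open>f\<close> vanishes on the
  boundary, only exits from \<open>B\<close> into \<open>G\<close> matter, and the claim reduces to
  \<open>E\<^sub>x (h(X\<^sub>\<tau>) \<phi>(X\<^sub>\<tau>); \<tau> < \<zeta>) = h(x) E\<^sub>y (\<phi>(Y\<^sub>\<tau>); \<tau> < A\<^sub>\<zeta>)\<close>, where \<open>Y\<^sub>t = I(X\<^bsub>\<gamma> t\<^esub>)\<close> and \<open>\<tau>\<close> is the exit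
  time from \<open>B\<close> of the process concerned: as time changes do not affect the place of exit, \<open>Y\<^sub>\<tau>\<close> is
  the image under \<open>I\<close> of the point where \<open>X\<close> leaves \<open>I(B)\<close>.

  The Inversion Property gives this identity with a fixed time \<open>t\<close> in place of \<open>\<tau>\<close>, for all
  functionals of the path up to time \<open>t\<close>. Apply it to \<open>\<phi>(Y\<^sub>t) 1(\<tau> < t \<le> \<tau> + s)\<close> and integrate over \<open>t\<close>:
  the strong Markov property at \<open>\<tau>\<close> turns the left-hand side into the integral over
  \<open>0 < r \<le> s\<close> of \<open>E\<^sub>x (P\<^sub>r(h \<phi>)(X\<^sub>\<tau>))\<close>. By the Inversion Property again, \<open>P\<^sub>r(h \<phi>) \<rightarrow> h \<phi>\<close> as
  \<open>r \<rightarrow> 0\<close> for continuous \<open>\<phi>\<close>, so that no regularity of \<open>h\<close> along paths is needed.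

  To make \<open>\<tau>\<close> a stopping time, exits from \<open>B\<close> are approximated by exits at rational times from an
  exhaustion of \<open>B\<close> by compact sets. By quasi-left-continuity these times increase to \<open>\<tau>\<close>, and before
  its lifetime the path stays locally in compact sets, so that \<open>A\<close> is finite.
\<close>

section \<open>Measures and integrals\<close>

text \<open>The Inversion Property speaks of finite-dimensional distributions only, so an exit time
  is accessible to it only as a functional of countably many coordinates; hence the exits at
  rational times. The obstacle is \<open>h\<close>, which is measurable and excessive: the common
  device of discrete times decreasing to the exit would lead to the limit of \<open>h\<close> along
  the path. Averaging over the time elapsed since the exit leads to the semigroup at small times
  instead.

  The two sides of the identity are not symmetric. For the original process the strong Markov
  property is assumed. For the time-changed process no such property is at hand, but its paths are
  right-continuous and its weight is the constant \<open>h(x)\<close>, so dominated convergence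
  along paths suffices. On the original side a dominating function must first be found: it is
  \<open>h\<close> at the exit point, and its integrability follows from the same averaged identity
  with \<phi> = 1.

  The inversion preserves the boundary of \<open>E\<close>, where the process stands still; starting
  points there are settled separately.\<close>

lemma emeasure_completion_AE_eq:
  assumes ae: "AE w in Q. w \<in> A \<longleftrightarrow> w \<in> B" and B: "B \<in> sets Q" and A: "A \<subseteq> space Q"
  shows "emeasure (completion Q) A = emeasure Q B"
proof -
  have ae': "AE w in completion Q. w \<in> A \<longleftrightarrow> w \<in> B" using AE_completion[OF ae] .
  have "A \<in> sets (completion Q)"
    by (rule completion.in_sets_AE[of B A]) (use ae' A B in auto)
  then have "emeasure (completion Q) A = emeasure (completion Q) B"
    using ae' B by (intro emeasure_eq_AE) auto
  then show ?thesis using B by simp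
qed

lemma nn_integral_tendsto_at_right:
  fixes f :: "real \<Rightarrow> 'a \<Rightarrow> ennreal"
  assumes [measurable]: "\<And>r. 0 < r \<Longrightarrow> f r \<in> borel_measurable Q" "g \<in> borel_measurable Q" "bd \<in> borel_measurable Q"
    and bound: "\<And>r. 0 < r \<Longrightarrow> AE w in Q. f r w \<le> bd w" and fin: "(\<integral>\<^sup>+w. bd w \<partial>Q) < \<infinity>"
    and lim: "AE w in Q. ((\<lambda>r. f r w) \<longlongrightarrow> g w) (at_right 0)"
  shows "((\<lambda>r. \<integral>\<^sup>+w. f r w \<partial>Q) \<longlongrightarrow> (\<integral>\<^sup>+w. g w \<partial>Q)) (at_right 0)"
proof (rule tendsto_at_right_sequentially[where b = 1])
  fix R :: "nat \<Rightarrow> real" assume R: "\<And>n. 0 < R n" "R \<longlonglongrightarrow> 0"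
  then have "filterlim R (at_right 0) sequentially"
    unfolding filterlim_at by (auto intro!: always_eventually simp: less_imp_neq[symmetric])
  note R' = this
  show "(\<lambda>n. \<integral>\<^sup>+w. f (R n) w \<partial>Q) \<longlonglongrightarrow> (\<integral>\<^sup>+w. g w \<partial>Q)"
  proof (rule nn_integral_dominated_convergence[where w = bd])
    show "AE w in Q. (\<lambda>n. f (R n) w) \<longlonglongrightarrow> g w"
      using lim by eventually_elim (rule filterlim_compose[OF _ R'])
  qed (use R fin bound in auto)
qed simp

text \<open>If the limits were in the wrong order, two constants between them would separate the
  functions on some interval \<open>(0,e)\<close>, and the window of length \<open>e / 2\<close>
  would give a contradiction. Applied in both directions, this removes the integration over the time
  elapsed since the exit.\<close>

lemma averages_le:
  fixes f g :: "real \<Rightarrow> ennreal"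
  assumes f: "(f \<longlongrightarrow> a) (at_right 0)" and g: "(g \<longlongrightarrow> b) (at_right 0)"
    and le: "\<And>s. 0 < s \<Longrightarrow> (\<integral>\<^sup>+r\<in>{0<..s}. f r \<partial>lborel) \<le> (\<integral>\<^sup>+r\<in>{0<..s}. g r \<partial>lborel)"
  shows "a \<le> b"
proof (rule ccontr)
  assume "\<not> a \<le> b"
  then have "b < a" by simp
  then obtain d where d: "b < d" "d < a" using dense by blast
  obtain c where c: "b < c" "c < d" using dense d by blast
  have "eventually (\<lambda>r. d < f r \<and> g r < c) (at_right 0)"
    using order_tendstoD(1)[OF f d(2)] order_tendstoD(2)[OF g c(1)] by eventually_elim simp
  then obtain e where e: "0 < e" "\<And>r. 0 < r \<Longrightarrow> r < e \<Longrightarrow> d < f r \<and> g r < c"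
    unfolding eventually_at_right_field by auto
  define s where "s = e / 2"
  have s: "0 < s" "s < e" using e by (auto simp: s_def)
  have "d * ennreal s = (\<integral>\<^sup>+r\<in>{0<..s}. d \<partial>lborel)"
    using s by (subst nn_integral_cmult_indicator) auto
  also have "\<dots> \<le> (\<integral>\<^sup>+r\<in>{0<..s}. f r \<partial>lborel)"
    by (intro nn_integral_mono) (use e(2) s in \<open>auto split: split_indicator intro: less_imp_le\<close>)
  also have "\<dots> \<le> (\<integral>\<^sup>+r\<in>{0<..s}. g r \<partial>lborel)" by (rule le[OF s(1)])
  also have "\<dots> \<le> (\<integral>\<^sup>+r\<in>{0<..s}. c \<partial>lborel)"
    by (intro nn_integral_mono) (use e(2) s in \<open>auto split: split_indicator intro: less_imp_le\<close>)
  also have "\<dots> = c * ennreal s"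
    using s by (subst nn_integral_cmult_indicator) auto
  finally have "d * ennreal s \<le> c * ennreal s" .
  moreover have "c * ennreal s < d * ennreal s"
    using c(2) s by (intro ennreal_mult_strict_right_mono) auto
  ultimately show False by simp
qed

text \<open>The indicator of an open set is the increasing limit of truncated multiples of the
  distance to its complement, and the open sets form a generator stable under intersection.\<close>

lemma finite_borel_measure_eqI:
  fixes \<alpha> \<beta> :: "'a::metric_space measure"
  assumes sets: "sets \<alpha> = sets borel" "sets \<beta> = sets borel"
    and fin: "emeasure \<alpha> UNIV \<noteq> \<infinity>"
    and eq: "\<And>f :: 'a \<Rightarrow> real. continuous_on UNIV f \<Longrightarrow> (\<And>x. 0 \<le> f x \<and> f x \<le> 1) \<Longrightarrow>
       (\<integral>\<^sup>+x. ennreal (f x) \<partial>\<alpha>) = (\<integral>\<^sup>+x. ennreal (f x) \<partial>\<beta>)"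
  shows "\<alpha> = \<beta>"
proof (rule measure_eqI_generator_eq[where E = "{U. open U}" and \<Omega> = UNIV and A = "\<lambda>_. UNIV"])
  show "Int_stable {U::'a set. open U}" by (auto simp: Int_stable_def)
  fix U :: "'a set" assume "U \<in> {U. open U}"
  then have U: "open U" by simp
  \<comment> \<open>\<open>infdist\<close> to the empty set is 0, so the whole space needs its own
    clause.\<close>
  define f where "f n x = (if - U = {} then 1 else min 1 (real n * infdist x (- U)))" for n x
  have nn: "0 \<le> real n * infdist x (- U)" for n x by (simp add: infdist_nonneg)
  have f: "continuous_on UNIV (f n)" "0 \<le> f n x \<and> f n x \<le> 1" for n x
  proof -
    show "continuous_on UNIV (f n)"
      unfolding f_def by (cases "- U = {}") (auto intro!: continuous_intros)
    show "0 \<le> f n x \<and> f n x \<le> 1"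
      unfolding f_def using nn[of n x] by (simp only: split: if_split) simp
  qed
  have "f n x \<le> f (Suc n) x" for n x
  proof (cases "- U = {}")
    case False
    have "real n * infdist x (- U) \<le> real (Suc n) * infdist x (- U)"
      by (rule mult_right_mono) (simp_all add: infdist_nonneg)
    from min.mono[OF order_refl this] show ?thesis unfolding f_def using False by simp
  qed (simp add: f_def)
  then have inc: "incseq (\<lambda>n x. ennreal (f n x))"
    by (intro incseq_SucI le_funI ennreal_leI) auto
  have sup: "(SUP n. ennreal (f n x)) = indicator U x" for x
  proof (cases "x \<in> U")
    case True
    have "\<exists>n. f n x = 1"
    proof (cases "- U = {}")
      case False
      have "infdist x (- U) > 0"
        using True U False infdist_pos_not_in_closed[of "- U" x] by auto
      then obtain n where "1 < real n * infdist x (- U)" using reals_Archimedean3 by blast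
      then show ?thesis using False by (intro exI[of _ n]) (simp add: f_def)
    qed (simp add: f_def)
    then obtain n where "f n x = 1" by blast
    then have "1 \<le> (SUP n. ennreal (f n x))" by (intro SUP_upper2[of n]) auto
    moreover have "(SUP n. ennreal (f n x)) \<le> 1" using f(2) by (intro SUP_least) simp
    ultimately show ?thesis using True by simp
  next
    case False
    then have "f n x = 0" for n by (auto simp: f_def)
    then show ?thesis using False by simp
  qed
  have m: "(\<lambda>x. ennreal (f n x)) \<in> borel_measurable \<alpha>" "(\<lambda>x. ennreal (f n x)) \<in> borel_measurable \<beta>" for n
    using borel_measurable_continuous_onI[OF f(1)[of n]] measurable_cong_sets[OF sets(1) refl] measurable_cong_sets[OF sets(2) refl]
    by (auto intro!: measurable_compose[OF _ measurable_ennreal])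
  have I: "emeasure \<mu> U = (SUP n. \<integral>\<^sup>+x. ennreal (f n x) \<partial>\<mu>)"
    if "sets \<mu> = sets borel" "\<And>n. (\<lambda>x. ennreal (f n x)) \<in> borel_measurable \<mu>" for \<mu>
  proof -
    have "emeasure \<mu> U = (\<integral>\<^sup>+x. (SUP n. ennreal (f n x)) \<partial>\<mu>)"
      using that(1) U by (simp add: sup)
    also have "\<dots> = (SUP n. \<integral>\<^sup>+x. ennreal (f n x) \<partial>\<mu>)"
      by (rule nn_integral_monotone_convergence_SUP[OF inc that(2)])
    finally show ?thesis .
  qed
  show "emeasure \<alpha> U = emeasure \<beta> U"
    using I[OF sets(1) m(1)] I[OF sets(2) m(2)] eq[OF f] by simp
qed (use sets fin in \<open>auto simp: borel_def\<close>)

text \<open>For a fixed outcome the times \<open>t\<close> with \<open>T < t \<le> T + s\<close>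
  form a window of length \<open>s\<close>; Tonelli and the shift \<open>t = T + r\<close> do the
  rest. The window is cut out by \<open>T < t\<close> and \<open>T < t - s\<close> because, for exit
  times, each of these events is decided by the path before \<open>t\<close>. For
  \<open>t < s\<close> the coercion turns \<open>t - s\<close> into 0, and the second event is
  empty.\<close>

lemma window_integral:
  fixes V :: "real \<Rightarrow> 'w \<Rightarrow> ennreal"
  assumes Q: "sigma_finite_measure Q"
    and V: "(\<lambda>p. V (fst p) (snd p)) \<in> borel_measurable (borel \<Otimes>\<^sub>M Q)"
    and T [measurable]: "T \<in> borel_measurable Q"
  shows "(\<integral>\<^sup>+t. (\<integral>\<^sup>+w. V t w * indicator {w. T w < ennreal t \<and> \<not> T w < ennreal (t - s)} w \<partial>Q) \<partial>lborel) =
    (\<integral>\<^sup>+r\<in>{0<..s}. (\<integral>\<^sup>+w. indicator {w. T w < \<infinity>} w * V (enn2real (T w) + r) w \<partial>Q) \<partial>lborel)"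
proof -
  let ?D = "\<lambda>t. {w. T w < ennreal t \<and> \<not> T w < ennreal (t - s)}"
  let ?F = "{w. T w < \<infinity>}"
  interpret sigma_finite_measure Q by fact
  interpret pair_sigma_finite Q lborel ..
  have V1 [measurable]: "(\<lambda>p. V (a p) (b p)) \<in> borel_measurable N"
    if "a \<in> borel_measurable N" "b \<in> N \<rightarrow>\<^sub>M Q" for a b and N :: "'z measure"
  proof -
    have "(\<lambda>p. (a p, b p)) \<in> N \<rightarrow>\<^sub>M borel \<Otimes>\<^sub>M Q" using that by measurable
    from measurable_compose[OF this V] show ?thesis by simp
  qed
  have "(\<integral>\<^sup>+t. (\<integral>\<^sup>+w. V t w * indicator (?D t) w \<partial>Q) \<partial>lborel) =
     (\<integral>\<^sup>+w. (\<integral>\<^sup>+t. V t w * indicator (?D t) w \<partial>lborel) \<partial>Q)"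
  proof (rule Fubini')
    have [measurable]: "(\<lambda>p. V (snd p) (fst p)) \<in> borel_measurable (Q \<Otimes>\<^sub>M lborel)"
      by (rule V1) measurable
    have "(\<lambda>p. V (snd p) (fst p) * indicator {p \<in> space (Q \<Otimes>\<^sub>M lborel). T (fst p) < ennreal (snd p) \<and> \<not> T (fst p) < ennreal (snd p - s)} p) \<in> borel_measurable (Q \<Otimes>\<^sub>M lborel)"
      by measurable
    then show "(\<lambda>(w, t). V t w * indicator (?D t) w) \<in> borel_measurable (Q \<Otimes>\<^sub>M lborel)"
      by (rule measurable_cong[THEN iffD1, rotated]) (auto split: split_indicator simp: space_pair_measure)
  qed
  also have "\<dots> = (\<integral>\<^sup>+w. (\<integral>\<^sup>+r. indicator ?F w * V (enn2real (T w) + r) w * indicator {0<..s} r \<partial>lborel) \<partial>Q)"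
  proof (rule nn_integral_cong)
    fix w assume w: "w \<in> space Q"
    show "(\<integral>\<^sup>+t. V t w * indicator (?D t) w \<partial>lborel) =
      (\<integral>\<^sup>+r. indicator ?F w * V (enn2real (T w) + r) w * indicator {0<..s} r \<partial>lborel)"
    proof (cases "T w" rule: ennreal_cases)
      case (real \<tau>)
      have [measurable]: "(\<lambda>t. V t w) \<in> borel_measurable borel"
        using V1[of "\<lambda>t. t" borel "\<lambda>_. w"] w by simp
      have "(\<integral>\<^sup>+t. V t w * indicator (?D t) w \<partial>lborel) =
         (\<integral>\<^sup>+t. V t w * indicator {\<tau><..\<tau> + s} t \<partial>lborel)"
        using real by (intro nn_integral_cong) (auto simp: ennreal_less_iff split: split_indicator)
      also have "\<dots> = ennreal \<bar>1\<bar> * (\<integral>\<^sup>+r. V (\<tau> + 1 * r) w * indicator {\<tau><..\<tau> + s} (\<tau> + 1 * r) \<partial>lborel)"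
        by (rule nn_integral_real_affine) auto
      also have "\<dots> = (\<integral>\<^sup>+r. indicator ?F w * V (enn2real (T w) + r) w * indicator {0<..s} r \<partial>lborel)"
        using real by (auto intro!: nn_integral_cong split: split_indicator)
      finally show ?thesis .
    qed simp
  qed
  also have "\<dots> = (\<integral>\<^sup>+r. (\<integral>\<^sup>+w. indicator ?F w * V (enn2real (T w) + r) w * indicator {0<..s} r \<partial>Q) \<partial>lborel)"
  proof (rule Fubini'[symmetric])
    have [measurable]: "(\<lambda>p. V (enn2real (T (fst p)) + snd p) (fst p)) \<in> borel_measurable (Q \<Otimes>\<^sub>M lborel)"
      by (rule V1) measurable
    have "(\<lambda>p. indicator {p \<in> space (Q \<Otimes>\<^sub>M lborel). T (fst p) < \<infinity>} p * V (enn2real (T (fst p)) + snd p) (fst p) * indicator {0<..s} (snd p)) \<in> borel_measurable (Q \<Otimes>\<^sub>M lborel)"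
      by measurable
    then show "(\<lambda>(w, r). indicator ?F w * V (enn2real (T w) + r) w * indicator {0<..s} r) \<in> borel_measurable (Q \<Otimes>\<^sub>M lborel)"
      by (rule measurable_cong[THEN iffD1, rotated]) (auto split: split_indicator simp: space_pair_measure)
  qed
  also have "\<dots> = (\<integral>\<^sup>+r\<in>{0<..s}. (\<integral>\<^sup>+w. indicator ?F w * V (enn2real (T w) + r) w \<partial>Q) \<partial>lborel)"
    by (intro nn_integral_cong) (auto split: split_indicator)
  finally show ?thesis .
qed

lemma e2ennreal_mult: "e2ennreal (enn2ereal a * b) = a * e2ennreal b"
proof (cases "0 \<le> b")
  case True
  then have "enn2ereal a * b = enn2ereal (a * e2ennreal b)"
    by (simp add: times_ennreal.rep_eq enn2ereal_e2ennreal)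
  then show ?thesis by simp
next
  case False
  then have "enn2ereal a * b \<le> enn2ereal a * 0" by (intro ereal_mult_left_mono) auto
  then show ?thesis using False by (simp add: e2ennreal_neg)
qed

lemma ennreal_Rats_dense:
  assumes "a < (b::ennreal)" obtains q where "q \<in> \<rat>" "0 < q" "a < ennreal q" "ennreal q < b"
proof -
  obtain r where r: "a < ennreal (real_of_rat r)" "ennreal (real_of_rat r) < b"
    using ennreal_rat_dense[OF assms] by blast
  have "0 < ennreal (real_of_rat r)" using r(1) by (rule le_less_trans[rotated]) simp
  then show ?thesis using that[of "real_of_rat r"] r by (simp add: ennreal_less_zero_iff)
qed

section \<open>Right-continuous paths and their exits\<close>

abbreviation (input) traj :: "('t \<Rightarrow> 'w \<Rightarrow> 'a) \<Rightarrow> 'w \<Rightarrow> 't \<Rightarrow> 'a" where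
  "traj Z w \<equiv> (\<lambda>t. Z t w)"

text \<open>Right-continuity is demanded at all real times, so that joint measurability holds on the
  whole line; the paths to which it is applied are set to 0 before time 0.\<close>

definition rc_path :: "(real \<Rightarrow> 'a::topological_space) \<Rightarrow> bool" where
  "rc_path z \<longleftrightarrow> (\<forall>t. (z \<longlongrightarrow> z t) (at_right t))"

definition absorbed_path :: "'a::zero set \<Rightarrow> (real \<Rightarrow> 'a) \<Rightarrow> bool" where
  "absorbed_path G z \<longleftrightarrow> (\<forall>t\<ge>0. z t \<notin> G \<longrightarrow> (\<forall>s\<ge>t. z s = 0))"

definition exhaustion :: "(nat \<Rightarrow> 'a::topological_space set) \<Rightarrow> 'a set \<Rightarrow> bool" where
  "exhaustion K b \<longleftrightarrow> (\<forall>n. compact (K n) \<and> K n \<subseteq> interior (K (Suc n))) \<and> \<Union>(range K) = b"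

text \<open>
  This is what quasi-left-continuity yields for an exhaustion \<open>K\<close> of \<open>b\<close>. In contrast to the existence
  of left limits, it clearly persists under a continuous time change.
\<close>

definition contained_path ::
  "(nat \<Rightarrow> 'a::topological_space set) \<Rightarrow> 'a set \<Rightarrow> (real \<Rightarrow> 'a) \<Rightarrow> bool" where
  "contained_path K b z \<longleftrightarrow>
     (\<forall>r. (\<forall>s\<in>{0..<r}. z s \<in> b) \<longrightarrow> (\<forall>r'<r. \<exists>n. \<forall>s\<in>{0..<r'}. z s \<in> K n))"

text \<open>Only countably many coordinates enter, so that finite-dimensional distributions
  determine the law of this time. Time 0 is included, unlike in \<open>exit_time\<close>; this is
  harmless for a path that starts in the exhausted set.\<close>

definition rational_exit :: "'a set \<Rightarrow> (real \<Rightarrow> 'a) \<Rightarrow> ennreal" where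
  "rational_exit A z = (INF q\<in>{q\<in>\<rat>. 0 \<le> q}. if z q \<notin> A then ennreal q else \<infinity>)"

text \<open>For right-continuous paths with \<open>contained_path\<close> this is the exit time from
  the union of the \<open>K n\<close>. Without containment it could be smaller, as a path may
  approach the boundary of the union before leaving it.\<close>

definition exit_limit :: "(nat \<Rightarrow> 'a set) \<Rightarrow> (real \<Rightarrow> 'a) \<Rightarrow> ennreal" where
  "exit_limit K z = (SUP n. rational_exit (K n) z)"

text \<open>The value 0 stands for the absence of an exit. As 0 is outside \<open>G\<close>, it
  drops out of every integral that carries \<open>indicator G\<close> or \<open>h0\<close>.\<close>

definition exit_pos :: "(nat \<Rightarrow> 'a::zero set) \<Rightarrow> (real \<Rightarrow> 'a) \<Rightarrow> 'a" where
  "exit_pos K z = (if exit_limit K z < \<infinity> then z (enn2real (exit_limit K z)) else 0)"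

lemma rational_exit_less_iff:
  "rational_exit A z < ennreal r \<longleftrightarrow> (\<exists>q\<in>\<rat>. 0 \<le> q \<and> q < r \<and> z q \<notin> A)"
  unfolding rational_exit_def INF_less_iff by (force simp: ennreal_less_iff)

lemma rational_exit_le: "q \<in> \<rat> \<Longrightarrow> 0 \<le> q \<Longrightarrow> z q \<notin> A \<Longrightarrow> rational_exit A z \<le> ennreal q"
  unfolding rational_exit_def by (intro INF_lower2[of q]) auto

lemma rational_exit_mono: "A \<subseteq> B \<Longrightarrow> rational_exit A z \<le> rational_exit B z"
  unfolding rational_exit_def by (intro INF_mono') auto

text \<open>A rational \<open>r'\<close> strictly below \<open>r\<close> turns the condition on the
  supremum into a countable union of countable intersections in which only the path before
  \<open>r\<close> occurs. Both measurability and adaptedness rest on this form.\<close>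

lemma exit_limit_less_iff:
  "exit_limit K z < ennreal r \<longleftrightarrow>
     (\<exists>r'\<in>\<rat>. r' < r \<and> (\<forall>n. rational_exit (K n) z < ennreal r'))"
proof
  assume "exit_limit K z < ennreal r"
  then obtain q where q: "q \<in> \<rat>" "0 < q" "exit_limit K z < ennreal q" "ennreal q < ennreal r"
    by (rule ennreal_Rats_dense)
  have "rational_exit (K n) z \<le> exit_limit K z" for n unfolding exit_limit_def by (rule SUP_upper) simp
  then have "rational_exit (K n) z < ennreal q" for n using q(3) le_less_trans by blast
  moreover have "q < r" using q(2,4) by (simp add: ennreal_less_iff)
  ultimately show "\<exists>r'\<in>\<rat>. r' < r \<and> (\<forall>n. rational_exit (K n) z < ennreal r')"
    using q(1) by blast
next
  assume "\<exists>r'\<in>\<rat>. r' < r \<and> (\<forall>n. rational_exit (K n) z < ennreal r')"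
  then obtain r' where r': "r' < r" "\<And>n. rational_exit (K n) z < ennreal r'" by blast
  have "0 < ennreal r'" using r'(2)[of 0] by (rule le_less_trans[rotated]) simp
  then have "ennreal r' < ennreal r" using r'(1) by (simp add: ennreal_less_zero_iff ennreal_less_iff)
  moreover have "exit_limit K z \<le> ennreal r'" unfolding exit_limit_def
    by (rule SUP_least) (use r' in \<open>auto intro: less_imp_le\<close>)
  ultimately show "exit_limit K z < ennreal r" by simp
qed

lemma rc_pathD: "rc_path z \<Longrightarrow> (z \<longlongrightarrow> z t) (at_right t)"
  by (simp add: rc_path_def)

lemma rc_path_open:
  fixes z :: "real \<Rightarrow> 'a::topological_space"
  assumes "rc_path z" "open U" "z s \<in> U"
  obtains e where "e > s" "\<And>t. s \<le> t \<Longrightarrow> t < e \<Longrightarrow> z t \<in> U"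
proof -
  have "eventually (\<lambda>t. z t \<in> U) (at_right s)"
    using topological_tendstoD[OF rc_pathD[OF assms(1)] assms(2,3)] .
  then obtain e where "e > s" "\<And>t. s < t \<Longrightarrow> t < e \<Longrightarrow> z t \<in> U"
    unfolding eventually_at_right_field by auto
  then show ?thesis using assms(3) that[of e] by (metis order_le_less)
qed

lemma rc_path_rational:
  fixes z :: "real \<Rightarrow> 'a::topological_space"
  assumes "rc_path z" "open U" "z s \<in> U" "s < r"
  obtains q where "q \<in> \<rat>" "s < q" "q < r" "z q \<in> U"
proof -
  obtain e where e: "e > s" "\<And>t. s \<le> t \<Longrightarrow> t < e \<Longrightarrow> z t \<in> U"
    using rc_path_open[OF assms(1-3)] by blast
  obtain q where "q \<in> \<rat>" "s < q" "q < min e r"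
    using Rats_dense_in_real[of s "min e r"] e(1) assms(4) by auto
  then show ?thesis using that e(2) by auto
qed

lemma exhaustion_mono: "exhaustion K b \<Longrightarrow> m \<le> n \<Longrightarrow> K m \<subseteq> K n"
  unfolding exhaustion_def by (rule lift_Suc_mono_le[of K]) (meson interior_subset subset_trans)+

lemma exhaustion_closed:
  fixes b :: "'a::t2_space set"
  shows "exhaustion K b \<Longrightarrow> closed (K n)"
  unfolding exhaustion_def by (auto intro: compact_imp_closed)

lemma exhaustion_subset: "exhaustion K b \<Longrightarrow> K n \<subseteq> b"
  unfolding exhaustion_def by auto

lemma exhaustion_interior:
  assumes "exhaustion K b" "x \<in> b" obtains n where "x \<in> interior (K n)"
  using assms unfolding exhaustion_def by blast

lemma ex_exhaustion:
  fixes b :: "'a::euclidean_space set"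
  assumes "open b" obtains K where "exhaustion K b"
  using open_Union_compact_subsets[OF assms] unfolding exhaustion_def by metis

text \<open>A path that stays in \<open>b\<close> up to \<open>r\<close> lies in a single
  \<open>K n\<close> up to any \<open>r' < r\<close>, so the rational exit from that
  \<open>K n\<close> is not before \<open>r'\<close>. Conversely, a point outside \<open>b\<close>
  is outside every closed \<open>K n\<close>, and right-continuity moves the time to a rational one
  slightly later.\<close>

lemma exit_limit_less_path:
  fixes z :: "real \<Rightarrow> 'a::t2_space"
  assumes rc: "rc_path z" and K: "exhaustion K b" and cc: "contained_path K b z"
  shows "exit_limit K z < ennreal r \<longleftrightarrow> (\<exists>s\<in>{0..<r}. z s \<notin> b)"
proof
  assume "exit_limit K z < ennreal r"
  then obtain r' where r': "r' < r" "\<And>n. rational_exit (K n) z < ennreal r'"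
    unfolding exit_limit_less_iff by blast
  show "\<exists>s\<in>{0..<r}. z s \<notin> b"
  proof (rule ccontr)
    assume "\<not> ?thesis"
    then obtain n where n: "\<forall>s\<in>{0..<r'}. z s \<in> K n"
      using cc r'(1) unfolding contained_path_def by blast
    show False using r'(2)[of n] n unfolding rational_exit_less_iff by auto
  qed
next
  assume "\<exists>s\<in>{0..<r}. z s \<notin> b"
  then obtain s where s: "0 \<le> s" "s < r" "z s \<notin> b" by auto
  obtain r' where r': "r' \<in> \<rat>" "s < r'" "r' < r" using Rats_dense_in_real s by blast
  have "rational_exit (K n) z < ennreal r'" for n
  proof -
    have "z s \<in> - K n" using exhaustion_subset[OF K, of n] s by auto
    moreover have "open (- K n)" using exhaustion_closed[OF K, of n] by auto
    ultimately obtain q where "q \<in> \<rat>" "s < q" "q < r'" "z q \<in> - K n"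
      using rc_path_rational[OF rc _ _ r'(2)] by metis
    then show ?thesis unfolding rational_exit_less_iff using s by force
  qed
  then show "exit_limit K z < ennreal r" unfolding exit_limit_less_iff using r' by blast
qed

lemma exit_pos_obtain:
  assumes "exit_pos K z \<noteq> 0"
  obtains t where "exit_limit K z = ennreal t" "0 \<le> t" "exit_pos K z = z t"
proof
  show "exit_limit K z = ennreal (enn2real (exit_limit K z))"
    using assms unfolding exit_pos_def by (simp split: if_splits)
  show "exit_pos K z = z (enn2real (exit_limit K z))"
    using assms unfolding exit_pos_def by (simp split: if_splits)
qed simp

lemma exit_limit_eqI:
  fixes z :: "real \<Rightarrow> 'a::t2_space"
  assumes "rc_path z" "exhaustion K b" "contained_path K b z"
    and "0 \<le> t" "z t \<notin> b" "\<And>s. 0 \<le> s \<Longrightarrow> s < t \<Longrightarrow> z s \<in> b"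
  shows "exit_limit K z = ennreal t"
proof -
  note less = exit_limit_less_path[OF assms(1-3)]
  have "exit_limit K z \<ge> ennreal t" using less[of t] assms by (auto simp: not_less[symmetric])
  moreover have "exit_limit K z \<le> ennreal t"
  proof (rule ennreal_le_epsilon)
    fix e :: real assume "0 < e"
    then have "exit_limit K z < ennreal (t + e)" using less[of "t + e"] assms by auto
    then show "exit_limit K z \<le> ennreal t + ennreal e"
      using assms \<open>0 < e\<close> by simp
  qed
  ultimately show ?thesis by auto
qed

lemma exit_limit_eqD:
  fixes z :: "real \<Rightarrow> 'a::t2_space"
  assumes "rc_path z" "exhaustion K b" "contained_path K b z" "open b"
    and "exit_limit K z = ennreal t" "0 \<le> t"
  shows "z t \<notin> b" "\<And>s. 0 \<le> s \<Longrightarrow> s < t \<Longrightarrow> z s \<in> b"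
proof -
  note less = exit_limit_less_path[OF assms(1-3)]
  show b: "z s \<in> b" if "0 \<le> s" "s < t" for s
    using less[of t] assms that by auto
  show "z t \<notin> b"
  proof
    assume "z t \<in> b"
    then obtain e where e: "e > t" "\<And>s. t \<le> s \<Longrightarrow> s < e \<Longrightarrow> z s \<in> b"
      using rc_path_open[OF assms(1) \<open>open b\<close>] by blast
    have "exit_limit K z < ennreal e"
      using e assms by (simp add: ennreal_less_iff)
    then show False using less[of e] b e by (metis atLeastLessThan_iff not_le)
  qed
qed

section \<open>Measurability along right-continuous paths\<close>

lemma rc_path_joint_measurable:
  fixes Z :: "real \<Rightarrow> 'w \<Rightarrow> 'a::metric_space"
  assumes Z: "\<And>t. Z t \<in> borel_measurable M"
    and rc: "\<And>w. rc_path (traj Z w)"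
  shows "(\<lambda>p. Z (fst p) (snd p)) \<in> borel_measurable (borel \<Otimes>\<^sub>M M)"
proof -
  \<comment> \<open>The next dyadic point strictly to the right of \<open>t\<close>: for fixed
    \<open>n\<close> it takes countably many values, and as \<open>n\<close> grows it approaches
    \<open>t\<close> within \<open>at_right t\<close>.\<close>
  define d where "d n t = (real_of_int \<lfloor>2 ^ n * t\<rfloor> + 1) / 2 ^ n" for n :: nat and t :: real
  show ?thesis
  proof (rule borel_measurable_LIMSEQ_metric[where f = "\<lambda>n p. Z (d n (fst p)) (snd p)"])
    fix n :: nat
    have 1: "(\<lambda>p. \<lfloor>(2::real) ^ n * fst p\<rfloor>) \<in> borel \<Otimes>\<^sub>M M \<rightarrow>\<^sub>M count_space UNIV"
      by measurable
    have 2: "(\<lambda>p. Z ((real_of_int k + 1) / 2 ^ n) (snd p)) \<in> borel_measurable (borel \<Otimes>\<^sub>M M)" for k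
      using Z by measurable
    have "(\<lambda>p. Z ((real_of_int \<lfloor>(2::real) ^ n * fst p\<rfloor> + 1) / 2 ^ n) (snd p)) \<in> borel_measurable (borel \<Otimes>\<^sub>M M)"
      by (rule measurable_compose_countable[OF 2 1])
    then show "(\<lambda>p. Z (d n (fst p)) (snd p)) \<in> borel_measurable (borel \<Otimes>\<^sub>M M)"
      by (simp add: d_def)
  next
    fix p :: "real \<times> 'w"
    obtain t w where [simp]: "p = (t, w)" by (cases p)
    have gt: "t < d n t" for n
      unfolding d_def by (simp add: field_simps) linarith
    have le: "d n t \<le> t + (1/2) ^ n" for n
      unfolding d_def by (simp add: field_simps power_divide)
    have "(\<lambda>n. d n t) \<longlonglongrightarrow> t"
    proof (rule tendsto_sandwich[where f = "\<lambda>n. t" and h = "\<lambda>n. t + (1/2) ^ n"])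
      have "(\<lambda>n. t + (1/2::real) ^ n) \<longlonglongrightarrow> t + 0"
        by (intro tendsto_intros LIMSEQ_power_zero) auto
      then show "(\<lambda>n. t + (1/2::real) ^ n) \<longlonglongrightarrow> t" by simp
      show "(\<lambda>n. t) \<longlonglongrightarrow> t" by simp
      show "\<forall>\<^sub>F n in sequentially. t \<le> d n t" using gt by (simp add: less_imp_le)
      show "\<forall>\<^sub>F n in sequentially. d n t \<le> t + (1 / 2) ^ n" using le by simp
    qed
    then have "filterlim (\<lambda>n. d n t) (at_right t) sequentially"
      unfolding filterlim_at using gt by (auto intro!: always_eventually simp: less_imp_neq[symmetric])
    then have "(\<lambda>n. Z (d n t) w) \<longlonglongrightarrow> Z t w"
      by (rule filterlim_compose[OF rc_pathD[OF rc]])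
    then show "(\<lambda>n. Z (d n (fst p)) (snd p)) \<longlonglongrightarrow> Z (fst p) (snd p)"
      by simp
  qed
qed

lemma rc_path_random_time:
  fixes Z :: "real \<Rightarrow> 'w \<Rightarrow> 'a::metric_space"
  assumes "\<And>t. Z t \<in> borel_measurable M" "\<And>w. rc_path (traj Z w)" "T \<in> borel_measurable M"
  shows "(\<lambda>w. Z (T w) w) \<in> borel_measurable M"
proof -
  have "(\<lambda>w. (T w, w)) \<in> M \<rightarrow>\<^sub>M borel \<Otimes>\<^sub>M M" using assms(3) by measurable
  from measurable_compose[OF this rc_path_joint_measurable[OF assms(1,2)]] show ?thesis by simp
qed

lemma rc_path_measurable:
  fixes z :: "real \<Rightarrow> 'a::metric_space"
  assumes "rc_path z" shows "z \<in> borel_measurable borel"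
  using rc_path_random_time[of "\<lambda>t _. z t" borel "\<lambda>t. t"] assms by simp

text \<open>\<open>\<theta>\<close> is continuous on \<open>G\<close> only. Whenever the path is
  outside \<open>G\<close> it is constant for some time to the right, and this replaces continuity
  there.\<close>

lemma tendsto_absorbed_comp:
  fixes \<theta> :: "'a::{zero,t2_space} \<Rightarrow> 'b::{zero,topological_space}"
  assumes rc: "rc_path z" and ab: "absorbed_path G z" and 0: "\<And>t. t < 0 \<Longrightarrow> z t = 0"
    and G: "open G" "continuous_on G \<theta>" "\<theta> 0 = 0" "0 \<notin> G"
  shows "rc_path (\<lambda>t. \<theta> (z t))"
  unfolding rc_path_def
proof
  fix t
  show "((\<lambda>t. \<theta> (z t)) \<longlongrightarrow> \<theta> (z t)) (at_right t)"
  proof (cases "z t \<in> G")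
    case True
    then have "isCont \<theta> (z t)" using G by (simp add: continuous_on_eq_continuous_at)
    then show ?thesis by (rule isCont_tendsto_compose[OF _ rc_pathD[OF rc]])
  next
    case False
    have "eventually (\<lambda>s. z s = z t) (at_right t)"
    proof (cases "t < 0")
      case True
      then show ?thesis unfolding eventually_at_right_field
        by (intro exI[of _ 0]) (auto simp: 0)
    next
      case f: False
      with False ab have "\<forall>s\<ge>t. z s = 0" unfolding absorbed_path_def by (meson not_le)
      then show ?thesis unfolding eventually_at_right_field
        by (intro exI[of _ "t+1"]) auto
    qed
    then have "eventually (\<lambda>s. \<theta> (z s) = \<theta> (z t)) (at_right t)"
      by eventually_elim simp
    then show ?thesis by (rule tendsto_eventually)
  qed
qed

lemma exit_limit_measurable:
  assumes V: "\<And>t. 0 \<le> t \<Longrightarrow> V t \<in> Q \<rightarrow>\<^sub>M borel" and K [measurable]: "\<And>n. K n \<in> sets borel"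
  shows "(\<lambda>w. exit_limit K (\<lambda>t. V t w)) \<in> borel_measurable Q"
  unfolding exit_limit_def rational_exit_def
proof (intro borel_measurable_SUP borel_measurable_INF)
  show "countable {q \<in> \<rat>. 0 \<le> (q::real)}" by (rule countable_subset[OF _ countable_rat]) auto
  fix n and q :: real assume "q \<in> {q \<in> \<rat>. 0 \<le> q}"
  then have [measurable]: "V q \<in> Q \<rightarrow>\<^sub>M borel" using V by simp
  show "(\<lambda>w. if V q w \<notin> K n then ennreal q else \<infinity>) \<in> borel_measurable Q" by measurable
qed auto


lemma exit_pos_measurable:
  fixes V :: "real \<Rightarrow> 'w \<Rightarrow> 'a::{zero,metric_space}"
  assumes V: "\<And>t. V t \<in> borel_measurable Q" "\<And>w. rc_path (traj V w)" and K: "\<And>n. K n \<in> sets borel"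
  shows "(\<lambda>w. exit_pos K (traj V w)) \<in> borel_measurable Q"
proof -
  have [measurable]: "(\<lambda>w. exit_limit K (traj V w)) \<in> borel_measurable Q"
    by (rule exit_limit_measurable[OF V(1) K])
  have [measurable]: "(\<lambda>w. V (enn2real (exit_limit K (traj V w))) w) \<in> borel_measurable Q"
    by (rule rc_path_random_time[OF V]) measurable
  show ?thesis unfolding exit_pos_def by measurable
qed

text \<open>Thanks to the strict inequality the event is decided by the path on
  \<open>[0,r)\<close>; this lets exit times be evaluated on paths restricted to a bounded time
  interval.\<close>

lemma exit_limit_less_cong:
  assumes "\<And>q. 0 \<le> q \<Longrightarrow> q < r \<Longrightarrow> z q = z' q"
  shows "exit_limit K z < ennreal r \<longleftrightarrow> exit_limit K z' < ennreal r"
proof -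
  have "rational_exit (K n) z < ennreal r' \<longleftrightarrow> rational_exit (K n) z' < ennreal r'" if "r' < r" for r' n
    unfolding rational_exit_less_iff using assms that by (auto intro!: bex_cong)
  then show ?thesis unfolding exit_limit_less_iff by auto
qed

lemma exit_limit_PiM:
  fixes K :: "nat \<Rightarrow> 'a::{zero,topological_space} set"
  assumes K: "\<And>n. K n \<in> sets borel" and r: "r \<le> t"
  shows "{\<pi> \<in> space (PiM {0..t} (\<lambda>_. borel)). exit_limit K \<pi> < ennreal r} \<in> sets (PiM {0..t} (\<lambda>_. borel :: 'a measure))"
proof -
  \<comment> \<open>beyond time \<open>r\<close> the path is frozen at \<open>0\<close>, so that only coordinates in \<open>{0..t}\<close> are evaluated\<close>
  let ?V = "\<lambda>q \<pi>. if q < r then \<pi> q else (0::'a)"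
  have m: "?V q \<in> PiM {0..t} (\<lambda>_. borel) \<rightarrow>\<^sub>M borel" if "0 \<le> q" for q
    using that r by (cases "q < r") auto
  have [measurable]: "(\<lambda>\<pi>. exit_limit K (\<lambda>q. ?V q \<pi>)) \<in> borel_measurable (PiM {0..t} (\<lambda>_. borel))"
    by (rule exit_limit_measurable[OF m K])
  have "{\<pi> \<in> space (PiM {0..t} (\<lambda>_. borel)). exit_limit K \<pi> < ennreal r} =
     {\<pi> \<in> space (PiM {0..t} (\<lambda>_. borel)). exit_limit K (\<lambda>q. ?V q \<pi>) < ennreal r}"
  proof (intro Collect_cong conj_cong refl)
    fix \<pi>
    show "exit_limit K \<pi> < ennreal r \<longleftrightarrow> exit_limit K (\<lambda>q. ?V q \<pi>) < ennreal r"
      by (rule exit_limit_less_cong) simp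
  qed
  also have "\<dots> \<in> sets (PiM {0..t} (\<lambda>_. borel))" by measurable
  finally show ?thesis .
qed
text \<open>The indicator of \<open>G\<close> is discontinuous only at points outside the open set
  \<open>G\<close>. From such a point the path never returns to \<open>G\<close>, so the expression
  is constantly 0 from then on.\<close>

lemma absorbed_path_tendsto:
  fixes f :: "'a::{zero,t2_space} \<Rightarrow> real"
  assumes rc: "rc_path z" and ab: "absorbed_path G z" and G: "open G" "0 \<notin> G" and t: "0 \<le> t"
    and f: "continuous_on UNIV f"
  shows "((\<lambda>r. indicator G (z (t + r)) * ennreal (f (z (t + r)))) \<longlongrightarrow> indicator G (z t) * ennreal (f (z t))) (at_right 0)"
proof (cases "z t \<in> G")
  case True
  have "((\<lambda>r. z (t + r)) \<longlongrightarrow> z t) (at_right 0)"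
    using rc_pathD[OF rc, of t] unfolding filterlim_at_right_to_0[of _ _ t] by (simp add: add.commute)
  then have 1: "((\<lambda>r. ennreal (f (z (t + r)))) \<longlongrightarrow> ennreal (f (z t))) (at_right 0)"
    and 2: "eventually (\<lambda>r. z (t + r) \<in> G) (at_right 0)"
    using f True G topological_tendstoD
    by (auto intro!: tendsto_ennrealI continuous_on_tendsto_compose[OF f])
  have "eventually (\<lambda>r. ennreal (f (z (t + r))) = indicator G (z (t + r)) * ennreal (f (z (t + r)))) (at_right 0)"
    using 2 by eventually_elim simp
  then show ?thesis using Lim_transform_eventually[OF 1] True by simp
next
  case False
  then have "z (t + r) \<notin> G" if "0 \<le> r" for r
    using ab t that G(2) unfolding absorbed_path_def by (metis le_add_same_cancel1)
  then have "eventually (\<lambda>r. indicator G (z (t + r)) * ennreal (f (z (t + r))) = indicator G (z t) * ennreal (f (z t))) (at_right 0)"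
    using False unfolding eventually_at_right_field by (intro exI[of _ 1]) auto
  then show ?thesis by (rule tendsto_eventually)
qed

section \<open>Time change of a path\<close>

text \<open>The time change is treated for one deterministic path at a time. Later
  \<open>\<theta>\<close> is \<open>1 / v\<close> extended by 0, \<open>j\<close> is the inversion
  in coordinates of \<open>G\<close>, and \<open>L\<close> is some fixed exhaustion that expresses
  that a living path stays locally in compact sets.\<close>

locale path_clock =
  fixes G :: "'a::euclidean_space set" and \<theta> :: "'a \<Rightarrow> real" and j :: "'a \<Rightarrow> 'a" and L :: "nat \<Rightarrow> 'a set"
  assumes open_G: "open G" and zero_notin: "0 \<notin> G"
    and cont_\<theta>: "continuous_on G \<theta>" and \<theta>_pos: "\<And>x. x \<in> G \<Longrightarrow> 0 < \<theta> x" and \<theta>_0: "\<And>x. x \<notin> G \<Longrightarrow> \<theta> x = 0"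
    and cont_j: "continuous_on G j" and j_in: "\<And>x. x \<in> G \<Longrightarrow> j x \<in> G" and j_j: "\<And>x. x \<in> G \<Longrightarrow> j (j x) = x"
    and exh_L: "exhaustion L G"
begin

definition good :: "(real \<Rightarrow> 'a) \<Rightarrow> bool" where
  "good z \<longleftrightarrow> rc_path z \<and> absorbed_path G z \<and> contained_path L G z \<and> (\<forall>t<0. z t = 0)"

text \<open>As \<open>\<theta>\<close> vanishes off \<open>G\<close>, this is the additive
  functional with no mention of a lifetime.\<close>

definition clock :: "(real \<Rightarrow> 'a) \<Rightarrow> ennreal \<Rightarrow> ennreal" where
  "clock z u = (\<integral>\<^sup>+s\<in>{s. 0 \<le> s \<and> ennreal s \<le> u}. ennreal (\<theta> (z s)) \<partial>lborel)"

definition clock_inv :: "(real \<Rightarrow> 'a) \<Rightarrow> real \<Rightarrow> ennreal" where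
  "clock_inv z t = Inf {u. ennreal t < clock z u}"

definition time_change :: "(real \<Rightarrow> 'a) \<Rightarrow> real \<Rightarrow> 'a" where
  "time_change z t =
     (if 0 \<le> t \<and> ennreal t < clock z \<infinity> then j (z (enn2real (clock_inv z t))) else 0)"

lemma absorbed_mono: "absorbed_path G z \<Longrightarrow> z t \<in> G \<Longrightarrow> 0 \<le> s \<Longrightarrow> s \<le> t \<Longrightarrow> z s \<in> G"
  using zero_notin unfolding absorbed_path_def by metis

lemma rc_\<theta>: "good z \<Longrightarrow> rc_path (\<lambda>t. \<theta> (z t))"
  unfolding good_def
  by (rule tendsto_absorbed_comp[of z G]) (use open_G cont_\<theta> \<theta>_0 zero_notin in auto)

lemma \<theta>_measurable: "good z \<Longrightarrow> (\<lambda>t. ennreal (\<theta> (z t))) \<in> borel_measurable borel"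
  using rc_path_measurable[OF rc_\<theta>] by measurable

lemma clock_mono: "u \<le> u' \<Longrightarrow> clock z u \<le> clock z u'"
  unfolding clock_def by (intro nn_integral_mono) (auto split: split_indicator)

abbreviation "clk z u \<equiv> clock z (ennreal u)"

lemma clock_add:
  assumes "good z" "0 \<le> a" "a \<le> b"
  shows "clk z b = clk z a + (\<integral>\<^sup>+s\<in>{a<..b}. ennreal (\<theta> (z s)) \<partial>lborel)"
proof -
  note [measurable] = \<theta>_measurable[OF assms(1)]
  have 1: "{s. 0 \<le> s \<and> ennreal s \<le> ennreal c} = {0..c}" if "0 \<le> c" for c
    using that by auto
  have "clk z b = (\<integral>\<^sup>+s\<in>{0..a} \<union> {a<..b}. ennreal (\<theta> (z s)) \<partial>lborel)"
    unfolding clock_def using assms by (subst 1) (auto intro!: nn_integral_cong split: split_indicator)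
  also have "\<dots> = (\<integral>\<^sup>+s\<in>{0..a}. ennreal (\<theta> (z s)) \<partial>lborel) + (\<integral>\<^sup>+s\<in>{a<..b}. ennreal (\<theta> (z s)) \<partial>lborel)"
    by (rule nn_integral_disjoint_pair) auto
  also have "(\<integral>\<^sup>+s\<in>{0..a}. ennreal (\<theta> (z s)) \<partial>lborel) = clk z a"
    unfolding clock_def using assms by (subst 1) auto
  finally show ?thesis .
qed

lemma clock_0: "clock z 0 = 0"
proof -
  have "{s::real. 0 \<le> s \<and> ennreal s \<le> 0} = {0}" by auto
  then show ?thesis unfolding clock_def
    by (simp add: nn_integral_null_set)
qed

text \<open>Up to a time \<open>u\<close> at which it is still in \<open>G\<close>, the path ranges
  in one compact set of the exhaustion, and there the continuous rate \<open>\<theta>\<close> is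
  bounded.\<close>

lemma clock_lipschitz:
  assumes z: "good z" and u: "0 \<le> u" "z u \<in> G"
  obtains C where "0 \<le> C" "\<And>a b. 0 \<le> a \<Longrightarrow> a \<le> b \<Longrightarrow> b \<le> u \<Longrightarrow> clk z b \<le> clk z a + ennreal (C * (b - a))"
proof -
  have rc: "rc_path z" and ab: "absorbed_path G z" and cc: "contained_path L G z"
    using z by (auto simp: good_def)
  obtain e where e: "e > u" "\<And>t. u \<le> t \<Longrightarrow> t < e \<Longrightarrow> z t \<in> G"
    using rc_path_open[OF rc open_G u(2)] by blast
  have "\<forall>s\<in>{0..<e}. z s \<in> G"
    using e absorbed_mono[OF ab u(2)] by (metis atLeastLessThan_iff linear)
  \<comment> \<open>Containment provides a compact set only on a strictly shorter interval; the
    midpoint leaves room to include \<open>u\<close> itself.\<close>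
  moreover have m: "u < (u + e) / 2" "(u + e) / 2 < e" using e(1) by auto
  ultimately obtain n where n: "\<forall>s\<in>{0..<(u + e)/2}. z s \<in> L n"
    using cc unfolding contained_path_def by blast
  have "compact (\<theta> ` L n)"
    using exh_L exhaustion_subset[OF exh_L] cont_\<theta>
    by (meson compact_continuous_image continuous_on_subset exhaustion_def)
  then obtain C where C: "\<And>x. x \<in> L n \<Longrightarrow> norm (\<theta> x) \<le> C"
    using compact_imp_bounded[of "\<theta> ` L n"] unfolding bounded_iff by auto
  have "z 0 \<in> L n" using n u m by auto
  then have "0 \<le> C" using C norm_ge_zero order_trans by blast
  moreover have "clk z b \<le> clk z a + ennreal (C * (b - a))"
    if "0 \<le> a" "a \<le> b" "b \<le> u" for a b
  proof -
    have "(\<integral>\<^sup>+s\<in>{a<..b}. ennreal (\<theta> (z s)) \<partial>lborel) \<le> (\<integral>\<^sup>+s\<in>{a<..b}. ennreal C \<partial>lborel)"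
    proof (intro nn_integral_mono)
      fix s
      show "ennreal (\<theta> (z s)) * indicator {a<..b} s \<le> ennreal C * indicator {a<..b} s"
      proof (cases "s \<in> {a<..b}")
        case True
        then have "z s \<in> L n" using n that m by auto
        then have "\<theta> (z s) \<le> C" using C[of "z s"] by auto
        then show ?thesis by (auto intro!: mult_right_mono ennreal_leI)
      qed auto
    qed
    also have "\<dots> = ennreal (C * (b - a))"
      using that \<open>0 \<le> C\<close> by (subst nn_integral_cmult_indicator) (auto simp: ennreal_mult)
    finally show ?thesis unfolding clock_add[OF z that(1,2)] by (rule add_left_mono)
  qed
  ultimately show ?thesis using that by blast
qed

lemma clock_finite:
  assumes "good z" "0 \<le> u" "z u \<in> G" shows "clk z u < \<infinity>"
proof -
  obtain C where "0 \<le> C" "\<And>a b. 0 \<le> a \<Longrightarrow> a \<le> b \<Longrightarrow> b \<le> u \<Longrightarrow> clk z b \<le> clk z a + ennreal (C * (b - a))"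
    using clock_lipschitz[OF assms] by blast
  from this(2)[of 0 u] assms have "clk z u \<le> ennreal (C * u)" by (simp add: clock_0)
  also have "\<dots> < \<infinity>" by simp
  finally show ?thesis .
qed

text \<open>The path remains in \<open>G\<close> for some time after \<open>u\<close>, where the
  rate is positive. The clock at \<open>u\<close> is finite, so adding a positive amount makes it
  strictly larger.\<close>

lemma clock_strict:
  assumes z: "good z" and u: "0 \<le> u" "z u \<in> G" "u < u'"
  shows "clk z u < clock z (ennreal u')"
proof -
  note [measurable] = \<theta>_measurable[OF z]
  have rc: "rc_path z" using z by (auto simp: good_def)
  obtain e where e: "e > u" "\<And>t. u \<le> t \<Longrightarrow> t < e \<Longrightarrow> z t \<in> G"
    using rc_path_open[OF rc open_G u(2)] by blast
  define c where "c = min u' e"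
  have "(\<integral>\<^sup>+s\<in>{u<..u'}. ennreal (\<theta> (z s)) \<partial>lborel) \<noteq> 0"
  proof
    assume "(\<integral>\<^sup>+s\<in>{u<..u'}. ennreal (\<theta> (z s)) \<partial>lborel) = 0"
    then have "AE s in lborel. ennreal (\<theta> (z s)) * indicator {u<..u'} s = 0"
      by (subst (asm) nn_integral_0_iff_AE) auto
    then have "AE s in lborel. s \<notin> {u<..<c}"
    proof eventually_elim
      case (elim s)
      show ?case
      proof
        assume "s \<in> {u<..<c}"
        then have "z s \<in> G" "s \<in> {u<..u'}" using e by (auto simp: c_def)
        then show False using elim \<theta>_pos[of "z s"] by auto
      qed
    qed
    then have "emeasure lborel {u<..<c} = 0"
      using AE_iff_null_sets[of "{u<..<c}" lborel] by auto
    then show False using u e by (simp add: c_def min_def split: if_splits)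
  qed
  then have "0 < (\<integral>\<^sup>+s\<in>{u<..u'}. ennreal (\<theta> (z s)) \<partial>lborel)"
    by (simp add: zero_less_iff_neq_zero)
  then have "clk z u + 0 < clk z u + (\<integral>\<^sup>+s\<in>{u<..u'}. ennreal (\<theta> (z s)) \<partial>lborel)"
    using clock_finite[OF z u(1,2)] by (intro ennreal_add_left_cancel_less[THEN iffD2]) auto
  then show ?thesis
    using clock_add[OF z u(1), of u'] u(3) by simp
qed

text \<open>The difficulty is to find \<open>u\<close> with \<open>z u\<close> still in
  \<open>G\<close>. The integrals over the sets \<open>B n\<close> increase to the total clock, and
  each of them stops some time before death.\<close>

lemma clock_sup:
  assumes z: "good z" and t: "ennreal t < clock z \<infinity>" "0 \<le> t"
  obtains u where "0 \<le> u" "z u \<in> G" "ennreal t < clk z u"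
proof -
  note [measurable] = \<theta>_measurable[OF z]
  have rc: "rc_path z" and ab: "absorbed_path G z" using z by (auto simp: good_def)
  have [measurable]: "z \<in> borel_measurable borel" "G \<in> sets borel"
    using rc_path_measurable[OF rc] open_G by auto
  \<comment> \<open>Times after which the path survives for at least another
    \<open>1 / Suc n\<close>, cut off at \<open>n\<close> to keep the set bounded.\<close>
  define B where "B n = {s. 0 \<le> s \<and> s \<le> real n \<and> z (s + 1 / Suc n) \<in> G}" for n
  let ?f = "\<lambda>n s. ennreal (\<theta> (z s)) * indicator (B n) s"
  have [measurable]: "B n \<in> sets borel" for n
  proof -
    have "B n = {s \<in> space borel. 0 \<le> s \<and> s \<le> real n \<and> z (s + 1 / Suc n) \<in> G}" by (simp add: B_def)
    also have "\<dots> \<in> sets borel" by measurable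
    finally show ?thesis .
  qed
  have "clock z \<infinity> = (\<integral>\<^sup>+s. (SUP n. ?f n s) \<partial>lborel)"
    unfolding clock_def
  proof (intro nn_integral_cong antisym)
    fix s
    show "(SUP n. ?f n s)
        \<le> ennreal (\<theta> (z s)) * indicator {s. 0 \<le> s \<and> ennreal s \<le> \<infinity>} s"
      by (intro SUP_least) (auto simp: B_def split: split_indicator)
    show "ennreal (\<theta> (z s)) * indicator {s. 0 \<le> s \<and> ennreal s \<le> \<infinity>} s
        \<le> (SUP n. ?f n s)"
    proof (cases "0 \<le> s \<and> z s \<in> G")
      case True
      then obtain e where e: "e > s" "\<And>t. s \<le> t \<Longrightarrow> t < e \<Longrightarrow> z t \<in> G"
        using rc_path_open[OF rc open_G] by blast
      obtain n1 where n1: "inverse (real (Suc n1)) < e - s"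
        using reals_Archimedean[of "e - s"] e(1) by auto
      obtain n2 where n2: "s \<le> real n2" using real_arch_simple by blast
      define n where "n = max n1 n2"
      have "1 / real (Suc n) \<le> inverse (real (Suc n1))"
        by (simp add: n_def field_simps)
      then have "s \<in> B n" using True n1 n2 e(2)[of "s + 1 / Suc n"] unfolding B_def
        by (auto simp: n_def)
      then have "ennreal (\<theta> (z s)) \<le> (SUP n. ?f n s)"
        by (intro SUP_upper2[of n]) auto
      then show ?thesis by (auto split: split_indicator)
    next
      case False
      then show ?thesis using \<theta>_0[of "z s"] by (auto split: split_indicator)
    qed
  qed
  also have "\<dots> = (SUP n. \<integral>\<^sup>+s. ?f n s \<partial>lborel)"
  proof (rule nn_integral_monotone_convergence_SUP)
    show "incseq (\<lambda>n s. ?f n s)"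
    proof (rule incseq_SucI, rule le_funI)
      fix n s
      have "z (s + 1 / Suc (Suc n)) \<in> G" if "0 \<le> s" "z (s + 1 / Suc n) \<in> G"
        by (rule absorbed_mono[OF ab that(2)]) (use that in \<open>auto simp: field_simps\<close>)
      then show "?f n s \<le> ?f (Suc n) s"
        by (auto simp: B_def split: split_indicator)
    qed
  qed measurable
  finally have "ennreal t < (SUP n. \<integral>\<^sup>+s. ?f n s \<partial>lborel)"
    using t(1) by metis
  then obtain n where n: "ennreal t < (\<integral>\<^sup>+s. ?f n s \<partial>lborel)"
    unfolding less_SUP_iff by auto
  have ne: "B n \<noteq> {}"
  proof
    assume "B n = {}"
    then show False using n by simp
  qed
  have bdd: "bdd_above (B n)" by (rule bdd_aboveI[of _ "real n"]) (auto simp: B_def)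
  define u where "u = Sup (B n)"
  have le: "s \<le> u" if "s \<in> B n" for s using cSup_upper[OF that bdd] by (simp add: u_def)
  \<comment> \<open>A member of \<open>B n\<close> less than \<open>1 / Suc n\<close> below the
    supremum \<open>u\<close>: the path is alive at \<open>s + 1 / Suc n\<close>, which is beyond
    \<open>u\<close>.\<close>
  obtain s where s: "s \<in> B n" "u - 1 / Suc n < s"
    using less_cSup_iff[OF ne bdd, of "u - 1 / Suc n"] by (auto simp: u_def)
  have "0 \<le> u" using le[OF s(1)] s(1) by (auto simp: B_def)
  moreover have "z u \<in> G"
    by (rule absorbed_mono[OF ab, of "s + 1 / Suc n"]) (use s \<open>0 \<le> u\<close> in \<open>auto simp: B_def\<close>)
  moreover have "ennreal t < clk z u"
  proof -
    have "(\<integral>\<^sup>+s. ?f n s \<partial>lborel) \<le> clk z u"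
      unfolding clock_def using le \<open>0 \<le> u\<close>
      by (intro nn_integral_mono) (auto simp: B_def split: split_indicator)
    then show ?thesis using n by simp
  qed
  ultimately show ?thesis using that by blast
qed

lemma clock_surj:
  assumes z: "good z" and t: "ennreal t < clock z \<infinity>" "0 \<le> t"
  obtains u where "0 \<le> u" "z u \<in> G" "clk z u = ennreal t"
proof -
  have ab: "absorbed_path G z" using z by (auto simp: good_def)
  obtain u1 where u1: "0 \<le> u1" "z u1 \<in> G" "ennreal t < clk z u1"
    using clock_sup[OF z t] .
  obtain C where C: "0 \<le> C" "\<And>a b. 0 \<le> a \<Longrightarrow> a \<le> b \<Longrightarrow> b \<le> u1 \<Longrightarrow> clk z b \<le> clk z a + ennreal (C * (b - a))"
    using clock_lipschitz[OF z u1(1,2)] by blast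
  define f where "f u = enn2real (clk z u)" for u
  have G: "z u \<in> G" if "0 \<le> u" "u \<le> u1" for u using absorbed_mono[OF ab u1(2) that] .
  have f: "clk z u = ennreal (f u)" if "0 \<le> u" "u \<le> u1" for u
    using clock_finite[OF z that(1) G[OF that]] by (simp add: f_def)
  have f0: "0 \<le> f u" for u by (simp add: f_def)
  have lip: "\<bar>f b - f a\<bar> \<le> C * (b - a)" if "0 \<le> a" "a \<le> b" "b \<le> u1" for a b
  proof -
    have "ennreal (f b) \<le> ennreal (f a + C * (b - a))"
      using C(2)[OF that] f[of a] f[of b] that f0 C(1) by simp
    then have "f b \<le> f a + C * (b - a)"
      using f0 C(1) that by (subst (asm) ennreal_le_iff) auto
    moreover have "f a \<le> f b"
      using clock_mono[of "ennreal a" "ennreal b" z] f[of a] f[of b] that f0 by simp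
    ultimately show ?thesis by auto
  qed
  have "continuous_on {0..u1} f"
  proof (rule lipschitz_on_continuous_on[of C])
    show "C-lipschitz_on {0..u1} f"
    proof (rule lipschitz_onI)
      fix x y assume "x \<in> {0..u1}" "y \<in> {0..u1}"
      then show "dist (f x) (f y) \<le> C * dist x y"
        using lip[of x y] lip[of y x] by (cases "x \<le> y") (auto simp: dist_real_def abs_minus_commute)
    qed fact
  qed
  moreover have "f 0 \<le> t" using t by (simp add: f_def clock_0)
  moreover have "t \<le> f u1" using u1(3) f[of u1] u1(1) f0 by (simp add: ennreal_less_iff t)
  ultimately obtain u where u: "0 \<le> u" "u \<le> u1" "f u = t"
    using IVT'[of f 0 t u1] u1(1) by blast
  then show ?thesis using that G f by auto
qed

text \<open>Just after \<open>u\<close> the clock increases strictly, so it exceeds \<open>t\<close>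
  exactly at the times beyond \<open>u\<close>; the generalised inverse is therefore the genuine
  one.\<close>

lemma clock_inv_eq:
  assumes z: "good z" and u: "0 \<le> u" "z u \<in> G" "clk z u = ennreal t"
  shows "clock_inv z t = ennreal u" "ennreal t < clock z \<infinity>"
proof -
  have "{v. ennreal t < clock z v} = {ennreal u<..}"
  proof safe
    fix v assume "ennreal t < clock z v"
    then show "ennreal u < v" using clock_mono[of v "ennreal u" z] u by (auto simp: not_less[symmetric])
  next
    fix v assume "ennreal u < v"
    then obtain bd where bd: "ennreal u < bd" "bd < v" using dense by blast
    have "bd < top" by (rule less_le_trans[OF bd(2)]) simp
    then have "bd = ennreal (enn2real bd)" by simp
    then obtain u' where u': "bd = ennreal u'" "0 \<le> u'" by (metis enn2real_nonneg)
    then have "u < u'" using bd u by (simp add: ennreal_less_iff)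
    have "ennreal t < clock z (ennreal u')" using clock_strict[OF z u(1,2) \<open>u < u'\<close>] u(3) by simp
    also have "\<dots> \<le> clock z v" using bd(2) u'(1) by (intro clock_mono) simp
    finally show "ennreal t < clock z v" .
  qed
  then show "clock_inv z t = ennreal u" unfolding clock_inv_def by simp
  show "ennreal t < clock z \<infinity>"
    using clock_strict[OF z u(1,2), of "u+1"] clock_mono[of "ennreal (u+1)" "\<infinity>" z] u by auto
qed

section \<open>Paths after the time change\<close>

lemma time_change_eq:
  assumes "good z" "0 \<le> u" "z u \<in> G" "clk z u = ennreal t" "0 \<le> t"
  shows "time_change z t = j (z u)"
  using clock_inv_eq[OF assms(1-4)] assms by (simp add: time_change_def)

lemma time_change_in_iff:
  assumes "good z" shows "time_change z t \<in> G \<longleftrightarrow> 0 \<le> t \<and> ennreal t < clock z \<infinity>"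
proof
  assume "0 \<le> t \<and> ennreal t < clock z \<infinity>"
  then obtain u where "0 \<le> u" "z u \<in> G" "clk z u = ennreal t" "0 \<le> t"
    using clock_surj[OF assms] by blast
  then show "time_change z t \<in> G" using time_change_eq[OF assms, of u t] j_in[of "z u"] by simp
qed (use zero_notin in \<open>auto simp: time_change_def split: if_splits\<close>)

lemma time_change_obtain:
  assumes "good z" "time_change z t \<in> G"
  obtains u where "0 \<le> t" "0 \<le> u" "z u \<in> G" "clk z u = ennreal t" "time_change z t = j (z u)"
proof -
  have t: "ennreal t < clock z \<infinity>" "0 \<le> t" using assms(2) unfolding time_change_in_iff[OF assms(1)] by auto
  obtain u where u: "0 \<le> u" "z u \<in> G" "clk z u = ennreal t"
    using clock_surj[OF assms(1) t] .
  show ?thesis using that[OF t(2) u time_change_eq[OF assms(1) u t(2)]] .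
qed

lemma time_change_at:
  assumes "good z" "0 \<le> u" "z u \<in> G"
  obtains t where "0 \<le> t" "clk z u = ennreal t" "time_change z t = j (z u)"
proof -
  have "clk z u = ennreal (enn2real (clk z u))"
    using clock_finite[OF assms] by simp
  from this that[OF enn2real_nonneg this time_change_eq[OF assms this enn2real_nonneg]]
  show ?thesis by blast
qed

lemma clock_less_iff:
  assumes "good z" "0 \<le> u" "z u \<in> G" "clk z u = ennreal t" "0 \<le> t"
    and "0 \<le> u'" "z u' \<in> G" "clock z (ennreal u') = ennreal t'" "0 \<le> t'"
  shows "u < u' \<longleftrightarrow> t < t'"
  using clock_strict[OF assms(1-3), of u'] clock_strict[OF assms(1,6,7), of u] assms
  by (cases u u' rule: linorder_cases) (auto simp: ennreal_less_iff)

lemma absorbed_time_change: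
  assumes "good z" shows "absorbed_path G (time_change z)"
  unfolding absorbed_path_def time_change_in_iff[OF assms]
proof (intro allI impI)
  fix t s :: real assume t: "0 \<le> t" "\<not> (0 \<le> t \<and> ennreal t < clock z \<infinity>)" "t \<le> s"
  then have "clock z \<infinity> \<le> ennreal t" by simp
  also have "\<dots> \<le> ennreal s" using t(3) by (rule ennreal_leI)
  finally show "time_change z s = 0" by (auto simp: time_change_def)
qed

text \<open>During life the clock matches an interval to the right of \<open>u\<close> with one to
  the right of \<open>t\<close>, on which the new path is \<open>j\<close> of the old one; at all
  other times the new path is constant to the right.\<close>

lemma rc_time_change:
  assumes z: "good z" shows "rc_path (time_change z)"
  unfolding rc_path_def
proof
  fix t
  have rc: "rc_path z" using z by (auto simp: good_def)
  consider "time_change z t \<in> G" | "t < 0" | "0 \<le> t" "time_change z t \<notin> G" by linarith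
  then show "(time_change z \<longlongrightarrow> time_change z t) (at_right t)"
  proof cases
    case 1
    obtain u where u: "0 \<le> t" "0 \<le> u" "z u \<in> G" "clk z u = ennreal t" "time_change z t = j (z u)"
      using time_change_obtain[OF z 1] .
    show ?thesis unfolding u(5)
    proof (rule topological_tendstoI)
      fix V assume V: "open V" "j (z u) \<in> V"
      have "isCont j (z u)" using u cont_j open_G by (simp add: continuous_on_eq_continuous_at)
      then have "((\<lambda>s. j (z s)) \<longlongrightarrow> j (z u)) (at_right u)"
        by (rule isCont_tendsto_compose[OF _ rc_pathD[OF rc]])
      from topological_tendstoD[OF this V] topological_tendstoD[OF rc_pathD[OF rc] open_G u(3)]
      have "\<forall>\<^sub>F s in at_right u. j (z s) \<in> V \<and> z s \<in> G" by eventually_elim auto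
      then obtain e where e: "e > u" "\<And>s. u < s \<Longrightarrow> s < e \<Longrightarrow> j (z s) \<in> V \<and> z s \<in> G"
        unfolding eventually_at_right_field by auto
      define c where "c = (u + e) / 2"
      have c: "u < c" "c < e" using e by (auto simp: c_def)
      have c0: "0 \<le> c" "z c \<in> G" using c e u by auto
      obtain t' where t': "0 \<le> t'" "clk z c = ennreal t'" "time_change z t' = j (z c)"
        using time_change_at[OF z c0] .
      have "t < t'" using clock_less_iff[OF z u(2-4,1) c0 t'(2,1)] c by auto
      moreover have "time_change z s \<in> V" if s: "t < s" "s < t'" for s
      proof -
        have "time_change z t' \<in> G" using t' c0 j_in by auto
        then have "time_change z s \<in> G"
          by (rule absorbed_mono[OF absorbed_time_change[OF z]]) (use s u in auto)
        then obtain r where r: "0 \<le> s" "0 \<le> r" "z r \<in> G" "clk z r = ennreal s" "time_change z s = j (z r)"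
          using time_change_obtain[OF z] by blast
        have "u < r" using clock_less_iff[OF z u(2-4,1) r(2-4,1)] s by auto
        moreover have "r < c" using clock_less_iff[OF z r(2-4,1) c0 t'(2,1)] s by auto
        ultimately show ?thesis using e(2)[of r] c r by auto
      qed
      ultimately show "\<forall>\<^sub>F s in at_right t. time_change z s \<in> V"
        unfolding eventually_at_right_field by auto
    qed
  next
    case 2
    have "\<forall>\<^sub>F s in at_right t. time_change z s = time_change z t"
      unfolding eventually_at_right_field using 2 by (intro exI[of _ 0]) (auto simp: time_change_def)
    then show ?thesis by (rule tendsto_eventually)
  next
    case 3
    have "\<forall>s\<ge>t. time_change z s = 0"
      using absorbed_time_change[OF z] 3 unfolding absorbed_path_def by auto
    then have "\<forall>\<^sub>F s in at_right t. time_change z s = time_change z t"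
      unfolding eventually_at_right_field using 3 by (intro exI[of _ "t+1"]) auto
    then show ?thesis by (rule tendsto_eventually)
  qed
qed

text \<open>The clock preserves the order of the times of life and \<open>j\<close> is an
  involution, so a compact set containing the old path up to \<open>u1\<close> becomes one
  containing the new path up to \<open>r'\<close>.\<close>

lemma contained_time_change:
  assumes z: "good z" and b: "b \<subseteq> G" and K: "\<And>n. K n \<subseteq> b"
    and cc: "contained_path (\<lambda>n. j ` K n) (j ` b) z"
  shows "contained_path K b (time_change z)"
  unfolding contained_path_def
proof (intro allI impI)
  fix r r' assume r: "\<forall>s\<in>{0..<r}. time_change z s \<in> b" and r': "r' < r"
  show "\<exists>n. \<forall>s\<in>{0..<r'}. time_change z s \<in> K n"
  proof (cases "0 \<le> r'")
    case True
    \<comment> \<open>An intermediate time produces the strict gap \<open>u1 < u2\<close> that the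
      containment hypothesis on \<open>z\<close> consumes.\<close>
    define r'' where "r'' = (r' + r) / 2"
    have rr: "0 \<le> r'" "r' < r''" "r'' < r" using r' True by (auto simp: r''_def)
    have G1: "time_change z r' \<in> G" and G2: "time_change z r'' \<in> G"
      using r b rr by auto
    obtain u1 where u1: "0 \<le> u1" "z u1 \<in> G" "clk z u1 = ennreal r'"
      using time_change_obtain[OF z G1] .
    obtain u2 where u2: "0 \<le> u2" "z u2 \<in> G" "clk z u2 = ennreal r''"
      using time_change_obtain[OF z G2] .
    have ab: "absorbed_path G z" using z by (auto simp: good_def)
    have "u1 < u2" using clock_less_iff[OF z u1 _ u2] rr by auto
    have "\<forall>u\<in>{0..<u2}. z u \<in> j ` b"
    proof
      fix u assume u: "u \<in> {0..<u2}"
      then have G: "z u \<in> G" "0 \<le> u" using absorbed_mono[OF ab u2(2)] by auto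
      obtain s where s: "0 \<le> s" "clk z u = ennreal s" "time_change z s = j (z u)"
        using time_change_at[OF z G(2,1)] .
      have "s < r''" using clock_less_iff[OF z G(2,1) s(2,1) u2] u rr by auto
      then have "s \<in> {0..<r}" using s rr by auto
      then have "j (z u) \<in> b" using r s(3) by metis
      then show "z u \<in> j ` b" using j_j[OF G(1)] by force
    qed
    then obtain n where n: "\<forall>u\<in>{0..<u1}. z u \<in> j ` K n"
      using cc \<open>u1 < u2\<close> unfolding contained_path_def by blast
    have "\<forall>s\<in>{0..<r'}. time_change z s \<in> K n"
    proof
      fix s assume s: "s \<in> {0..<r'}"
      then have "time_change z s \<in> G" using r rr b by auto
      then obtain u where u: "0 \<le> s" "0 \<le> u" "z u \<in> G" "clk z u = ennreal s" "time_change z s = j (z u)"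
        using time_change_obtain[OF z] by blast
      have "u < u1" using clock_less_iff[OF z u(2-4,1) u1] s rr by auto
      then have "u \<in> {0..<u1}" using u(2) by simp
      then have "z u \<in> j ` K n" using n by blast
      then obtain x where "x \<in> K n" "z u = j x" by blast
      then show "time_change z s \<in> K n" using u j_j[of x] K[of n] b by auto
    qed
    then show ?thesis ..
  qed auto
qed

text \<open>As \<open>j\<close> is an involution of \<open>G\<close>, images under \<open>j\<close>
  are preimages under \<open>j\<close>; continuity thus carries over open sets as well as compact
  ones.\<close>

lemma exhaustion_image:
  assumes "exhaustion K b" "b \<subseteq> G" shows "exhaustion (\<lambda>n. j ` K n) (j ` b)"
proof -
  have "compact (j ` K n)" for n
    using assms cont_j exhaustion_subset[OF assms(1)]
    by (meson compact_continuous_image continuous_on_subset exhaustion_def subset_trans)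
  moreover have "j ` K n \<subseteq> interior (j ` K (Suc n))" for n
  proof -
    have KG: "K n \<subseteq> G" for n using exhaustion_subset[OF assms(1)] assms(2) by blast
    have eq: "j ` interior (K (Suc n)) = G \<inter> j -` interior (K (Suc n))"
    proof (intro equalityI subsetI)
      fix y assume "y \<in> j ` interior (K (Suc n))"
      then obtain x where x: "x \<in> interior (K (Suc n))" "y = j x" by auto
      then have "x \<in> G" using KG interior_subset by blast
      then show "y \<in> G \<inter> j -` interior (K (Suc n))" using x j_in j_j by auto
    next
      fix x assume "x \<in> G \<inter> j -` interior (K (Suc n))"
      then show "x \<in> j ` interior (K (Suc n))" using j_j by (metis IntE imageI vimageE)
    qed
    have "open (j ` interior (K (Suc n)))"
      unfolding eq by (rule continuous_open_preimage[OF cont_j open_G open_interior])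
    moreover have "K n \<subseteq> interior (K (Suc n))" using assms(1) by (auto simp: exhaustion_def)
    ultimately show ?thesis
      by (meson image_mono interior_maximal interior_subset subset_trans)
  qed
  moreover have "(\<Union>n. j ` K n) = j ` b" using assms(1) unfolding exhaustion_def by blast
  ultimately show ?thesis unfolding exhaustion_def by blast
qed

lemma open_image:
  assumes "open b" "b \<subseteq> G" shows "open (j ` b)"
proof -
  have "j ` b = G \<inter> j -` b"
  proof (intro equalityI subsetI)
    fix y assume "y \<in> j ` b"
    then obtain x where "x \<in> b" "y = j x" by auto
    then show "y \<in> G \<inter> j -` b" using assms(2) j_in[of x] j_j[of x] by auto
  next
    fix x assume "x \<in> G \<inter> j -` b"
    then show "x \<in> j ` b" using j_j by (metis IntE imageI vimageE)
  qed
  then show ?thesis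
    using continuous_open_preimage[OF cont_j open_G assms(1)] by simp
qed

text \<open>While the path is alive, the clock sends the exit time of \<open>z\<close> from the
  image of \<open>b\<close> to the exit time of the new path from \<open>b\<close>. Only exits into
  \<open>G\<close> are compared, because after death the clock no longer relates the two
  times.\<close>

lemma exit_pos_time_change:
  assumes z: "good z" and K: "exhaustion K b" and b: "open b" "b \<subseteq> G"
    and cc: "contained_path (\<lambda>n. j ` K n) (j ` b) z"
  shows "exit_pos K (time_change z) \<in> G \<longleftrightarrow> exit_pos (\<lambda>n. j ` K n) z \<in> G"
    and "exit_pos (\<lambda>n. j ` K n) z \<in> G \<Longrightarrow> exit_pos K (time_change z) = j (exit_pos (\<lambda>n. j ` K n) z)"
proof -
  let ?w = "time_change z"
  let ?jK = "\<lambda>n. j ` K n"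
  let ?e = "exit_pos ?jK z"
  have rc: "rc_path z" and ab: "absorbed_path G z" using z by (auto simp: good_def)
  have ccw: "contained_path K b ?w"
    by (rule contained_time_change[OF z b(2) exhaustion_subset[OF K] cc])
  note Kj = exhaustion_image[OF K b(2)]
  have 1: "exit_pos K ?w = j (?e) \<and> exit_pos K ?w \<in> G"
    if G: "?e \<in> G"
  proof -
    have "?e \<noteq> 0" using G zero_notin by auto
    then obtain \<tau> where \<tau>: "exit_limit ?jK z = ennreal \<tau>" "0 \<le> \<tau>" and e: "?e = z \<tau>"
      by (rule exit_pos_obtain)
    then have zG: "z \<tau> \<in> G" using G by simp
    note \<tau>' = exit_limit_eqD[OF rc Kj cc open_image[OF b] \<tau>]
    obtain t where t: "0 \<le> t" "clk z \<tau> = ennreal t" "?w t = j (z \<tau>)"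
      using time_change_at[OF z \<tau>(2) zG] .
    have "exit_limit K ?w = ennreal t"
    proof (rule exit_limit_eqI[OF rc_time_change[OF z] K ccw t(1)])
      show "?w t \<notin> b" using t(3) \<tau>'(1) j_j[OF zG] by force
      fix s assume s: "0 \<le> s" "s < t"
      have "?w t \<in> G" using t j_in zG by auto
      then have "?w s \<in> G" by (rule absorbed_mono[OF absorbed_time_change[OF z]]) (use s in auto)
      then obtain u where u: "0 \<le> s" "0 \<le> u" "z u \<in> G" "clk z u = ennreal s" "?w s = j (z u)"
        using time_change_obtain[OF z] by blast
      have "u < \<tau>" using clock_less_iff[OF z u(2-4,1) \<tau>(2) zG t(2,1)] s by auto
      then have "z u \<in> j ` b" using \<tau>'(2) u by auto
      then show "?w s \<in> b" using u(5) j_j b(2) by auto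
    qed
    then have "exit_pos K ?w = j (z \<tau>)" using t by (simp add: exit_pos_def)
    then show ?thesis using e j_in[OF zG] by simp
  qed
  have 2: "?e \<in> G" if G: "exit_pos K ?w \<in> G"
  proof -
    have "exit_pos K ?w \<noteq> 0" using G zero_notin by auto
    then obtain t where t: "exit_limit K ?w = ennreal t" "0 \<le> t" and e: "exit_pos K ?w = ?w t"
      by (rule exit_pos_obtain)
    then have wG: "?w t \<in> G" using G by simp
    note t' = exit_limit_eqD[OF rc_time_change[OF z] K ccw b(1) t]
    obtain \<tau> where \<tau>: "0 \<le> \<tau>" "z \<tau> \<in> G" "clk z \<tau> = ennreal t" "?w t = j (z \<tau>)"
      using time_change_obtain[OF z wG] .
    have "exit_limit ?jK z = ennreal \<tau>"
    proof (rule exit_limit_eqI[OF rc Kj cc \<tau>(1)])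
      show "z \<tau> \<notin> j ` b" using t'(1) \<tau>(4) j_j b(2) by auto
      fix u assume u: "0 \<le> u" "u < \<tau>"
      then have uG: "z u \<in> G" using absorbed_mono[OF ab \<tau>(2)] by auto
      obtain s where s: "0 \<le> s" "clk z u = ennreal s" "?w s = j (z u)"
        using time_change_at[OF z u(1) uG] .
      have "s < t" using clock_less_iff[OF z u(1) uG s(2,1) \<tau>(1-3) t(2)] u by auto
      then have "?w s \<in> b" using t'(2) s(1) by blast
      then have "j (z u) \<in> b" unfolding s(3) .
      then show "z u \<in> j ` b" using j_j[OF uG] by force
    qed
    then show ?thesis using \<tau> by (simp add: exit_pos_def)
  qed
  show "exit_pos K ?w \<in> G \<longleftrightarrow> ?e \<in> G"
    and "?e \<in> G \<Longrightarrow> exit_pos K ?w = j (?e)"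
    using 1 2 by blast+
qed

end

section \<open>The process in the interior\<close>

locale inverted_process =
  fixes S :: "(real ^ 'n) set"
    and M :: "'w measure"
    and P :: "(real ^ 'n) option \<Rightarrow> 'w measure"
    and X :: "real \<Rightarrow> 'w \<Rightarrow> (real ^ 'n) option"
    and I :: "(real ^ 'n) option \<Rightarrow> (real ^ 'n) option"
    and h :: "(real ^ 'n) option \<Rightarrow> ennreal"
    and v :: "(real ^ 'n) option \<Rightarrow> real"
  assumes std: "standard_process S M P X"
    and inversion: "inversion_property S P X I h v"
begin

abbreviation "Px x \<equiv> P (Some x)"
abbreviation "cP x \<equiv> completion (P x)"
abbreviation "EB \<equiv> E_borel S"
abbreviation "EE x \<equiv> nn_integral (P (Some x))"
abbreviation "rv x \<equiv> borel_measurable (P (Some x))"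
abbreviation "nat_filt x \<equiv> natural_filtration (P x) EB X"
abbreviation "Kel \<equiv> kelvin_transform I h"

definition G :: "(real ^ 'n) set" where "G = interior S - {0}"
definition point :: "(real ^ 'n) option \<Rightarrow> real ^ 'n" where
  "point e = (if e \<in> E_int S then the e else 0)"
text \<open>As \<open>0 \<notin> G\<close>, the origin serves as the cemetery of the process \<open>Z\<close> of interior points.\<close>

definition Z :: "real \<Rightarrow> 'w \<Rightarrow> real ^ 'n" where
  "Z t w = (if 0 \<le> t then point (X t w) else 0)"
definition j :: "real ^ 'n \<Rightarrow> real ^ 'n" where "j x = the (I (Some x))"
definition \<theta> :: "real ^ 'n \<Rightarrow> real" where "\<theta> x = (if x \<in> G then 1 / v (Some x) else 0)"
definition h0 :: "real ^ 'n \<Rightarrow> ennreal" where "h0 x = (if x \<in> G then h (Some x) else 0)"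

lemma open_G: "open G" by (simp add: G_def open_Diff)
lemma zero_notin_G: "0 \<notin> G" by (simp add: G_def)
lemma G_subset: "G \<subseteq> S" using interior_subset by (auto simp: G_def)
lemma E_int_eq: "E_int S = Some ` G" by (simp add: E_int_def G_def)
lemma E_int_subset: "E_int S \<subseteq> E_set S" using G_subset by (auto simp: E_int_eq E_set_eq)
lemma Some_in: "x \<in> G \<Longrightarrow> Some x \<in> E_set S" using E_int_subset E_int_eq by blast

lemma Some_int: "x \<in> G \<Longrightarrow> Some x \<in> E_int S" by (simp add: E_int_eq)

lemma point_Some [simp]: "x \<in> G \<Longrightarrow> point (Some x) = x" by (simp add: point_def E_int_eq)
lemma point_out: "e \<notin> E_int S \<Longrightarrow> point e = 0" by (simp add: point_def)
lemma point_in_iff: "point e \<in> G \<longleftrightarrow> e \<in> E_int S"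
  using zero_notin_G by (auto simp: point_def E_int_eq)
lemma point_eq: "point e \<in> G \<Longrightarrow> e = Some (point e)"
  unfolding point_in_iff by (auto simp: E_int_eq)

lemma Z_eq: "Z t w \<in> G \<Longrightarrow> X t w = Some (Z t w)"
  using zero_notin_G point_eq[of "X t w"] by (auto simp: Z_def split: if_splits)
lemma Z_in_iff: "0 \<le> t \<Longrightarrow> Z t w \<in> G \<longleftrightarrow> X t w \<in> E_int S"
  by (simp add: Z_def point_in_iff)
lemma Z_neg: "t < 0 \<Longrightarrow> Z t w = 0" by (simp add: Z_def)

section \<open>Open and Borel sets of the compactification\<close>

lemma openin_Some: "open U \<Longrightarrow> U \<subseteq> G \<Longrightarrow> openin (E_top S) (Some ` U)"
  unfolding E_top_def openin_Alexandroff_compactification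
  using G_subset open_subset[of U S] by blast

lemma space_E: "space EB = E_set S"
  unfolding E_borel_def E_set_def using openin_subset by (intro space_measure_of) blast

lemma sets_E: "sets EB = sigma_sets (E_set S) {U. openin (E_top S) U}"
  unfolding E_borel_def E_set_def using openin_subset by (intro sets_measure_of) blast

lemma openin_sets: "openin (E_top S) U \<Longrightarrow> U \<in> sets EB"
  unfolding sets_E by auto

lemma E_int_sets [measurable]: "E_int S \<in> sets EB"
  unfolding E_int_eq by (intro openin_sets openin_Some open_G order_refl)

lemma point_measurable [measurable]: "point \<in> EB \<rightarrow>\<^sub>M borel"
proof (rule borel_measurableI)
  fix V :: "(real ^ 'n) set" assume V: "open V"
  have "point -` V \<inter> space EB = Some ` (V \<inter> G) \<union> (if 0 \<in> V then space EB - E_int S else {})"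
  proof (rule set_eqI)
    fix e
    show "e \<in> point -` V \<inter> space EB \<longleftrightarrow>
        e \<in> Some ` (V \<inter> G) \<union> (if 0 \<in> V then space EB - E_int S else {})"
      using point_eq[of e] point_in_iff[of e] point_out[of e] E_int_subset
      by (cases "e \<in> E_int S") (auto simp: space_E E_int_eq)
  qed
  also have "\<dots> \<in> sets EB"
    using openin_sets[OF openin_Some[of "V \<inter> G"]] V open_G sets.compl_sets[OF E_int_sets]
    by (auto intro!: sets.Un)
  finally show "point -` V \<inter> space EB \<in> sets EB" .
qed

lemma Some_sets: "A \<in> sets borel \<Longrightarrow> Some ` (A \<inter> G) \<in> sets EB"
proof -
  assume A: "A \<in> sets borel"
  have "Some ` (A \<inter> G) = point -` (A \<inter> G) \<inter> space EB"
    using E_int_subset zero_notin_G by (auto simp: point_def space_E E_int_eq split: if_splits)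
  also have "\<dots> \<in> sets EB"
    using A open_G by (intro measurable_sets[OF point_measurable]) auto
  finally show ?thesis .
qed

lemma open_Some_vimage:
  assumes "openin (E_top S) U" shows "open (Some -` U \<inter> G)"
proof -
  have "openin (top_of_set S) (Some -` U)"
    using assms unfolding E_top_def openin_Alexandroff_compactification
  proof (elim disjE exE conjE)
    fix C assume C: "closedin (top_of_set S) C" "U = insert None (Some ` (topspace (top_of_set S) - C))"
    then have "Some -` U = topspace (top_of_set S) - C" by auto
    then show ?thesis using C(1) openin_diff[OF openin_topspace C(1)] by simp
  qed (auto simp: vimage_def image_iff)
  then obtain T where T: "open T" "Some -` U = S \<inter> T" unfolding openin_open by auto
  have "Some -` U \<inter> G = T \<inter> G" using T(2) G_subset by auto
  then show ?thesis using T(1) open_G by auto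
qed

lemma Some_measurable:
  assumes "g \<in> borel_measurable EB"
  shows "(\<lambda>x. g (Some x)) \<in> borel_measurable (restrict_space borel G)"
proof (rule measurable_compose[OF _ assms])
  show "Some \<in> restrict_space borel G \<rightarrow>\<^sub>M EB"
    unfolding E_borel_def
  proof (rule measurable_measure_of)
    show "{U. openin (E_top S) U} \<subseteq> Pow (E_set S)" using openin_subset by (auto simp: E_set_def)
    show "Some \<in> space (restrict_space borel G) \<rightarrow> E_set S" using Some_in by (auto simp: space_restrict_space)
    fix U assume "U \<in> {U. openin (E_top S) U}"
    then have "Some -` U \<inter> G \<in> sets (restrict_space borel G)"
      using open_Some_vimage open_G by (auto simp: sets_restrict_space_iff)
    then show "Some -` U \<inter> space (restrict_space borel G) \<in> sets (restrict_space borel G)"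
      by (simp add: space_restrict_space)
  qed
qed

lemma tendsto_point:
  assumes "limitin (E_top S) f l F" "l \<in> E_int S"
  shows "((\<lambda>s. point (f s)) \<longlongrightarrow> point l) F"
proof (rule topological_tendstoI)
  fix V assume V: "open V" "point l \<in> V"
  have "l \<in> Some ` (V \<inter> G)" using assms(2) V(2) point_eq[of l] point_in_iff[of l] by auto
  moreover have "openin (E_top S) (Some ` (V \<inter> G))"
    using V open_G by (intro openin_Some) auto
  ultimately have "eventually (\<lambda>s. f s \<in> Some ` (V \<inter> G)) F"
    using assms(1) unfolding limitin_def by blast
  then show "eventually (\<lambda>s. point (f s) \<in> V) F" by eventually_elim auto
qed

lemma prob_P: "x \<in> E_set S \<Longrightarrow> prob_space (P x)"
  and sets_P: "x \<in> E_set S \<Longrightarrow> sets (P x) = sets M"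
  and X_measurable: "0 \<le> t \<Longrightarrow> X t \<in> M \<rightarrow>\<^sub>M EB"
  and kernel_measurable: "0 \<le> t \<Longrightarrow> A \<in> sets EB \<Longrightarrow>
        (\<lambda>x. emeasure (P x) {w \<in> space M. X t w \<in> A}) \<in> borel_measurable EB"
  and start: "x \<in> E_set S \<Longrightarrow> AE w in P x. X 0 w = x"
  and right_cont: "x \<in> E_set S \<Longrightarrow> AE w in P x. \<forall>t\<ge>0. limitin (E_top S) (\<lambda>s. X s w) (X t w) (at_right t)"
  and strong_markov: "strong_markov S P X"
  and qlc: "quasi_left_continuous S P X"
  and absorbed_bd: "x \<in> E_bd S \<Longrightarrow> AE w in P x. \<forall>t\<ge>0. X t w = x"
  using std unfolding standard_process_def absorbed_def by (auto 0 0)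

lemma absorbed_int: "x \<in> E_int S \<Longrightarrow> AE w in P x. lifetime S X w < \<infinity> \<longrightarrow>
        at_time X (lifetime S X) w \<in> {Some 0, None} \<and>
        (\<forall>t\<ge>0. lifetime S X w \<le> ennreal t \<longrightarrow> X t w = at_time X (lifetime S X) w)"
proof -
  assume "x \<in> E_int S"
  then have "AE w in P x. lifetime S X w < \<infinity> \<longrightarrow>
        at_time X (lifetime S X) w \<in> {Some 0, None} \<and>
        (\<forall>t\<ge>0. lifetime S X w \<le> ennreal t \<longrightarrow> X t w = at_time X (lifetime S X) w) \<and>
        (\<forall>l\<in>E_bd S.
           limitin (E_top S) (\<lambda>s. X s w) l (at_left (enn2real (lifetime S X w))) \<longrightarrow>
           at_time X (lifetime S X) w = (if l = None then None else Some 0))"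
    using std unfolding standard_process_def absorbed_def by blast
  then show ?thesis by eventually_elim blast
qed

lemma space_P: "x \<in> E_set S \<Longrightarrow> space (P x) = space M"
  by (rule sets_eq_imp_space_eq[OF sets_P])

lemma Z_measurable: "Z t \<in> borel_measurable M"
proof (cases "0 \<le> t")
  case True
  then have "Z t = (\<lambda>w. point (X t w))" by (simp add: Z_def fun_eq_iff)
  then show ?thesis using measurable_compose[OF X_measurable[OF True] point_measurable] by simp
next
  case False
  then have "Z t = (\<lambda>w. 0)" by (simp add: Z_def fun_eq_iff)
  then show ?thesis by simp
qed

lemma Z_measurable_P: "x \<in> E_set S \<Longrightarrow> Z t \<in> borel_measurable (P x)"
  using Z_measurable measurable_cong_sets[OF sets_P refl] by blast

lemma AE_path:
  assumes x: "x \<in> G"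
  shows "AE w in Px x. Z 0 w = x \<and> rc_path (traj Z w) \<and> absorbed_path G (traj Z w) \<and>
     (\<forall>t\<ge>0. ennreal t < lifetime S X w \<longleftrightarrow> Z t w \<in> G)"
  using start[OF Some_in[OF x]] right_cont[OF Some_in[OF x]] absorbed_int[OF Some_int[OF x]]
proof eventually_elim
  case (elim w)
  note abs = elim(3)
  have Z0: "Z 0 w = x" using elim(1) x by (simp add: Z_def)
  have le: "lifetime S X w \<le> ennreal t" if t: "0 \<le> t" "Z t w \<notin> G" for t
  proof -
    \<comment> \<open>The infimum in the lifetime runs over strictly positive times; the start in
      \<open>G\<close> excludes 0.\<close>
    have "t \<noteq> 0" using t Z0 x by auto
    then show ?thesis unfolding exit_time_def
      using t Z_in_iff by (intro Inf_lower) auto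
  qed
  have z: "Z t w = 0" if t: "0 \<le> t" "lifetime S X w \<le> ennreal t" for t
  proof -
    have "lifetime S X w < \<infinity>" using t(2) by (simp add: le_less_trans)
    then have "X t w \<in> {Some 0, None}" using abs t by auto
    then show ?thesis using zero_notin_G by (auto simp: Z_def point_def E_int_eq)
  qed
  have life: "\<forall>t\<ge>0. ennreal t < lifetime S X w \<longleftrightarrow> Z t w \<in> G"
    using le z zero_notin_G by (metis not_le)
  have abs: "absorbed_path G (traj Z w)"
    unfolding absorbed_path_def
  proof (intro allI impI)
    fix t s :: real assume t: "0 \<le> t" "Z t w \<notin> G" "t \<le> s"
    show "Z s w = 0"
      using t by (intro z order_trans[OF le[OF t(1,2)]] ennreal_leI) auto
  qed
  have rc: "rc_path (traj Z w)"
    unfolding rc_path_def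
  proof
    fix t
    consider "t < 0" | "0 \<le> t" "Z t w \<in> G" | "0 \<le> t" "Z t w \<notin> G" by linarith
    then show "((traj Z w) \<longlongrightarrow> Z t w) (at_right t)"
    proof cases
      case 1
      then have "eventually (\<lambda>s. Z s w = Z t w) (at_right t)"
        unfolding eventually_at_right_field by (intro exI[of _ 0]) (auto simp: Z_neg)
      then show ?thesis by (rule tendsto_eventually)
    next
      case 2
      then have "((\<lambda>s. point (X s w)) \<longlongrightarrow> point (X t w)) (at_right t)"
        using elim(2) Z_in_iff by (intro tendsto_point) auto
      moreover have "eventually (\<lambda>s. point (X s w) = Z s w) (at_right t)"
        unfolding eventually_at_right_field using 2 by (intro exI[of _ "t+1"]) (auto simp: Z_def)
      ultimately show ?thesis using 2 by (simp add: Z_def[of t]) (erule Lim_transform_eventually)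
    next
      case 3
      then have "\<forall>s\<ge>t. Z s w = 0" using abs unfolding absorbed_path_def by blast
      then have "eventually (\<lambda>s. Z s w = Z t w) (at_right t)"
        unfolding eventually_at_right_field by (intro exI[of _ "t+1"]) auto
      then show ?thesis by (rule tendsto_eventually)
    qed
  qed
  show ?case using Z0 rc abs life by blast
qed

section \<open>Exit times as stopping times of the augmented filtration\<close>

lemma natural_sets:
  assumes x: "x \<in> E_set S" and "0 \<le> s" "s \<le> u" "A \<in> sets EB"
  shows "{w \<in> space M. X s w \<in> A} \<in> sets (nat_filt x u)"
proof -
  have "{w \<in> space M. X s w \<in> A} = X s -` A \<inter> space (P x)" using space_P[OF x] by auto
  then have "{w \<in> space M. X s w \<in> A} \<in> sigma_sets (space (P x)) (\<Union>s\<in>{0..u}. {X s -` A \<inter> space (P x) | A. A \<in> sets EB})"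
    by (rule ssubst, intro sigma_sets.Basic UN_I[of s] CollectI exI[of _ A]) (use assms in auto)
  then show ?thesis unfolding natural_filtration_def by (subst sets_measure_of) auto
qed

lemma natural_sub:
  assumes x: "x \<in> E_set S"
  shows "sets (nat_filt x u) \<subseteq> sets M"
proof -
  have "(\<Union>s\<in>{0..u}. {X s -` A \<inter> space (P x) | A. A \<in> sets EB}) \<subseteq> sets M"
    using X_measurable space_P[OF x] by (auto intro: measurable_sets)
  then show ?thesis unfolding natural_filtration_def
    by (subst sets_measure_of) (auto simp: space_P[OF x] intro!: sets.sigma_sets_subset)
qed

lemma natural_mono:
  assumes x: "x \<in> E_set S" and "u \<le> u'"
  shows "sets (nat_filt x u) \<subseteq> sets (nat_filt x u')"
  unfolding natural_filtration_def
proof (subst (1 2) sets_measure_of)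
  have "{0..u} \<subseteq> {0..u'}" using assms by auto
  then show "sigma_sets (space (P x)) (\<Union>s\<in>{0..u}. {X s -` A \<inter> space (P x) |A. A \<in> sets EB})
      \<subseteq> sigma_sets (space (P x)) (\<Union>s\<in>{0..u'}. {X s -` A \<inter> space (P x) |A. A \<in> sets EB})"
    by (intro sigma_sets_mono' UN_mono) auto
qed auto

lemma space_natural: "space (nat_filt x u) = space (P x)"
  unfolding natural_filtration_def by (rule space_measure_of) auto

abbreviation "aug x \<equiv> augmented_filtration (P x) EB X"

lemma aug_generator: "{A \<in> sets (cP x). \<forall>u::real. t < ennreal u \<longrightarrow>
          (\<exists>B \<in> sets (nat_filt x u).
             (A - B) \<union> (B - A) \<in> null_sets (cP x))} \<subseteq> Pow (space (P x))"
  using sets.sets_into_space[of _ "cP x"] by auto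

lemma filtration_aug: "filtration (space (P x)) (aug x)"
proof
  show "space (aug x t) = space (P x)" for t
    unfolding augmented_filtration_def by (rule space_measure_of[OF aug_generator])
  show "sets (aug x t) \<subseteq> sets (aug x t')" if "t \<le> t'" for t t'
    unfolding augmented_filtration_def sets_measure_of[OF aug_generator]
    by (rule sigma_sets_mono') (use that le_less_trans in blast)
qed

lemma augI:
  assumes x: "x \<in> E_set S" and "A \<in> sets M"
    and "\<And>u. t < ennreal u \<Longrightarrow> A \<in> sets (nat_filt x u)"
  shows "A \<in> sets (aug x t)"
  unfolding augmented_filtration_def sets_measure_of[OF aug_generator]
proof (rule sigma_sets.Basic, safe)
  show "A \<in> sets (cP x)" using assms(2) sets_P[OF x] by auto
  fix u assume "t < ennreal u"
  then show "\<exists>B\<in>sets (nat_filt x u). A - B \<union> (B - A) \<in> null_sets (cP x)"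
    by (intro bexI[of _ A] assms) auto
qed

text \<open>\<open>T \<le> t\<close> is the intersection of the events \<open>T < q\<close> over
  rational \<open>q\<close> in \<open>(t, u]\<close>, hence known at every time after
  \<open>t\<close>. Right-continuity of the augmented filtration then makes \<open>T\<close> a
  stopping time.\<close>

lemma optional_le:
  assumes x: "x \<in> E_set S"
    and T: "\<And>u. {w \<in> space M. T w < ennreal u} \<in> sets (nat_filt x u)"
    and t: "t < ennreal u"
  shows "{w \<in> space M. T w \<le> t} \<in> sets (nat_filt x u)"
proof -
  let ?R = "{q\<in>\<rat>. t < ennreal q \<and> q \<le> u}"
  have dense: "\<exists>q\<in>?R. ennreal q < c" if "t < c" for c
  proof -
    have "t < min c (ennreal u)" using that t by simp
    then obtain q where q: "q \<in> \<rat>" "0 < q" "t < ennreal q" "ennreal q < min c (ennreal u)"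
      by (rule ennreal_Rats_dense)
    then show ?thesis by (intro bexI[of _ q]) (auto simp: ennreal_less_iff)
  qed
  have "{w \<in> space M. T w \<le> t} = (\<Inter>q\<in>?R. {w \<in> space M. T w < ennreal q})"
  proof (intro equalityI subsetI)
    fix w assume w: "w \<in> (\<Inter>q\<in>?R. {w \<in> space M. T w < ennreal q})"
    then have "\<not> t < T w" using dense[of "T w"] by (auto dest: order.asym)
    then show "w \<in> {w \<in> space M. T w \<le> t}" using w dense[OF t] by auto
  qed (auto intro: le_less_trans)
  also have "\<dots> \<in> sets (nat_filt x u)"
  proof (rule sets.countable_INT')
    show "countable ?R" by (rule countable_subset[OF _ countable_rat]) auto
    show "?R \<noteq> {}" using dense[OF t] by auto
    show "(\<lambda>q. {w \<in> space M. T w < ennreal q}) ` ?R \<subseteq> sets (nat_filt x u)"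
      using T natural_mono[OF x] by blast
  qed
  finally show ?thesis .
qed

lemma stopping_time_optional:
  assumes x: "x \<in> E_set S"
    and T: "\<And>u. {w \<in> space M. T w < ennreal u} \<in> sets (nat_filt x u)"
  shows "stopping_time (aug x) T"
    and "T \<in> borel_measurable M"
proof -
  interpret filtration "space (P x)" "aug x" by (rule filtration_aug)
  have [measurable]: "{w \<in> space M. T w < ennreal u} \<in> sets M" for u
    using natural_sub[OF x] T by blast
  show M: "T \<in> borel_measurable M"
  proof (rule borel_measurableI_le)
    fix t
    show "{w \<in> space M. T w \<le> t} \<in> sets M"
    proof (cases "t = top")
      case False
      then have "t < top" by (simp add: less_top)
      then obtain r where "t < ennreal r" by (rule ennreal_Rats_dense)
      then show ?thesis using optional_le[OF x T] natural_sub[OF x] by blast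
    qed simp
  qed
  show "stopping_time (aug x) T"
  proof
    fix t
    show "Measurable.pred (aug x t) (\<lambda>w. T w \<le> t)"
      unfolding pred_def space_F space_P[OF x]
    proof (rule augI[OF x])
      show "{w \<in> space M. T w \<le> t} \<in> sets M" using M by measurable
    qed (rule optional_le[OF x T])
  qed
qed

lemma natural_Z:
  assumes x: "x \<in> E_set S" and "s \<le> u" "A \<in> sets borel" "A \<subseteq> G"
  shows "{w \<in> space M. Z s w \<in> A} \<in> sets (nat_filt x u)"
proof (cases "0 \<le> s")
  case True
  have "Z s w \<in> A \<longleftrightarrow> X s w \<in> Some ` (A \<inter> G)" for w
    using True assms(4) Z_eq[of s w] by (auto simp: Z_def)
  then show ?thesis using natural_sets[OF x True assms(2) Some_sets[OF assms(3)]] by simp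
next
  case False
  then have eq: "{w \<in> space M. Z s w \<in> A} = {}" using assms(4) zero_notin_G by (auto simp: Z_def)
  show ?thesis unfolding eq by (rule sets.empty_sets)
qed

lemma natural_rational_exit:
  assumes x: "x \<in> E_set S" and A: "A \<in> sets borel" "A \<subseteq> G"
  shows "{w \<in> space M. rational_exit A (traj Z w) < ennreal u} \<in> sets (nat_filt x u)"
proof -
  have "{w \<in> space M. rational_exit A (traj Z w) < ennreal u} =
     (\<Union>q\<in>{q\<in>\<rat>. 0 \<le> q \<and> q < u}. space M - {w \<in> space M. Z q w \<in> A})"
    unfolding rational_exit_less_iff by auto
  also have "\<dots> \<in> sets (nat_filt x u)"
  proof (rule sets.countable_UN'')
    show "countable {q \<in> \<rat>. 0 \<le> q \<and> q < u}" by (rule countable_subset[OF _ countable_rat]) auto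
    fix q assume "q \<in> {q \<in> \<rat>. 0 \<le> q \<and> q < u}"
    then have "{w \<in> space M. Z q w \<in> A} \<in> sets (nat_filt x u)"
      by (intro natural_Z[OF x _ A]) auto
    from sets.compl_sets[OF this]
    show "space M - {w \<in> space M. Z q w \<in> A} \<in> sets (nat_filt x u)"
      unfolding space_natural space_P[OF x] .
  qed
  finally show ?thesis .
qed

lemma natural_exit_limit:
  assumes x: "x \<in> E_set S" and A: "\<And>n. K n \<in> sets borel" "\<And>n. K n \<subseteq> G"
  shows "{w \<in> space M. exit_limit K (traj Z w) < ennreal u} \<in> sets (nat_filt x u)"
proof -
  have "{w \<in> space M. exit_limit K (traj Z w) < ennreal u} =
     (\<Union>q\<in>{q\<in>\<rat>. q < u}. \<Inter>n. {w \<in> space M. rational_exit (K n) (traj Z w) < ennreal q})"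
    unfolding exit_limit_less_iff by auto
  also have "\<dots> \<in> sets (nat_filt x u)"
  proof (rule sets.countable_UN'')
    show "countable {q \<in> \<rat>. q < u}" by (rule countable_subset[OF _ countable_rat]) auto
    fix q assume "q \<in> {q \<in> \<rat>. q < u}"
    then have "{w \<in> space M. rational_exit (K n) (traj Z w) < ennreal q} \<in> sets (nat_filt x u)" for n
      using natural_rational_exit[OF x A, of n q] natural_mono[OF x, of q u] by auto
    then show "(\<Inter>n. {w \<in> space M. rational_exit (K n) (traj Z w) < ennreal q}) \<in> sets (nat_filt x u)"
      by (intro sets.countable_INT) auto
  qed
  finally show ?thesis .
qed

lemma exhaustion_borel:
  fixes b :: "(real ^ 'n) set" 
  shows "exhaustion K b \<Longrightarrow> K n \<in> sets borel"
  by (rule borel_closed[OF exhaustion_closed])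

text \<open>Suppose that the path stays in \<open>b\<close> before \<open>r\<close> but has left
  every \<open>K n\<close> before some \<open>r' < r\<close>. The exit times from the
  \<open>K n\<close> increase to some time \<open>\<sigma> \<le> r'\<close>, at which the path is in
  \<open>b\<close> and so alive. By quasi-left-continuity the positions at these times converge to a
  point in the interior of some \<open>K m\<close>; but for large \<open>n\<close> the path leaves
  \<open>K n\<close>, which contains \<open>K m\<close>, at or immediately after the
  \<open>n\<close>-th time.\<close>

lemma AE_contained:
  assumes x: "x \<in> G" and K: "exhaustion K b" and b: "b \<subseteq> G"
  shows "AE w in Px x. contained_path K b (traj Z w)"
proof -
  define T where "T n w = rational_exit (K n) (traj Z w)" for n w
  note xE = Some_in[OF x]
  have KG: "K n \<subseteq> G" for n using exhaustion_subset[OF K] b by blast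
  have "stopping_time (aug (Some x)) (T n)" for n
    unfolding T_def by (rule stopping_time_optional[OF xE natural_rational_exit[OF xE exhaustion_borel[OF K] KG]])
  moreover have "incseq (\<lambda>n. T n w)" for w
    unfolding T_def incseq_def using rational_exit_mono exhaustion_mono[OF K] by blast
  ultimately have "AE w in Px x. (SUP n. T n w) < lifetime S X w \<longrightarrow>
           limitin (E_top S) (\<lambda>n. at_time X (T n) w)
             (at_time X (\<lambda>w. SUP n. T n w) w) sequentially"
    using qlc xE unfolding quasi_left_continuous_def by blast
  then show ?thesis using AE_path[OF x]
  proof eventually_elim
    case (elim w)
    then have rc: "rc_path (traj Z w)" and life: "\<And>t. 0 \<le> t \<Longrightarrow> ennreal t < lifetime S X w \<longleftrightarrow> Z t w \<in> G"
      by auto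
    let ?T = "\<lambda>n. enn2real (T n w)"
    show ?case unfolding contained_path_def
    proof (intro allI impI, rule ccontr)
      fix r r' assume r: "\<forall>s\<in>{0..<r}. Z s w \<in> b" "r' < r" "\<not> (\<exists>n. \<forall>s\<in>{0..<r'}. Z s w \<in> K n)"
      have less: "T n w < ennreal r'" for n
      proof -
        from r(3) obtain s where "s \<in> {0..<r'}" "Z s w \<notin> K n" by blast
        then have s: "0 \<le> s" "s < r'" "Z s w \<in> - K n" by auto
        have "open (- K n)" using exhaustion_closed[OF K] by blast
        then obtain q where "q \<in> \<rat>" "s < q" "q < r'" "Z q w \<in> - K n"
          using rc_path_rational[OF rc _ s(3,2)] by metis
        then show ?thesis unfolding T_def rational_exit_less_iff using s by (intro bexI[of _ q]) auto
      qed
      have "(SUP n. T n w) \<le> ennreal r'" by (intro SUP_least less_imp_le less)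
      moreover have "0 < r'"
        using less[of 0] by (metis ennreal_less_zero_iff le_less_trans zero_le)
      ultimately obtain \<sigma> where \<sigma>: "(SUP n. T n w) = ennreal \<sigma>" "0 \<le> \<sigma>" "\<sigma> \<le> r'"
        by (cases "SUP n. T n w") (auto simp: top_unique)
      have b\<sigma>: "Z \<sigma> w \<in> b" using r \<sigma> by auto
      then have G\<sigma>: "Z \<sigma> w \<in> G" using b by auto
      then have "(SUP n. T n w) < lifetime S X w" using life[OF \<sigma>(2)] \<sigma>(1) by simp
      then have "limitin (E_top S) (\<lambda>n. X (?T n) w) (X \<sigma> w) sequentially"
        using elim(1) \<sigma> by (simp add: at_time_def)
      then have "(\<lambda>n. point (X (?T n) w)) \<longlonglongrightarrow> point (X \<sigma> w)"
        by (rule tendsto_point) (use G\<sigma> Z_in_iff \<sigma> in auto)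
      then have lim: "(\<lambda>n. Z (?T n) w) \<longlonglongrightarrow> Z \<sigma> w"
        using \<sigma> by (simp add: Z_def)
      obtain m where m: "Z \<sigma> w \<in> interior (K m)" using exhaustion_interior[OF K b\<sigma>] .
      obtain N where "\<forall>n\<ge>N. Z (?T n) w \<in> interior (K m)"
        using topological_tendstoD[OF lim open_interior m] unfolding eventually_sequentially by auto
      then obtain n where n: "n \<ge> m" "Z (?T n) w \<in> interior (K m)"
        by (meson nat_le_linear)
      then obtain e where e: "e > ?T n" "\<And>t. ?T n \<le> t \<Longrightarrow> t < e \<Longrightarrow> Z t w \<in> interior (K m)"
        using rc_path_open[OF rc open_interior] by metis
      have Tn: "T n w = ennreal (?T n)"
        using less[of n] by (metis ennreal_enn2real ennreal_less_top less_trans)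
      \<comment> \<open>By right-continuity the path is in \<open>K m\<close> on
        \<open>[T n, e)\<close>, whereas the infimum defining \<open>T n\<close> supplies a rational
        time in this interval at which it is outside \<open>K n\<close>.\<close>
      have "T n w < ennreal e" using e(1) by (subst Tn) (simp add: ennreal_less_iff)
      then obtain q where q: "q \<in> \<rat>" "0 \<le> q" "q < e" "Z q w \<notin> K n"
        unfolding T_def rational_exit_less_iff by auto
      have "T n w \<le> ennreal q" unfolding T_def using q by (intro rational_exit_le)
      then have "?T n \<le> q" using q(2) by (subst (asm) Tn) simp
      then have "Z q w \<in> K m" using e(2) q(3) interior_subset by blast
      then show False using q(4) exhaustion_mono[OF K n(1)] by auto
    qed
  qed
qed

section \<open>The inversion, the excessive function and the rate on the interior\<close>

lemma I_continuous: "continuous_map (E_top S) (E_top S) I"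
  and I_I: "x \<in> E_set S \<Longrightarrow> I (I x) = x"
  and h_excessive: "excessive S P X h"
  and h_pos: "x \<in> E_int S \<Longrightarrow> 0 < h x" and h_finite: "x \<in> E_int S \<Longrightarrow> h x < \<infinity>"
  and v_continuous: "continuous_map (subtopology (E_top S) (E_int S)) euclideanreal v"
  and v_pos: "x \<in> E_int S \<Longrightarrow> 0 < v x"
  and inversion_fdd: "x \<in> E_set S \<Longrightarrow> sorted (map fst ps) \<Longrightarrow> (\<forall>(t, A)\<in>set ps. 0 \<le> t \<and> A \<in> sets EB) \<Longrightarrow>
        emeasure (cP x)
          {w \<in> space (P x). \<forall>(t, A)\<in>set ps.
             ennreal t < additive_functional S X v (lifetime S X w) w \<and>
             I (at_time X (inverse_functional S X v t) w) \<in> A}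
        = semigroup_fdd (doob_semigroup S P X h (E_int S)) ps 0 (I x)"
  using inversion unfolding inversion_property_def by blast+

lemma h_measurable [measurable]: "h \<in> borel_measurable EB"
  using h_excessive by (simp add: excessive_def)

lemma I_in: "x \<in> E_set S \<Longrightarrow> I x \<in> E_set S"
  using continuous_map_image_subset_topspace[OF I_continuous] unfolding E_set_def by blast

lemma I_measurable [measurable]: "I \<in> EB \<rightarrow>\<^sub>M EB"
proof (subst (2) E_borel_def, rule measurable_measure_of)
  show "{U. openin (E_top S) U} \<subseteq> Pow (E_set S)" using openin_subset by (auto simp: E_set_def)
  show "I \<in> space EB \<rightarrow> E_set S" using I_in by (auto simp: space_E)
  fix U assume "U \<in> {U. openin (E_top S) U}"
  then have "openin (E_top S) {x \<in> topspace (E_top S). I x \<in> U}"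
    using I_continuous openin_continuous_map_preimage by blast
  moreover have "{x \<in> topspace (E_top S). I x \<in> U} = I -` U \<inter> space EB"
    by (auto simp: space_E E_set_def)
  ultimately show "I -` U \<inter> space EB \<in> sets EB" using openin_sets by simp
qed

lemma E_bd_iff: "x \<in> E_bd S \<longleftrightarrow> x \<in> E_set S \<and> x \<notin> E_int S" by (simp add: E_bd_def)

lemma h0_measurable [measurable]: "h0 \<in> borel_measurable borel"
proof -
  have "(\<lambda>x. h (Some x) * indicator G x) \<in> borel_measurable borel"
    using Some_measurable[OF h_measurable] open_G
    by (subst (asm) borel_measurable_restrict_space_iff_ennreal) auto
  also have "(\<lambda>x. h (Some x) * indicator G x) = h0"
    by (auto simp: h0_def fun_eq_iff split: split_indicator)
  finally show ?thesis .
qed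

lemma h0_pos: "x \<in> G \<Longrightarrow> 0 < h0 x" and h0_finite: "h0 x < \<infinity>"
  and h0_in: "x \<in> G \<Longrightarrow> h0 x = h (Some x)" and h0_out: "x \<notin> G \<Longrightarrow> h0 x = 0"
  using h_pos[of "Some x"] h_finite[of "Some x"] by (auto simp: h0_def E_int_eq)

lemma boundary_exit:
  assumes "x \<in> E_bd S" shows "AE w in P x. lifetime S X w = 0"
  using absorbed_bd[OF assms]
proof eventually_elim
  case (elim w)
  show ?case
  proof (rule antisym)
    have "lifetime S X w \<le> 0 + ennreal e" if "0 < e" for e :: real
      unfolding exit_time_def using elim assms that by (intro Inf_lower) (auto simp: E_bd_iff)
    then show "lifetime S X w \<le> 0" by (rule ennreal_le_epsilon)
  qed simp
qed

lemma E_h_int: "E_h S h \<inter> E_int S = E_int S"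
  using h_pos h_finite E_int_subset by (auto simp: E_h_def)

text \<open>The factor \<open>h0\<close> vanishes at the cemetery 0, so it carries the killing on
  leaving the interior and no exit time remains in the integrand.\<close>

lemma doob_eq:
  assumes x: "x \<in> G" and t: "0 \<le> t"
  shows "doob_semigroup S P X h (E_int S) t g (Some x) = (EE x (\<lambda>w. h0 (Z t w) * g (Some (Z t w)))) / h0 x"
proof -
  have "Some x \<in> E_h S h" using E_h_int x by (auto simp: E_int_eq)
  then have "doob_semigroup S P X h (E_int S) t g (Some x) = killed_semigroup P X (E_int S) t (\<lambda>y. h y * g y) (Some x) / h0 x"
    using x by (simp add: doob_semigroup_def E_h_int h0_in)
  also have "killed_semigroup P X (E_int S) t (\<lambda>y. h y * g y) (Some x) = EE x (\<lambda>w. h0 (Z t w) * g (Some (Z t w)))"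
    unfolding killed_semigroup_def nn_integral_completion
  proof (rule nn_integral_cong_AE)
    show "AE w in Px x. h (X t w) * g (X t w) * indicator {w. ennreal t < lifetime S X w} w =
      h0 (Z t w) * g (Some (Z t w))"
      using AE_path[OF x]
    proof eventually_elim
      case (elim w)
      then have "ennreal t < lifetime S X w \<longleftrightarrow> Z t w \<in> G" using t by auto
      then show ?case using Z_eq[of t w] by (auto simp: h0_def split: split_indicator)
    qed
  qed
  finally show ?thesis .
qed

text \<open>Evaluate the Inversion Property at time 0. From a boundary point the lifetime is 0, the
  additive functional vanishes, and the time-changed process is dead from the outset. From an
  interior point \<open>I x\<close> the Doob transform would be alive at time 0 with probability
  one.\<close>

lemma I_boundary:
  assumes x: "x \<in> E_bd S" shows "I x \<in> E_bd S"
proof (rule ccontr)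
  assume "I x \<notin> E_bd S"
  have xE: "x \<in> E_set S" using x by (simp add: E_bd_iff)
  then obtain y where y: "I x = Some y" "y \<in> G"
    using \<open>I x \<notin> E_bd S\<close> I_in by (auto simp: E_bd_iff E_int_eq)
  let ?ps = "[(0, E_set S)] :: (real \<times> _ set) list"
  have "AE w in cP x. \<not> (\<forall>(t, A)\<in>set ?ps. ennreal t < additive_functional S X v (lifetime S X w) w \<and>
             I (at_time X (inverse_functional S X v t) w) \<in> A)"
    using AE_completion[OF boundary_exit[OF x]]
    by eventually_elim (simp add: additive_functional_def)
  from emeasure_eq_0_AE[OF this]
  have "semigroup_fdd (doob_semigroup S P X h (E_int S)) ?ps 0 (I x) = 0"
    using inversion_fdd[OF xE, of ?ps] sets.top[of "EB"] by (simp add: space_E)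
  then have "(EE y (\<lambda>w. h0 (Z 0 w) * (indicator (E_set S) (Some (Z 0 w)) * 1))) / h0 y = 0"
    using doob_eq[OF y(2), of 0 "\<lambda>y. indicator (E_set S) y * 1"] y by simp
  moreover have "EE y (\<lambda>w. h0 (Z 0 w) * (indicator (E_set S) (Some (Z 0 w)) * 1)) = EE y (\<lambda>w. h0 y)"
  by (rule nn_integral_cong_AE, use AE_path[OF y(2)] in eventually_elim) (use Some_in[OF y(2)] in auto)
  moreover have "EE y (\<lambda>w. h0 y) = h0 y"
    using prob_space.emeasure_space_1[OF prob_P[OF Some_in[OF y(2)]]] by simp
  ultimately show False using h0_pos[OF y(2)] h0_finite[of y]
    by (auto simp: ennreal_divide_eq_0_iff)
qed

lemma I_interior: "x \<in> E_int S \<Longrightarrow> I x \<in> E_int S"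
  using I_boundary[of "I x"] I_in[of x] I_I[of x] subsetD[OF E_int_subset, of x] by (auto simp: E_bd_iff)

lemma I_Some: "x \<in> G \<Longrightarrow> I (Some x) = Some (j x)" and j_in: "x \<in> G \<Longrightarrow> j x \<in> G"
  using I_interior[of "Some x"] by (auto simp: j_def E_int_eq)

lemma j_j: "x \<in> G \<Longrightarrow> j (j x) = x"
  using I_I[OF Some_in[of x]] I_Some[of x] I_Some[of "j x"] j_in[of x] by simp

lemma continuous_on_preimage:
  fixes f :: "real ^ 'n \<Rightarrow> 'b::topological_space"
  assumes "\<And>V. open V \<Longrightarrow> open {x \<in> G. f x \<in> V}"
  shows "continuous_on G f"
  unfolding continuous_on_open_vimage[OF open_G]
  using assms by (auto simp: vimage_def Int_def conj_commute)

lemma cont_j: "continuous_on G j"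
proof (rule continuous_on_preimage)
  fix V :: "(real ^ 'n) set" assume V: "open V"
  have "openin (E_top S) (Some ` (V \<inter> G))" using V open_G by (intro openin_Some) auto
  then have "openin (E_top S) {x \<in> topspace (E_top S). I x \<in> Some ` (V \<inter> G)}"
    using I_continuous openin_continuous_map_preimage by blast
  then have "open (Some -` {x \<in> topspace (E_top S). I x \<in> Some ` (V \<inter> G)} \<inter> G)"
    by (rule open_Some_vimage)
  also have "Some -` {x \<in> topspace (E_top S). I x \<in> Some ` (V \<inter> G)} \<inter> G = {x \<in> G. j x \<in> V}"
    using I_Some j_in Some_in by (auto simp: E_set_def)
  finally show "open {x \<in> G. j x \<in> V}" .
qed

lemma cont_v: "continuous_on G (\<lambda>x. v (Some x))"
proof (rule continuous_on_preimage)
  fix V :: "real set" assume V: "open V"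
  have "openin (subtopology (E_top S) (E_int S)) {x \<in> topspace (subtopology (E_top S) (E_int S)). v x \<in> V}"
    using openin_continuous_map_preimage[OF v_continuous, of V] V by (simp add: open_openin[symmetric])
  then obtain U where U: "openin (E_top S) U" "{x \<in> topspace (subtopology (E_top S) (E_int S)). v x \<in> V} = U \<inter> E_int S"
    unfolding openin_subtopology by blast
  have "{x \<in> G. v (Some x) \<in> V} = Some -` U \<inter> G"
  proof (rule set_eqI)
    fix x
    show "x \<in> {x \<in> G. v (Some x) \<in> V} \<longleftrightarrow> x \<in> Some -` U \<inter> G"
      using U(2) Some_in[of x] by (auto simp: E_set_def E_int_eq set_eq_iff)
  qed
  then show "open {x \<in> G. v (Some x) \<in> V}" using open_Some_vimage[OF U(1)] by simp
qed

section \<open>Versions with regular paths\<close>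

definition L :: "nat \<Rightarrow> (real ^ 'n) set" where "L = (SOME K. exhaustion K G)"

lemma exhaustion_L: "exhaustion L G"
  unfolding L_def using ex_exhaustion[OF open_G] by (metis someI_ex)

sublocale path_clock G \<theta> j L
proof
  have "v (Some x) \<noteq> 0" if "x \<in> G" for x using v_pos[of "Some x"] that by (auto simp: E_int_eq)
  then have "continuous_on G (\<lambda>x. 1 / v (Some x))" by (intro continuous_intros cont_v) auto
  then show "continuous_on G \<theta>" by (rule continuous_on_eq) (simp add: \<theta>_def)
  show "0 < \<theta> x" if "x \<in> G" for x using v_pos[of "Some x"] that by (simp add: \<theta>_def E_int_eq)
qed (use open_G zero_notin_G cont_j j_in j_j exhaustion_L in \<open>auto simp: \<theta>_def\<close>)

text \<open>The paths of \<open>Z\<close> are regular only almost surely. A version with good paths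
  for every outcome lets the path calculus and its measurability statements apply without
  exceptional sets or completions.\<close>

definition version :: "real ^ 'n \<Rightarrow> (real \<Rightarrow> 'w \<Rightarrow> real ^ 'n) \<Rightarrow> bool" where
  "version x Y \<longleftrightarrow> (\<forall>t. Y t \<in> rv x) \<and>
     (AE w in Px x. \<forall>t. Y t w = Z t w) \<and> (\<forall>w. good (traj Y w))"

lemma good_0: "good (\<lambda>t. 0)"
  using zero_notin_G by (auto simp: good_def rc_path_def absorbed_path_def contained_path_def)

lemma ex_version:
  assumes x: "x \<in> G" and K: "exhaustion K b" "b \<subseteq> G"
  obtains Y where "version x Y" "\<And>w. contained_path K b (traj Y w)"
proof -
  have "AE w in Px x. good (traj Z w) \<and> contained_path K b (traj Z w)"
    using AE_path[OF x] AE_contained[OF x K] AE_contained[OF x exhaustion_L order_refl]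
    by eventually_elim (auto simp: good_def Z_neg)
  then obtain N where N: "N \<in> null_sets (Px x)"
    "{w \<in> space (Px x). \<not> (good (traj Z w) \<and> contained_path K b (traj Z w))} \<subseteq> N"
    by (rule AE_E) auto
  \<comment> \<open>On a null set that contains the bad outcomes the path is replaced by the
    constant 0, which is good and trivially contained since 0 is outside \<open>b\<close>.\<close>
  define Y where "Y t w = (if w \<in> space (Px x) - N then Z t w else 0)" for t w
  have ok: "w \<in> space (Px x) - N \<Longrightarrow> good (traj Z w) \<and> contained_path K b (traj Z w)" for w
    using N(2) by auto
  have "version x Y"
    unfolding version_def
  proof (intro conjI allI)
    fix t
    have [measurable]: "Z t \<in> rv x" "N \<in> sets (Px x)"
      using Z_measurable_P[OF Some_in[OF x]] N(1) by auto
    show "Y t \<in> rv x" unfolding Y_def by measurable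
  next
    show "AE w in Px x. \<forall>t. Y t w = Z t w"
      using AE_not_in[OF N(1)] AE_space by eventually_elim (simp add: Y_def)
  next
    fix w
    show "good (traj Y w)"
    proof (cases "w \<in> space (Px x) - N")
      case True
      then have "(traj Y w) = (traj Z w)" by (simp add: Y_def)
      then show ?thesis using ok[OF True] by simp
    next
      case False
      then have "(traj Y w) = (\<lambda>t. 0)" by (auto simp: Y_def)
      then show ?thesis using good_0 by simp
    qed
  qed
  moreover have "contained_path K b (traj Y w)" for w
  proof (cases "w \<in> space (Px x) - N")
    case True
    then have "(traj Y w) = (traj Z w)" by (simp add: Y_def)
    then show ?thesis using ok[OF True] by simp
  next
    case False
    then have "(traj Y w) = (\<lambda>t. 0)" by (auto simp: Y_def)
    moreover have "0 \<notin> b" using K(2) zero_notin_G by auto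
    ultimately show ?thesis by (auto simp: contained_path_def)
  qed
  ultimately show ?thesis using that by blast
qed

lemma version_measurable:
  "version x Y \<Longrightarrow> Y t \<in> rv x"
  and version_AE: "version x Y \<Longrightarrow> AE w in Px x. \<forall>t. Y t w = Z t w"
  and version_good: "version x Y \<Longrightarrow> good (traj Y w)"
  by (auto simp: version_def)

lemma version_rc: "version x Y \<Longrightarrow> rc_path (traj Y w)"
  using version_good[of x Y w] by (simp add: good_def)

lemma version_joint:
  "version x Y \<Longrightarrow> (\<lambda>p. Y (fst p) (snd p)) \<in> borel_measurable (borel \<Otimes>\<^sub>M Px x)"
  by (rule rc_path_joint_measurable) (simp_all add: version_measurable version_rc)

lemma version_random_time: "version x Y \<Longrightarrow> T \<in> rv x \<Longrightarrow> (\<lambda>w. Y (T w) w) \<in> rv x"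
  by (rule rc_path_random_time) (simp_all add: version_measurable version_rc)

abbreviation "TC Y w \<equiv> time_change (traj Y w)"

section \<open>Transition kernels of the process killed on leaving \<open>G\<close>, and the strong
  Markov property\<close>

definition Ker :: "real \<Rightarrow> real ^ 'n \<Rightarrow> (real ^ 'n) measure" where
  "Ker t x = (if x \<in> G then distr (density (Px x) (\<lambda>w. indicator G (Z t w))) borel (Z t) else null_measure borel)"

lemma G_borel [measurable]: "G \<in> sets borel" using open_G by simp

lemma emeasure_Ker:
  assumes "x \<in> G" "A \<in> sets borel"
  shows "emeasure (Ker t x) A = emeasure (Px x) {w \<in> space M. Z t w \<in> A \<inter> G}"
proof -
  note xE = Some_in[OF assms(1)]
  have [measurable]: "Z t \<in> rv x" by (rule Z_measurable_P[OF xE])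
  note [measurable] = assms(2)
  have "emeasure (Ker t x) A = EE x (\<lambda>w. indicator G (Z t w) * indicator (Z t -` A \<inter> space (Px x)) w)"
    using assms by (simp add: Ker_def emeasure_distr emeasure_density)
  also have "\<dots> = EE x (\<lambda>w. indicator {w \<in> space (Px x). Z t w \<in> A \<inter> G} w)"
    by (intro nn_integral_cong) (auto split: split_indicator)
  also have "\<dots> = emeasure (Px x) {w \<in> space (Px x). Z t w \<in> A \<inter> G}"
    by (intro nn_integral_indicator) measurable
  finally show ?thesis by (simp add: space_P[OF xE])
qed

lemma nn_integral_Ker:
  assumes "g \<in> borel_measurable borel"
  shows "x \<in> G \<Longrightarrow> (\<integral>\<^sup>+y. g y \<partial>Ker t x) = EE x (\<lambda>w. indicator G (Z t w) * g (Z t w))"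
    and "x \<notin> G \<Longrightarrow> (\<integral>\<^sup>+y. g y \<partial>Ker t x) = 0"
proof -
  note [measurable] = assms
  assume x: "x \<in> G"
  have [measurable]: "Z t \<in> rv x" by (rule Z_measurable_P[OF Some_in[OF x]])
  show "(\<integral>\<^sup>+y. g y \<partial>Ker t x) = EE x (\<lambda>w. indicator G (Z t w) * g (Z t w))"
    using x by (simp add: Ker_def nn_integral_distr nn_integral_density)
qed (simp add: Ker_def)

lemma Ker_measurable [measurable]:
  assumes t: "0 \<le> t" shows "Ker t \<in> borel \<rightarrow>\<^sub>M subprob_algebra borel"
proof (rule measurable_subprob_algebra)
  fix x :: "real ^ 'n"
  show "sets (Ker t x) = sets borel" by (simp add: Ker_def)
  show "subprob_space (Ker t x)"
  proof (rule subprob_spaceI)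
    have "space (Ker t x) = UNIV" by (simp add: Ker_def)
    then show "space (Ker t x) \<noteq> {}" by simp
    have "emeasure (Ker t x) UNIV \<le> 1"
    proof (cases "x \<in> G")
      case True
      then interpret prob_space "Px x" using prob_P Some_in by blast
      show ?thesis using emeasure_Ker[OF True, of UNIV t] emeasure_le_1 by simp
    qed (simp add: Ker_def)
    then show "emeasure (Ker t x) (space (Ker t x)) \<le> 1" using \<open>space (Ker t x) = UNIV\<close> by simp
  qed
next
  fix A :: "(real ^ 'n) set" assume A: "A \<in> sets borel"
  have "(\<lambda>x. emeasure (Px x) {w \<in> space M. X t w \<in> Some ` (A \<inter> G)}) \<in> borel_measurable (restrict_space borel G)"
    by (rule Some_measurable[OF kernel_measurable[OF t Some_sets[OF A]]])
  then have "(\<lambda>x. emeasure (Px x) {w \<in> space M. X t w \<in> Some ` (A \<inter> G)} * indicator G x) \<in> borel_measurable borel"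
    by (subst (asm) borel_measurable_restrict_space_iff_ennreal) auto
  also have "(\<lambda>x. emeasure (Px x) {w \<in> space M. X t w \<in> Some ` (A \<inter> G)} * indicator G x) = (\<lambda>x. emeasure (Ker t x) A)"
  proof
    fix x
    show "emeasure (Px x) {w \<in> space M. X t w \<in> Some ` (A \<inter> G)} * indicator G x = emeasure (Ker t x) A"
    proof (cases "x \<in> G")
      case True
      have "X t w \<in> Some ` (A \<inter> G) \<longleftrightarrow> Z t w \<in> A \<inter> G" for w
        using Z_eq[of t w] t by (auto simp: Z_def)
      then show ?thesis using True emeasure_Ker[OF True A, of t] by simp
    qed (simp add: Ker_def)
  qed
  finally show "(\<lambda>x. emeasure (Ker t x) A) \<in> borel_measurable borel" .
qed

abbreviation "Kh r \<phi> z \<equiv> (\<integral>\<^sup>+y. h0 y * \<phi> y \<partial>Ker r z)"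

lemma nn_integral_Ker_measurable [measurable]:
  assumes "0 \<le> t" "g \<in> borel_measurable borel"
  shows "(\<lambda>x. \<integral>\<^sup>+y. g y \<partial>Ker t x) \<in> borel_measurable borel"
  by (rule measurable_compose[OF Ker_measurable[OF assms(1)] nn_integral_measurable_subprob_algebra[OF assms(2)]])

text \<open>The assumed property concerns \<open>X\<close> and the completed measure; here it is
  carried over to a version and to \<open>Ker\<close>. If \<open>X\<close> is on the boundary at
  time \<open>T\<close>, the process started there never reaches \<open>G\<close>, in agreement with
  \<open>Ker\<close> being the null measure outside \<open>G\<close>.\<close>

lemma strong_markov_set:
  assumes x: "x \<in> G" and Y: "version x Y"
    and T: "stopping_time (aug (Some x)) T" "T \<in> borel_measurable M"
    and LL: "LL \<in> sets (filtration.pre_sigma (space (Px x)) (aug (Some x)) T)" "LL \<in> sets M"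
    and t: "0 \<le> t" and A: "A \<in> sets borel"
  shows "emeasure (Px x) {w \<in> LL. T w < \<infinity> \<and> Y (enn2real (T w) + t) w \<in> A \<inter> G}
    = EE x (\<lambda>w. indicator {w \<in> LL. T w < \<infinity>} w * emeasure (Ker t (Y (enn2real (T w)) w)) A)"
proof -
  let ?B = "{w \<in> LL. T w < \<infinity> \<and> Y (enn2real (T w) + t) w \<in> A \<inter> G}"
  let ?A = "{w \<in> LL. T w < \<infinity> \<and> X (enn2real (T w) + t) w \<in> Some ` (A \<inter> G)}"
  let ?L = "{w \<in> LL. T w < \<infinity>}"
  note xE = Some_in[OF x]
  have TP [measurable]: "T \<in> rv x"
    using T(2) measurable_cong_sets[OF sets_P[OF xE] refl] by blast
  have LP [measurable]: "LL \<in> sets (Px x)" using LL(2) sets_P[OF xE] by simp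
  have [measurable]: "(\<lambda>w. Y (enn2real (T w) + t) w) \<in> rv x"
    by (rule version_random_time[OF Y]) measurable
  note [measurable] = A
  have LM: "LL \<subseteq> space M" using LL(2) sets.sets_into_space by blast
  have key: "emeasure (cP (Some x)) ?A
           = (\<integral>\<^sup>+w\<in>?L.
                emeasure (P (at_time X T w)) {w' \<in> space (P (at_time X T w)). X t w' \<in> Some ` (A \<inter> G)}
              \<partial>cP (Some x))"
    using strong_markov xE T(1) LL(1) Some_sets[OF A] t unfolding strong_markov_def by blast
  have B: "?B \<in> sets (Px x)"
  proof -
    have "?B =
      LL \<inter> {w \<in> space (Px x). T w < \<infinity> \<and> Y (enn2real (T w) + t) w \<in> A \<inter> G}"
      using LM space_P[OF xE] by auto
    also have "\<dots> \<in> sets (Px x)" by measurable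
    finally show ?thesis .
  qed
  have XZ: "X s w \<in> Some ` (A \<inter> G) \<longleftrightarrow> Z s w \<in> A \<inter> G" if "0 \<le> s" for s w
    using Z_eq[of s w] that by (auto simp: Z_def)
  have "emeasure (cP (Some x)) ?A
     = emeasure (Px x) ?B"
  proof (rule emeasure_completion_AE_eq[OF _ B])
    show "?A \<subseteq> space (Px x)"
      using LM space_P[OF xE] by auto
    show "AE w in Px x. w \<in> ?A \<longleftrightarrow>
        w \<in> ?B"
      using version_AE[OF Y]
    proof eventually_elim
      case (elim w)
      have "0 \<le> enn2real (T w) + t" using t by simp
      from XZ[OF this, of w] elim show ?case by simp
    qed
  qed
  moreover have "(\<integral>\<^sup>+w\<in>?L.
                emeasure (P (at_time X T w)) {w' \<in> space (P (at_time X T w)). X t w' \<in> Some ` (A \<inter> G)}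
              \<partial>cP (Some x)) =
    EE x (\<lambda>w. indicator ?L w * emeasure (Ker t (Y (enn2real (T w)) w)) A)"
    unfolding nn_integral_completion
  proof (rule nn_integral_cong_AE)
    show "AE w in Px x.
       emeasure (P (at_time X T w)) {w' \<in> space (P (at_time X T w)). X t w' \<in> Some ` (A \<inter> G)} * indicator ?L w =
       indicator ?L w * emeasure (Ker t (Y (enn2real (T w)) w)) A"
      using version_AE[OF Y] AE_space
    proof eventually_elim
      case (elim w)
      let ?\<tau> = "enn2real (T w)"
      have eq: "Y ?\<tau> w = Z ?\<tau> w" using elim by simp
      have "emeasure (P (X ?\<tau> w)) {w' \<in> space (P (X ?\<tau> w)). X t w' \<in> Some ` (A \<inter> G)} = emeasure (Ker t (Z ?\<tau> w)) A"
      proof (cases "Z ?\<tau> w \<in> G")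
        case True
        then show ?thesis using emeasure_Ker[OF True A, of t] Z_eq[OF True] XZ[OF t] space_P[OF Some_in[OF True]] by simp
      next
        case False
        have "X ?\<tau> w \<in> E_set S"
          using measurable_space[OF X_measurable[of ?\<tau>], of w] elim space_P[OF xE] space_E by simp
        then have bd: "X ?\<tau> w \<in> E_bd S" using False Z_in_iff[of ?\<tau> w] by (simp add: E_bd_iff)
        have "AE w' in P (X ?\<tau> w). \<not> X t w' \<in> Some ` (A \<inter> G)"
          using absorbed_bd[OF bd] by eventually_elim (use bd t in \<open>auto simp: E_bd_iff E_int_eq\<close>)
        from emeasure_eq_0_AE[OF this] show ?thesis using False by (simp add: Ker_def)
      qed
      then show ?case using eq by (simp add: at_time_def mult.commute)
    qed
  qed
  ultimately show ?thesis using key by simp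
qed

text \<open>The statement for sets identifies the law of the position at \<open>T + t\<close> as a
  mixture of kernels, that is, a bind of sub-probability measures; integrals against a bind are
  iterated integrals.\<close>

lemma strong_markov_nn_integral:
  assumes x: "x \<in> G" and Y: "version x Y"
    and T: "stopping_time (aug (Some x)) T" "T \<in> borel_measurable M"
    and LL: "LL \<in> sets (filtration.pre_sigma (space (Px x)) (aug (Some x)) T)" "LL \<in> sets M"
    and t: "0 \<le> t" and g [measurable]: "g \<in> borel_measurable borel"
  shows "(EE x (\<lambda>w. indicator {w \<in> LL. T w < \<infinity>} w * (indicator G (Y (enn2real (T w) + t) w) * g (Y (enn2real (T w) + t) w))))
    = EE x (\<lambda>w. indicator {w \<in> LL. T w < \<infinity>} w * (\<integral>\<^sup>+y. g y \<partial>Ker t (Y (enn2real (T w)) w)))"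
proof -
  let ?L = "{w \<in> LL. T w < \<infinity>}"
  note xE = Some_in[OF x]
  interpret prob_space "Px x" by (rule prob_P[OF xE])
  have TP [measurable]: "T \<in> rv x"
    using T(2) measurable_cong_sets[OF sets_P[OF xE] refl] by blast
  have LP [measurable]: "LL \<in> sets (Px x)" using LL(2) sets_P[OF xE] by simp
  have LM: "LL \<subseteq> space (Px x)" using LP sets.sets_into_space by blast
  have LT [measurable]: "?L \<in> sets (Px x)"
  proof -
    have "?L = LL \<inter> {w \<in> space (Px x). T w < \<infinity>}" using LM by auto
    also have "\<dots> \<in> sets (Px x)" by measurable
    finally show ?thesis .
  qed
  define Yt where "Yt w = Y (enn2real (T w) + t) w" for w
  define Y0 where "Y0 w = Y (enn2real (T w)) w" for w
  have [measurable]: "Yt \<in> rv x" "Y0 \<in> rv x"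
    unfolding Yt_def Y0_def by (rule version_random_time[OF Y]; measurable)+
  define Q where "Q = density (Px x) (indicator ?L)"
  have [measurable_cong]: "sets Q = sets (Px x)" by (simp add: Q_def)
  have spQ: "space Q \<noteq> {}" using not_empty by (simp add: Q_def)
  have K: "(\<lambda>w. Ker t (Y0 w)) \<in> Q \<rightarrow>\<^sub>M subprob_algebra borel"
    by (rule measurable_compose[OF _ Ker_measurable[OF t]]) measurable
  define \<alpha> where "\<alpha> = distr (density Q (\<lambda>w. indicator G (Yt w))) borel Yt"
  have "\<alpha> = Q \<bind> (\<lambda>w. Ker t (Y0 w))"
  proof (rule measure_eqI)
    have "sets (Q \<bind> (\<lambda>w. Ker t (Y0 w))) = sets borel"
      by (rule sets_bind[OF _ spQ]) (simp add: Ker_def)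
    then show s: "sets \<alpha> = sets (Q \<bind> (\<lambda>w. Ker t (Y0 w)))" by (simp add: \<alpha>_def)
    fix A assume "A \<in> sets \<alpha>"
    then have A [measurable]: "A \<in> sets borel" by (simp add: \<alpha>_def)
    have "emeasure \<alpha> A = EE x (\<lambda>w. indicator ?L w * (indicator G (Yt w) * indicator (Yt -` A \<inter> space (Px x)) w))"
      unfolding \<alpha>_def Q_def by (simp add: emeasure_distr emeasure_density nn_integral_density)
    also have "\<dots> = EE x (\<lambda>w. indicator {w \<in> LL. T w < \<infinity> \<and> Yt w \<in> A \<inter> G} w)"
      by (intro nn_integral_cong) (auto split: split_indicator)
    also have "\<dots> = emeasure (Px x) {w \<in> LL. T w < \<infinity> \<and> Yt w \<in> A \<inter> G}"
    proof (rule nn_integral_indicator)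
      have "{w \<in> LL. T w < \<infinity> \<and> Yt w \<in> A \<inter> G} = ?L \<inter> {w \<in> space (Px x). Yt w \<in> A \<inter> G}"
        using LM by auto
      also have "\<dots> \<in> sets (Px x)" by measurable
      finally show "{w \<in> LL. T w < \<infinity> \<and> Yt w \<in> A \<inter> G} \<in> sets (Px x)" .
    qed
    also have "\<dots> = EE x (\<lambda>w. indicator ?L w * emeasure (Ker t (Y0 w)) A)"
      unfolding Yt_def Y0_def by (rule strong_markov_set[OF x Y T LL t A])
    also have "\<dots> = (\<integral>\<^sup>+w. emeasure (Ker t (Y0 w)) A \<partial>Q)"
    proof -
      have "(\<lambda>w. emeasure (Ker t (Y0 w)) A) \<in> rv x"
        using measurable_compose[OF K measurable_emeasure_subprob_algebra[OF A]] by simp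
      then show ?thesis unfolding Q_def by (subst nn_integral_density) auto
    qed
    also have "\<dots> = emeasure (Q \<bind> (\<lambda>w. Ker t (Y0 w))) A"
      by (rule emeasure_bind[OF spQ K A, symmetric])
    finally show "emeasure \<alpha> A = emeasure (Q \<bind> (\<lambda>w. Ker t (Y0 w))) A" .
  qed
  then have "(\<integral>\<^sup>+y. g y \<partial>\<alpha>) = (\<integral>\<^sup>+w. \<integral>\<^sup>+y. g y \<partial>Ker t (Y0 w) \<partial>Q)"
    using nn_integral_bind[OF g K] by simp
  also have "\<dots> = EE x (\<lambda>w. indicator ?L w * (\<integral>\<^sup>+y. g y \<partial>Ker t (Y0 w)))"
  proof -
    have "(\<lambda>w. \<integral>\<^sup>+y. g y \<partial>Ker t (Y0 w)) \<in> rv x"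
      using measurable_compose[OF K nn_integral_measurable_subprob_algebra[OF g]] by simp
    then show ?thesis unfolding Q_def by (subst nn_integral_density) auto
  qed
  also have "(\<integral>\<^sup>+y. g y \<partial>\<alpha>) = EE x (\<lambda>w. indicator ?L w * (indicator G (Yt w) * g (Yt w)))"
    unfolding \<alpha>_def Q_def by (simp add: nn_integral_distr nn_integral_density)
  finally show ?thesis unfolding Yt_def Y0_def .
qed

section \<open>Finite-dimensional distributions\<close>

lemma indicator_Some_measurable:
  assumes "A \<in> sets EB"
  shows "(\<lambda>y. indicator A (Some y) * indicator G y :: ennreal) \<in> borel_measurable borel"
proof -
  have "(\<lambda>y. indicator A (Some y) :: ennreal) \<in> borel_measurable (restrict_space borel G)"
    using Some_measurable[of "indicator A"] assms by simp
  then show ?thesis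
    by (subst (asm) borel_measurable_restrict_space_iff_ennreal) auto
qed

abbreviation "fdd \<equiv> semigroup_fdd (doob_semigroup S P X h (E_int S))"

text \<open>Multiplication by \<open>h0 x\<close> clears the denominator of the Doob transform. The
  recursion then involves only the kernel \<open>Ker\<close>, and the factors \<open>h0\<close>
  telescope over successive times.\<close>

lemma fdd_Cons:
  assumes x: "x \<in> G" and t: "s \<le> t"
    and m: "(\<lambda>y. h0 y * (indicator A (Some y) * fdd ps t (Some y))) \<in> borel_measurable borel"
  shows "h0 x * fdd ((t, A) # ps) s (Some x) =
    (\<integral>\<^sup>+y. h0 y * (indicator A (Some y) * fdd ps t (Some y)) \<partial>Ker (t - s) x)"
proof -
  let ?g = "\<lambda>y. h0 y * (indicator A (Some y) * fdd ps t (Some y))"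
  have "fdd ((t, A) # ps) s (Some x) = (EE x (\<lambda>w. ?g (Z (t - s) w))) / h0 x"
    using doob_eq[OF x, of "t - s" "\<lambda>y. indicator A y * fdd ps t y"] t by simp
  also have "EE x (\<lambda>w. ?g (Z (t - s) w)) = (\<integral>\<^sup>+y. ?g y \<partial>Ker (t - s) x)"
    unfolding nn_integral_Ker(1)[OF m x]
    by (intro nn_integral_cong) (auto simp: h0_out split: split_indicator)
  finally have 1: "fdd ((t, A) # ps) s (Some x) = (\<integral>\<^sup>+y. ?g y \<partial>Ker (t - s) x) / h0 x" .
  show ?thesis
    unfolding 1 ennreal_times_divide mult.commute[of "h0 x"]
    by (rule ennreal_mult_divide_eq) (use h0_pos[OF x] h0_finite[of x] in auto)
qed

lemma fdd_measurable:
  assumes "sorted (map fst ps)" "\<forall>(t, A)\<in>set ps. s \<le> t \<and> A \<in> sets EB"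
  shows "(\<lambda>x. h0 x * fdd ps s (Some x)) \<in> borel_measurable borel"
  using assms
proof (induction ps arbitrary: s)
  case (Cons p ps)
  obtain t A where p: "p = (t, A)" by (cases p)
  have IH: "(\<lambda>x. h0 x * fdd ps t (Some x)) \<in> borel_measurable borel"
    by (rule Cons.IH) (use Cons.prems p in auto)
  have A: "A \<in> sets EB" "s \<le> t" using Cons.prems p by auto
  have eq: "h0 y * (indicator A (Some y) * fdd ps t (Some y)) =
      (indicator A (Some y) * indicator G y) * (h0 y * fdd ps t (Some y))" for y
    by (auto simp: h0_out split: split_indicator)
  have m: "(\<lambda>y. h0 y * (indicator A (Some y) * fdd ps t (Some y))) \<in> borel_measurable borel"
    unfolding eq by (intro borel_measurable_times_ennreal indicator_Some_measurable A IH)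
  have "(\<lambda>x. h0 x * fdd (p # ps) s (Some x)) =
     (\<lambda>x. \<integral>\<^sup>+y. h0 y * (indicator A (Some y) * fdd ps t (Some y)) \<partial>Ker (t - s) x)"
  proof
    fix x
    show "h0 x * fdd (p # ps) s (Some x) = (\<integral>\<^sup>+y. h0 y * (indicator A (Some y) * fdd ps t (Some y)) \<partial>Ker (t - s) x)"
      using fdd_Cons[OF _ A(2) m] nn_integral_Ker(2)[OF m] by (cases "x \<in> G") (auto simp: p h0_out)
  qed
  then show ?case using nn_integral_Ker_measurable[OF _ m, of "t - s"] A by simp
qed simp

text \<open>This is the strong Markov property at the constant time \<open>s\<close>, for which an
  event of the natural filtration up to \<open>s\<close> belongs to the past.\<close>

lemma markov_const:
  assumes x: "x \<in> G" and s: "0 \<le> s" "0 \<le> t"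
    and LL: "LL \<in> sets (nat_filt (Some x) s)"
    and g: "g \<in> borel_measurable borel"
  shows "(EE x (\<lambda>w. indicator LL w * (\<integral>\<^sup>+y. g y \<partial>Ker t (Z s w))))
    = EE x (\<lambda>w. indicator LL w * (indicator G (Z (s + t) w) * g (Z (s + t) w)))"
proof -
  note xE = Some_in[OF x]
  interpret filtration "space (Px x)" "aug (Some x)" by (rule filtration_aug)
  obtain Y where Y: "version x Y" using ex_version[OF x exhaustion_L order_refl] by blast
  have LM: "LL \<in> sets M" using LL natural_sub[OF xE] by blast
  have st: "stopping_time (aug (Some x)) (\<lambda>_. ennreal s)" by (rule stopping_time_const)
  have pre: "LL \<in> sets (pre_sigma (\<lambda>_. ennreal s))"
  proof (rule sets_pre_sigmaI[OF st])
    fix t'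
    show "{w \<in> LL. ennreal s \<le> t'} \<in> sets (aug (Some x) t')"
    proof (cases "ennreal s \<le> t'")
      case True
      have "LL \<in> sets (aug (Some x) t')"
      proof (rule augI[OF xE LM])
        fix u assume "t' < ennreal u"
        with True have "ennreal s < ennreal u" by simp
        then have "s \<le> u" using s(1) by (simp add: ennreal_less_iff)
        then show "LL \<in> sets (nat_filt (Some x) u)"
          using natural_mono[OF xE] LL by blast
      qed
      then show ?thesis using True by simp
    qed simp
  qed
  have Z: "AE w in Px x. \<forall>t. Y t w = Z t w" by (rule version_AE[OF Y])
  have "EE x (\<lambda>w. indicator LL w * (\<integral>\<^sup>+y. g y \<partial>Ker t (Z s w))) =
    EE x (\<lambda>w. indicator {w \<in> LL. ennreal s < \<infinity>} w * (\<integral>\<^sup>+y. g y \<partial>Ker t (Y (enn2real (ennreal s)) w)))"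
    by (intro nn_integral_cong_AE) (use Z s in \<open>auto elim!: eventually_mono\<close>)
  also have "\<dots> = EE x (\<lambda>w. indicator {w \<in> LL. ennreal s < \<infinity>} w * (indicator G (Y (enn2real (ennreal s) + t) w) * g (Y (enn2real (ennreal s) + t) w)))"
    by (rule strong_markov_nn_integral[OF x Y st _ pre LM s(2) g, symmetric]) simp
  also have "\<dots> = EE x (\<lambda>w. indicator LL w * (indicator G (Z (s + t) w) * g (Z (s + t) w)))"
    by (intro nn_integral_cong_AE) (use Z s in \<open>auto elim!: eventually_mono\<close>)
  finally show ?thesis .
qed

text \<open>The density that remains after telescoping: all constraints of the list, and a single
  factor \<open>h0\<close> at the last of its times.\<close>

primrec weight :: "(real \<times> (real ^ 'n) option set) list \<Rightarrow> real \<Rightarrow> 'w \<Rightarrow> ennreal" where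
  "weight [] s w = h0 (Z s w)"
| "weight (p # ps) s w = indicator {w. Z (fst p) w \<in> G \<and> Some (Z (fst p) w) \<in> snd p} w * weight ps (fst p) w"

text \<open>An arbitrary event \<open>LL\<close> of the past is carried along so that the induction
  closes: the constraint at time \<open>t\<close> is absorbed into the event, which then belongs to
  the past of \<open>t\<close>.\<close>

lemma fdd_weight_aux:
  assumes x: "x \<in> G"
    and "sorted (map fst ps)" "\<forall>(t, A)\<in>set ps. s \<le> t \<and> A \<in> sets EB" "0 \<le> s"
    and "LL \<in> sets (nat_filt (Some x) s)"
  shows "EE x (\<lambda>w. indicator LL w * (h0 (Z s w) * fdd ps s (Some (Z s w)))) =
    EE x (\<lambda>w. indicator LL w * weight ps s w)"
  using assms(2-)
proof (induction ps arbitrary: s LL)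
  case (Cons p ps)
  note xE = Some_in[OF x]
  obtain t A where p: "p = (t, A)" by (cases p)
  have A: "A \<in> sets EB" "s \<le> t" "0 \<le> t" using Cons.prems p by auto
  have prems: "sorted (map fst ps)" "\<forall>(t', A)\<in>set ps. t \<le> t' \<and> A \<in> sets EB"
    using Cons.prems p by auto
  let ?g = "\<lambda>y. h0 y * (indicator A (Some y) * fdd ps t (Some y))"
  have eq: "?g y = (indicator A (Some y) * indicator G y) * (h0 y * fdd ps t (Some y))" for y
    by (auto simp: h0_out split: split_indicator)
  have m: "?g \<in> borel_measurable borel"
    unfolding eq by (intro borel_measurable_times_ennreal indicator_Some_measurable A fdd_measurable prems)
  define L' where "L' = LL \<inter> {w \<in> space M. X t w \<in> A \<inter> E_int S}"
  have XA: "X t w \<in> A \<inter> E_int S \<longleftrightarrow> Z t w \<in> G \<and> Some (Z t w) \<in> A" for w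
    using Z_eq[of t w] Z_in_iff[OF A(3), of w] by (auto simp: E_int_eq)
  have L': "L' \<in> sets (nat_filt (Some x) t)"
    unfolding L'_def
    using natural_mono[OF xE A(2)] Cons.prems(4) natural_sets[OF xE A(3) order_refl, of "A \<inter> E_int S"] A(1) by auto
  have "EE x (\<lambda>w. indicator LL w * (h0 (Z s w) * fdd (p # ps) s (Some (Z s w)))) =
    EE x (\<lambda>w. indicator LL w * (\<integral>\<^sup>+y. ?g y \<partial>Ker (t - s) (Z s w)))"
  proof (intro nn_integral_cong)
    fix w
    have "h0 (Z s w) * fdd (p # ps) s (Some (Z s w)) = (\<integral>\<^sup>+y. ?g y \<partial>Ker (t - s) (Z s w))"
      unfolding p using fdd_Cons[OF _ A(2) m, of "Z s w"] nn_integral_Ker(2)[OF m, of "Z s w" "t - s"]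
      by (cases "Z s w \<in> G") (auto simp: h0_out)
    then show "indicator LL w * (h0 (Z s w) * fdd (p # ps) s (Some (Z s w))) =
        indicator LL w * (\<integral>\<^sup>+y. ?g y \<partial>Ker (t - s) (Z s w))" by simp
  qed
  also have "\<dots> = EE x (\<lambda>w. indicator LL w * (indicator G (Z (s + (t - s)) w) * ?g (Z (s + (t - s)) w)))"
    by (rule markov_const[OF x Cons.prems(3) _ Cons.prems(4) m]) (use A in simp)
  also have "\<dots> = EE x (\<lambda>w. indicator L' w * (h0 (Z t w) * fdd ps t (Some (Z t w))))"
  proof (intro nn_integral_cong)
    fix w assume "w \<in> space (Px x)"
    then show "indicator LL w * (indicator G (Z (s + (t - s)) w) * ?g (Z (s + (t - s)) w)) =
       indicator L' w * (h0 (Z t w) * fdd ps t (Some (Z t w)))"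
      using XA[of w] space_P[OF xE] by (auto simp: L'_def split: split_indicator)
  qed
  also have "\<dots> = EE x (\<lambda>w. indicator L' w * weight ps t w)"
    by (rule Cons.IH[OF prems A(3) L'])
  also have "\<dots> = EE x (\<lambda>w. indicator LL w * weight (p # ps) s w)"
  proof (intro nn_integral_cong)
    fix w assume "w \<in> space (Px x)"
    then show "indicator L' w * weight ps t w = indicator LL w * weight (p # ps) s w"
      using XA[of w] space_P[OF xE] by (auto simp: L'_def p split: split_indicator)
  qed
  finally show ?case .
qed simp

lemma fdd_weight:
  assumes x: "x \<in> G"
    and "sorted (map fst ps)" "\<forall>(t, A)\<in>set ps. 0 \<le> t \<and> A \<in> sets EB"
  shows "h0 x * fdd ps 0 (Some x) = EE x (\<lambda>w. weight ps 0 w)"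
proof -
  note xE = Some_in[OF x]
  interpret prob_space "Px x" by (rule prob_P[OF xE])
  have "space M \<in> sets (nat_filt (Some x) 0)"
    using sets.top[of "nat_filt (Some x) 0"] by (simp add: space_natural space_P[OF xE])
  note aux = fdd_weight_aux[OF x assms(2,3) order_refl this]
  have "h0 x * fdd ps 0 (Some x) = EE x (\<lambda>w. h0 x * fdd ps 0 (Some x))"
    by (simp add: emeasure_space_1)
  also have "\<dots> = EE x (\<lambda>w. indicator (space M) w * (h0 (Z 0 w) * fdd ps 0 (Some (Z 0 w))))"
    by (rule nn_integral_cong_AE, use AE_path[OF x] AE_space in eventually_elim) (simp add: space_P[OF xE])
  also have "\<dots> = EE x (\<lambda>w. weight ps 0 w)"
    unfolding aux by (intro nn_integral_cong) (simp add: space_P[OF xE])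
  finally show ?thesis .
qed

section \<open>Measurability and law of the time-changed process\<close>

lemma additive_functional_clock:
  assumes "\<And>t. 0 \<le> t \<Longrightarrow> ennreal t < lifetime S X w \<longleftrightarrow> Z t w \<in> G"
  shows "additive_functional S X v u w = clock (traj Z w) u"
    and "additive_functional S X v (lifetime S X w) w = clock (traj Z w) \<infinity>"
    and "inverse_functional S X v t w = clock_inv (traj Z w) t"
proof -
  have eq: "ennreal (1 / v (X s w)) * indicator {s. 0 \<le> s \<and> ennreal s \<le> u \<and> ennreal s < lifetime S X w} s =
      ennreal (\<theta> (Z s w)) * indicator {s. 0 \<le> s \<and> ennreal s \<le> u} s" for s u
    using assms[of s] Z_eq[of s w] by (auto simp: \<theta>_def split: split_indicator)
  show 1: "additive_functional S X v u w = clock (traj Z w) u" for u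
    unfolding additive_functional_def clock_def using eq by simp
  have "additive_functional S X v (lifetime S X w) w = additive_functional S X v \<infinity> w"
    unfolding additive_functional_def by (intro nn_integral_cong) (auto split: split_indicator)
  then show "additive_functional S X v (lifetime S X w) w = clock (traj Z w) \<infinity>"
    using 1 by simp
  show "inverse_functional S X v t w = clock_inv (traj Z w) t"
    unfolding inverse_functional_def clock_inv_def 1 ..
qed

lemma time_changed_process:
  assumes life: "\<And>t. 0 \<le> t \<Longrightarrow> ennreal t < lifetime S X w \<longleftrightarrow> Z t w \<in> G"
    and good: "good (traj Z w)" and t: "0 \<le> t"
  shows "ennreal t < additive_functional S X v (lifetime S X w) w \<and>
      I (at_time X (inverse_functional S X v t) w) \<in> A \<longleftrightarrow>
      time_change (traj Z w) t \<in> G \<and> Some (time_change (traj Z w) t) \<in> A"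
proof (cases "ennreal t < clock (traj Z w) \<infinity>")
  case True
  then obtain u where u: "0 \<le> u" "Z u w \<in> G" "clock (traj Z w) (ennreal u) = ennreal t"
    using clock_surj[OF good True t] by blast
  have "time_change (traj Z w) t = j (Z u w)" by (rule time_change_eq[OF good u t])
  moreover have "I (at_time X (inverse_functional S X v t) w) = Some (j (Z u w))"
    using clock_inv_eq(1)[OF good u] u(1) Z_eq[OF u(2)] I_Some[OF u(2)]
    by (simp add: at_time_def additive_functional_clock(3)[OF life])
  ultimately show ?thesis using True j_in[OF u(2)] by (simp add: additive_functional_clock(2)[OF life])
next
  case False
  then show ?thesis using time_change_in_iff[OF good, of t]
    by (simp add: additive_functional_clock(2)[OF life])
qed

lemma \<theta>_borel [measurable]: "\<theta> \<in> borel_measurable borel"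
proof -
  have "(\<lambda>x. indicator G x *\<^sub>R \<theta> x) \<in> borel_measurable borel"
    by (rule borel_measurable_continuous_on_indicator[OF G_borel cont_\<theta>])
  also have "(\<lambda>x. indicator G x *\<^sub>R \<theta> x) = \<theta>" by (auto simp: \<theta>_def fun_eq_iff)
  finally show ?thesis .
qed

lemma j_borel: "(\<lambda>x. indicator G x *\<^sub>R j x) \<in> borel_measurable borel"
  by (rule borel_measurable_continuous_on_indicator[OF G_borel cont_j])

lemma clock_measurable:
  assumes Y: "version x Y"
  shows "(\<lambda>w. clock (traj Y w) u) \<in> rv x"
proof -
  have [measurable]: "(\<lambda>(w, s). Y s w) \<in> borel_measurable (Px x \<Otimes>\<^sub>M lborel)"
  proof -
    have "(\<lambda>p. (snd p, fst p)) \<in> Px x \<Otimes>\<^sub>M lborel \<rightarrow>\<^sub>M borel \<Otimes>\<^sub>M Px x"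
      by measurable
    from measurable_compose[OF this version_joint[OF Y]] show ?thesis by (simp add: case_prod_beta')
  qed
  have "(\<lambda>(w, s). ennreal (\<theta> (Y s w)) * indicator {s. 0 \<le> s \<and> ennreal s \<le> u} s) \<in> borel_measurable (Px x \<Otimes>\<^sub>M lborel)"
    by measurable
  then show ?thesis unfolding clock_def by (rule lborel.borel_measurable_nn_integral)
qed

text \<open>The clock is monotone, so the infimum may be taken over rational times; a countable
  infimum is measurable in the outcome.\<close>

lemma clock_inv_rational:
  "clock_inv z t = (INF q\<in>{q\<in>\<rat>. 0 \<le> q}. if ennreal t < clock z (ennreal q) then ennreal q else \<infinity>)"
    (is "_ = ?I")
proof (rule antisym)
  show "clock_inv z t \<le> ?I"
    by (rule INF_greatest) (auto simp: clock_inv_def intro: Inf_lower)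
  show "?I \<le> clock_inv z t"
    unfolding clock_inv_def
  proof (rule Inf_greatest, rule ccontr)
    fix u assume u: "u \<in> {u. ennreal t < clock z u}" "\<not> ?I \<le> u"
    have "u < ?I" using u(2) by (simp only: not_le)
    then obtain q where q: "q \<in> \<rat>" "0 < q" "u < ennreal q" "ennreal q < ?I"
      by (rule ennreal_Rats_dense)
    have "ennreal t < clock z (ennreal q)"
      using u(1) clock_mono[OF less_imp_le[OF q(3)], of z] by auto
    then have "?I \<le> ennreal q" using q(1,2) by (intro INF_lower2[of q]) auto
    then show False using q(4) by simp
  qed
qed

lemma time_change_measurable:
  assumes Y: "version x Y"
  shows "(\<lambda>w. TC Y w t) \<in> rv x"
proof -
  note [measurable] = clock_measurable[OF Y]
  have [measurable]: "(\<lambda>w. clock_inv (traj Y w) t) \<in> rv x"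
    unfolding clock_inv_rational
  proof (rule borel_measurable_INF)
    show "countable {q \<in> \<rat>. 0 \<le> (q::real)}" by (rule countable_subset[OF _ countable_rat]) auto
  qed measurable
  have [measurable]: "(\<lambda>w. Y (enn2real (clock_inv (traj Y w) t)) w) \<in> rv x"
    by (rule version_random_time[OF Y]) measurable
  \<comment> \<open>\<open>j\<close> is known to be Borel after being cut off outside
    \<open>G\<close>; at the inverse clock the path is in \<open>G\<close>, so the cut-off changes
    no value.\<close>
  have eq: "(\<lambda>w. TC Y w t) =
    (\<lambda>w. if 0 \<le> t \<and> ennreal t < clock (traj Y w) \<infinity> then
       (\<lambda>x. indicator G x *\<^sub>R j x) (Y (enn2real (clock_inv (traj Y w) t)) w) else 0)"
  proof
    fix w
    note good = version_good[OF Y, of w]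
    show "TC Y w t = (if 0 \<le> t \<and> ennreal t < clock (traj Y w) \<infinity> then
       (\<lambda>x. indicator G x *\<^sub>R j x) (Y (enn2real (clock_inv (traj Y w) t)) w) else 0)"
    proof (cases "0 \<le> t \<and> ennreal t < clock (traj Y w) \<infinity>")
      case True
      then obtain u where u: "0 \<le> u" "Y u w \<in> G" "clock (traj Y w) (ennreal u) = ennreal t"
        using clock_surj[OF good] by blast
      then show ?thesis using True time_change_eq[OF good u] clock_inv_eq(1)[OF good u] by simp
    qed (auto simp: time_change_def)
  qed
  have m: "(\<lambda>w. (\<lambda>x. indicator G x *\<^sub>R j x) (Y (enn2real (clock_inv (traj Y w) t)) w)) \<in> rv x"
    by (rule measurable_compose[OF _ j_borel]) measurable
  show ?thesis unfolding eq by (rule measurable_If[OF m]) measurable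
qed

lemma time_change_start:
  assumes "good z" "z 0 \<in> G" shows "time_change z 0 = j (z 0)"
  using time_change_eq[OF assms(1), of 0 0] assms(2) clock_0 by simp

lemma weight_map:
  "weight (map (\<lambda>s. (s, Some ` (A s \<inter> G))) xs @ [(t, E_set S)]) s w =
    indicator {w. \<forall>r\<in>set xs. Z r w \<in> A r \<inter> G} w * h0 (Z t w)"
proof (induction xs arbitrary: s)
  case Nil
  then show ?case using Some_in by (auto simp: h0_out split: split_indicator)
next
  case (Cons a xs)
  then show ?case by (auto split: split_indicator)
qed

text \<open>The Inversion Property is used from the starting point \<open>j x\<close>, whose image
  under the inversion is \<open>x\<close>. The list of constraints ends with
  \<open>(t, E_set S)\<close>: this entry asks only for survival until \<open>t\<close>, and it
  places the remaining factor \<open>h0\<close> at time \<open>t\<close>.\<close>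

lemma law_cylinder:
  assumes x: "x \<in> G" and Y: "version (j x) Y" and J: "finite J" "J \<subseteq> {0..t}" "0 \<le> t"
    and A: "\<And>s. s \<in> J \<Longrightarrow> A s \<in> sets borel"
  shows "h0 x * emeasure (Px (j x)) {w \<in> space M. TC Y w t \<in> G \<and>
           (\<forall>s\<in>J. TC Y w s \<in> A s)} =
    EE x (\<lambda>w. h0 (Z t w) * indicator {w. \<forall>s\<in>J. Z s w \<in> A s} w)"
proof -
  have jx: "j x \<in> G" by (rule j_in[OF x])
  note yE = Some_in[OF jx]
  have [measurable]: "(\<lambda>w. TC Y w s) \<in> rv (j x)" for s
    by (rule time_change_measurable[OF Y])
  define xs where "xs = sorted_list_of_set J"
  define ps where "ps = map (\<lambda>s. (s, Some ` (A s \<inter> G))) xs @ [(t, E_set S)]"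
  have xs: "set xs = J" "sorted xs" using J by (auto simp: xs_def)
  have "map fst ps = xs @ [t]" by (simp add: ps_def o_def)
  then have s1: "sorted (map fst ps)" using xs J by (auto simp: sorted_append)
  have s2: "\<forall>(t, A)\<in>set ps. 0 \<le> t \<and> A \<in> sets EB"
    using J A Some_sets sets.top[of "EB"] xs(1) by (auto simp: ps_def space_E)
  \<comment> \<open>Survival until \<open>t\<close> implies survival at all earlier times, so
    intersecting the constraint sets with \<open>G\<close> costs nothing.\<close>
  have ab: "TC Y w s \<in> G" if "TC Y w t \<in> G" "s \<in> J" for w s
    by (rule absorbed_mono[OF absorbed_time_change[OF version_good[OF Y]] that(1)]) (use that J in auto)
  let ?A = "{w \<in> space (Px (j x)). \<forall>(t, A)\<in>set ps.
             ennreal t < additive_functional S X v (lifetime S X w) w \<and>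
             I (at_time X (inverse_functional S X v t) w) \<in> A}"
  let ?B = "{w \<in> space M. TC Y w t \<in> G \<and> (\<forall>s\<in>J. TC Y w s \<in> A s)}"
  have "emeasure (cP (Some (j x)))
          ?A
     = emeasure (Px (j x)) ?B"
  proof (rule emeasure_completion_AE_eq)
    show "AE w in Px (j x). w \<in> ?A \<longleftrightarrow>
       w \<in> ?B"
      using AE_path[OF jx] version_AE[OF Y]
    proof eventually_elim
      case (elim w)
      have eq: "(traj Y w) = (traj Z w)" using elim by auto
      have life: "\<And>t. 0 \<le> t \<Longrightarrow> ennreal t < lifetime S X w \<longleftrightarrow> Z t w \<in> G" using elim by blast
      have good: "good (traj Z w)" using version_good[OF Y, of w] eq by simp
      have "(\<forall>(t, A)\<in>set ps. ennreal t < additive_functional S X v (lifetime S X w) w \<and>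
             I (at_time X (inverse_functional S X v t) w) \<in> A) \<longleftrightarrow>
         (\<forall>(t, A)\<in>set ps. TC Y w t \<in> G \<and> Some (TC Y w t) \<in> A)"
        unfolding eq
      proof (intro ball_cong refl)
        fix p assume "p \<in> set ps"
        moreover obtain t A where p: "p = (t, A)" by (cases p)
        ultimately have "0 \<le> t" using s2 by auto
        from time_changed_process[OF life good this, of A]
        show "(case p of (t, A) \<Rightarrow> ennreal t < additive_functional S X v (lifetime S X w) w \<and>
             I (at_time X (inverse_functional S X v t) w) \<in> A) =
           (case p of (t, A) \<Rightarrow> time_change (traj Z w) t \<in> G \<and> Some (time_change (traj Z w) t) \<in> A)"
          unfolding p by simp
      qed
      also have "\<dots> \<longleftrightarrow> TC Y w t \<in> G \<and> (\<forall>s\<in>J. TC Y w s \<in> A s)"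
        using ab[of w] Some_in xs(1) by (auto simp: ps_def)
      finally show ?case using space_P[OF yE] by auto
    qed
    have "?B =
      {w \<in> space (Px (j x)). TC Y w t \<in> G} \<inter> (\<Inter>s\<in>J. (\<lambda>w. TC Y w s) -` A s \<inter> space (Px (j x))) \<inter> space (Px (j x))"
      using space_P[OF yE] by auto
    also have "\<dots> \<in> sets (Px (j x))"
    proof (cases "J = {}")
      case False
      then have "(\<Inter>s\<in>J. (\<lambda>w. TC Y w s) -` A s \<inter> space (Px (j x))) \<in> sets (Px (j x))"
        using J A by (intro sets.finite_INT) (auto intro!: measurable_sets)
      then show ?thesis by (intro sets.Int sets.top) measurable
    qed simp
    finally show "?B \<in> sets (Px (j x))" .
  qed auto
  then have "emeasure (Px (j x)) ?B = fdd ps 0 (Some x)"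
    using inversion_fdd[OF yE s1 s2] I_Some[OF jx] j_j[OF x] by simp
  then have "h0 x * emeasure (Px (j x)) ?B =
     EE x (\<lambda>w. weight ps 0 w)"
    using fdd_weight[OF x s1 s2] by simp
  also have "\<dots> = EE x (\<lambda>w. h0 (Z t w) * indicator {w. \<forall>s\<in>J. Z s w \<in> A s} w)"
  proof (rule nn_integral_cong_AE)
    show "AE w in Px x. weight ps 0 w = h0 (Z t w) * indicator {w. \<forall>s\<in>J. Z s w \<in> A s} w"
      using AE_path[OF x]
    proof eventually_elim
      case (elim w)
      have "Z s w \<in> G" if "Z t w \<in> G" "s \<in> J" for s
        by (rule absorbed_mono[of "\<lambda>t. Z t w", OF _ that(1)]) (use that J elim in auto)
      then show ?case unfolding ps_def weight_map xs(1)
        by (cases "Z t w \<in> G") (auto simp: h0_out split: split_indicator)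
    qed
  qed
  finally show ?thesis .
qed

section \<open>Exit laws\<close>

lemma time_change_joint:
  "version x Y \<Longrightarrow> (\<lambda>p. TC Y (snd p) (fst p)) \<in> borel_measurable (borel \<Otimes>\<^sub>M Px x)"
  by (rule rc_path_joint_measurable[of "\<lambda>t w. TC Y w t"])
    (simp_all add: time_change_measurable rc_time_change version_good)

lemma time_change_random_time: "version x Y \<Longrightarrow> T \<in> rv x \<Longrightarrow> (\<lambda>w. TC Y w (T w)) \<in> rv x"
  by (rule rc_path_random_time[of "\<lambda>t w. TC Y w t"])
    (simp_all add: time_change_measurable rc_time_change version_good)

text \<open>Both sides are integrals against finite measures on the path space over
  \<open>[0,t]\<close>. They agree on cylinders, hence coincide, which extends the law to every
  measurable functional of the path up to \<open>t\<close>.\<close>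

lemma nn_integral_h0:
  assumes x: "x \<in> G" and Y: "version (j x) Y" and U: "version x U" and t: "0 \<le> t"
    and \<Psi>: "\<Psi> \<in> borel_measurable (PiM {0..t} (\<lambda>_. borel))"
  shows "EE (j x) (\<lambda>w. h0 x * indicator G (TC Y w t) * \<Psi> (\<lambda>s\<in>{0..t}. TC Y w s)) =
    EE x (\<lambda>w. h0 (U t w) * \<Psi> (\<lambda>s\<in>{0..t}. U s w))"
proof -
  let ?p1 = "\<lambda>w. \<lambda>s\<in>{0..t}. TC Y w s"
  let ?p2 = "\<lambda>w. \<lambda>s\<in>{0..t}. U s w"
  let ?d1 = "density (Px (j x)) (\<lambda>w. h0 x * indicator G (TC Y w t))"
  let ?N = "PiM {0..t} (\<lambda>_. borel) :: (real \<Rightarrow> real ^ 'n) measure"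
  have jx: "j x \<in> G" by (rule j_in[OF x])
  interpret Q1: prob_space "Px (j x)" by (rule prob_P[OF Some_in[OF jx]])
  have sp1: "space (Px (j x)) = space M" by (rule space_P[OF Some_in[OF jx]])
  have Wm [measurable]: "(\<lambda>w. TC Y w s) \<in> rv (j x)" for s
    by (rule time_change_measurable[OF Y])
  have Um [measurable]: "U s \<in> rv x" for s
    by (rule version_measurable[OF U])
  note \<Psi>[measurable]
  have r1 [measurable]: "?p1 \<in> Px (j x) \<rightarrow>\<^sub>M ?N"
    by (rule measurable_restrict) measurable
  have r2 [measurable]: "?p2 \<in> Px x \<rightarrow>\<^sub>M ?N"
    by (rule measurable_restrict) measurable
  define \<mu> where "\<mu> = distr (?d1) (?N) ?p1"
  define \<nu> where "\<nu> = distr (density (Px x) (\<lambda>w. h0 (U t w))) (?N) ?p2"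
  have "\<mu> = \<nu>"
  proof (rule measure_eqI_PiM_infinite)
    show "sets \<mu> = sets (?N)" "sets \<nu> = sets (?N)"
      by (simp_all add: \<mu>_def \<nu>_def)
    show "finite_measure \<mu>"
      unfolding \<mu>_def
    proof (rule finite_measure.finite_measure_distr[OF finite_measureI])
      have "emeasure (?d1) (space (Px (j x))) =
        EE (j x) (\<lambda>w. h0 x * indicator G (TC Y w t) * indicator (space (Px (j x))) w)"
        by (rule emeasure_density) measurable
      also have "\<dots> \<le> (EE (j x) (\<lambda>w. h0 x))"
        by (intro nn_integral_mono) (auto split: split_indicator)
      also have "\<dots> < \<infinity>" using h0_finite[of x] by (simp add: Q1.emeasure_space_1)
      finally show "emeasure (?d1)
        (space (?d1)) \<noteq> \<infinity>" by simp
    qed measurable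
    fix J and A :: "real \<Rightarrow> (real ^ 'n) set"
    assume J: "finite J" "J \<subseteq> {0..t}" and A: "\<And>i. i \<in> J \<Longrightarrow> A i \<in> sets borel"
    let ?E = "prod_emb {0..t} (\<lambda>_. borel) J (Pi\<^sub>E J A)"
    have Es: "?E \<in> sets (?N)"
      using J A by (intro sets_PiM_I) auto
    have E: "(\<lambda>s\<in>{0..t}. z s) \<in> ?E \<longleftrightarrow> (\<forall>s\<in>J. z s \<in> A s)" for z :: "real \<Rightarrow> real ^ 'n"
      using J(2) by (auto simp: prod_emb_iff PiE_iff restrict_def extensional_def subset_iff)
    have "emeasure \<mu> ?E = EE (j x) (\<lambda>w. h0 x * indicator G (TC Y w t) * indicator (?p1 -` ?E \<inter> space (Px (j x))) w)"
      unfolding \<mu>_def using Es measurable_sets[OF r1 Es] by (subst emeasure_distr) (auto simp: emeasure_density)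
    also have "\<dots> = EE (j x) (\<lambda>w. h0 x * indicator {w \<in> space M. TC Y w t \<in> G \<and> (\<forall>s\<in>J. TC Y w s \<in> A s)} w)"
      by (intro nn_integral_cong) (auto simp: E sp1 split: split_indicator)
    also have "\<dots> = h0 x * emeasure (Px (j x)) {w \<in> space M. TC Y w t \<in> G \<and> (\<forall>s\<in>J. TC Y w s \<in> A s)}"
    proof (rule nn_integral_cmult_indicator)
      have "{w \<in> space M. TC Y w t \<in> G \<and> (\<forall>s\<in>J. TC Y w s \<in> A s)} =
         {w \<in> space (Px (j x)). TC Y w t \<in> G} \<inter> (?p1 -` ?E \<inter> space (Px (j x)))"
        by (auto simp: E sp1)
      also have "\<dots> \<in> sets (Px (j x))"
        by (rule sets.Int[OF _ measurable_sets[OF r1 Es]]) measurable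
      finally show "{w \<in> space M. TC Y w t \<in> G \<and> (\<forall>s\<in>J. TC Y w s \<in> A s)} \<in> sets (Px (j x))" .
    qed
    also have "\<dots> = EE x (\<lambda>w. h0 (Z t w) * indicator {w. \<forall>s\<in>J. Z s w \<in> A s} w)"
      by (rule law_cylinder[OF x Y J t A])
    also have "\<dots> = EE x (\<lambda>w. h0 (U t w) * indicator (?p2 -` ?E \<inter> space (Px x)) w)"
    by (rule nn_integral_cong_AE, use version_AE[OF U] AE_space in eventually_elim) (auto simp: E split: split_indicator)
    also have "\<dots> = emeasure \<nu> ?E"
      unfolding \<nu>_def using Es measurable_sets[OF r2 Es] by (subst emeasure_distr) (auto simp: emeasure_density)
    finally show "emeasure \<mu> ?E = emeasure \<nu> ?E" .
  qed
  then have "(\<integral>\<^sup>+\<pi>. \<Psi> \<pi> \<partial>\<mu>) = (\<integral>\<^sup>+\<pi>. \<Psi> \<pi> \<partial>\<nu>)" by simp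
  then show ?thesis unfolding \<mu>_def \<nu>_def
    by (simp add: nn_integral_distr nn_integral_density)
qed

text \<open>This is the law of the path read at a single time. It expresses the semigroup applied to
  \<open>h0 * \<phi>\<close> through the right-continuous path of the time-changed process, in whose
  expectation \<open>h0\<close> enters only as the constant \<open>h0 z\<close>.\<close>

lemma semigroup_law:
  assumes z: "z \<in> G" and Y: "version (j z) Y" and r: "0 \<le> r" and \<phi> [measurable]: "\<phi> \<in> borel_measurable borel"
  shows "Kh r \<phi> z =
    EE (j z) (\<lambda>w. h0 z * (indicator G (TC Y w r) * \<phi> (TC Y w r)))"
proof -
  obtain U where U: "version z U" using ex_version[OF z exhaustion_L order_refl] by blast
  have "(\<lambda>\<pi>. \<pi> r) \<in> PiM {0..r} (\<lambda>_. borel) \<rightarrow>\<^sub>M (borel :: (real ^ 'n) measure)"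
    using r by (intro measurable_component_singleton) auto
  from nn_integral_h0[OF z Y U r measurable_compose[OF this \<phi>]]
  have "EE (j z) (\<lambda>w. h0 z * (indicator G (TC Y w r) * \<phi> (TC Y w r))) =
     EE z (\<lambda>w. h0 (U r w) * \<phi> (U r w))"
    using r by (simp add: mult.assoc)
  also have "\<dots> = EE z (\<lambda>w. indicator G (Z r w) * (h0 (Z r w) * \<phi> (Z r w)))"
    by (rule nn_integral_cong_AE)
       (use version_AE[OF U] in \<open>auto elim!: eventually_mono simp: h0_out split: split_indicator\<close>)
  also have "\<dots> = Kh r \<phi> z"
    by (rule nn_integral_Ker(1)[OF _ z, symmetric]) measurable
  finally show ?thesis ..
qed

lemma semigroup_bound:
  assumes r: "0 \<le> r" and \<phi>: "\<phi> \<in> borel_measurable borel" "\<And>y. \<phi> y \<le> 1"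
  shows "Kh r \<phi> z \<le> h0 z"
proof (cases "z \<in> G")
  case True
  obtain Y where Y: "version (j z) Y" using ex_version[OF j_in[OF True] exhaustion_L order_refl] by blast
  interpret prob_space "Px (j z)" by (rule prob_P[OF Some_in[OF j_in[OF True]]])
  have "indicator G y * \<phi> y \<le> 1" for y using \<phi>(2)[of y] by (simp split: split_indicator)
  then have "Kh r \<phi> z \<le> (EE (j z) (\<lambda>w. h0 z * 1))"
    unfolding semigroup_law[OF True Y r \<phi>(1)] by (intro nn_integral_mono mult_left_mono) auto
  then show ?thesis by (simp add: emeasure_space_1)
next
  case False
  then show ?thesis by (simp add: Ker_def)
qed

text \<open>After the passage to the time-changed process this says that survival until
  \<open>r'\<close> implies survival until \<open>r\<close>.\<close>

lemma semigroup_antimono: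
  assumes r: "0 \<le> r" "r \<le> r'"
  shows "(\<integral>\<^sup>+y. h0 y \<partial>Ker r' z) \<le> (\<integral>\<^sup>+y. h0 y \<partial>Ker r z)"
proof (cases "z \<in> G")
  case True
  obtain Y where Y: "version (j z) Y" using ex_version[OF j_in[OF True] exhaustion_L order_refl] by blast
  note law = semigroup_law[OF True Y, of _ "\<lambda>_. 1", simplified]
  have r': "0 \<le> r'" using r by simp
  have "TC Y w r' \<in> G \<Longrightarrow> TC Y w r \<in> G" for w
    by (rule absorbed_mono[OF absorbed_time_change[OF version_good[OF Y]] _ r])
  then show ?thesis unfolding law[OF r(1)] law[OF r']
    by (intro nn_integral_mono mult_left_mono) (auto split: split_indicator)
next
  case False
  then show ?thesis by (simp add: Ker_def)
qed

text \<open>The time-changed process from \<open>j z\<close> starts at \<open>j (j z) = z\<close>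
  and is right-continuous there; the constant \<open>h0 z\<close> dominates.\<close>

lemma semigroup_tendsto:
  fixes f :: "real ^ 'n \<Rightarrow> real"
  assumes f: "continuous_on UNIV f" "\<And>y. f y \<le> 1"
  shows "((\<lambda>r. \<integral>\<^sup>+y. h0 y * ennreal (f y) \<partial>Ker r z) \<longlongrightarrow> h0 z * ennreal (f z)) (at_right 0)"
proof (cases "z \<in> G")
  case True
  note jz = j_in[OF True]
  obtain Y where Y: "version (j z) Y" using ex_version[OF jz exhaustion_L order_refl] by blast
  interpret prob_space "Px (j z)" by (rule prob_P[OF Some_in[OF jz]])
  have [measurable]: "(\<lambda>y. ennreal (f y)) \<in> borel_measurable borel"
    using borel_measurable_continuous_onI[OF f(1)] by measurable
  have [measurable]: "(\<lambda>w. TC Y w r) \<in> rv (j z)" for r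
    by (rule time_change_measurable[OF Y])
  let ?F = "\<lambda>r w. h0 z * (indicator G (TC Y w r) * ennreal (f (TC Y w r)))"
  have "((\<lambda>r. \<integral>\<^sup>+w. ?F r w \<partial>Px (j z)) \<longlongrightarrow> (EE (j z) (\<lambda>w. h0 z * ennreal (f z)))) (at_right 0)"
  proof (rule nn_integral_tendsto_at_right[where bd = "\<lambda>_. h0 z"])
    show "(EE (j z) (\<lambda>w. h0 z)) < \<infinity>" using h0_finite[of z] by (simp add: emeasure_space_1)
    show "AE w in Px (j z). ?F r w \<le> h0 z" for r
    proof (rule AE_I2)
      fix w
      have "indicator G y * ennreal (f y) \<le> 1" for y using f(2)[of y] by (simp split: split_indicator)
      from mult_left_mono[OF this, of "h0 z"] show "?F r w \<le> h0 z" by simp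
    qed
    show "AE w in Px (j z). ((\<lambda>r. ?F r w) \<longlongrightarrow> h0 z * ennreal (f z)) (at_right 0)"
      using AE_path[OF jz] version_AE[OF Y]
    proof eventually_elim
      case (elim w)
      have "Y 0 w = j z" using elim by simp
      then have 0: "TC Y w 0 = z"
        using time_change_start[OF version_good[OF Y, of w]] jz j_j[OF True] by simp
      have "((\<lambda>r. indicator G (TC Y w (0 + r)) * ennreal (f (TC Y w (0 + r))))
         \<longlongrightarrow> indicator G (TC Y w 0) * ennreal (f (TC Y w 0))) (at_right 0)"
        by (rule absorbed_path_tendsto[OF rc_time_change[OF version_good[OF Y]] absorbed_time_change[OF version_good[OF Y]] open_G zero_notin_G order_refl f(1)])
      then show ?case unfolding 0 using True h0_finite[of z]
        by (intro ennreal_tendsto_cmult) auto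
    qed
  qed measurable
  also have "EE (j z) (\<lambda>w. h0 z * ennreal (f z)) = h0 z * ennreal (f z)"
    by (simp add: emeasure_space_1)
  finally show ?thesis
  proof (rule Lim_transform_eventually)
    show "eventually (\<lambda>r. (EE (j z) (\<lambda>w. ?F r w)) = (\<integral>\<^sup>+y. h0 y * ennreal (f y) \<partial>Ker r z)) (at_right 0)"
      unfolding eventually_at_right_field using semigroup_law[OF True Y, of _ "\<lambda>y. ennreal (f y)"]
      by (intro exI[of _ 1]) auto
  qed
next
  case False
  then show ?thesis by (simp add: Ker_def h0_out)
qed

text \<open>Both events cutting out the window depend only on the path up to \<open>t\<close>, so
  the window indicator is an admissible functional on the path space.\<close>

lemma window_law:
  assumes x: "x \<in> G" and Y: "version (j x) Y" and U: "version x U"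
    and K: "\<And>n. K n \<in> sets borel" and \<phi> [measurable]: "\<phi> \<in> borel_measurable borel" and s: "0 \<le> s"
  shows "(EE (j x) (\<lambda>w. h0 x * (indicator G (TC Y w t) * \<phi> (TC Y w t)) *
       indicator {w. exit_limit K (TC Y w) < ennreal t \<and> \<not> exit_limit K (TC Y w) < ennreal (t - s)} w))
   = EE x (\<lambda>w. h0 (U t w) * \<phi> (U t w) *
       indicator {w. exit_limit K (traj U w) < ennreal t \<and> \<not> exit_limit K (traj U w) < ennreal (t - s)} w)"
proof (cases "0 \<le> t")
  case True
  let ?N = "PiM {0..t} (\<lambda>_. borel) :: (real \<Rightarrow> real ^ 'n) measure"
  define C where "C = {\<pi> \<in> space ?N. exit_limit K \<pi> < ennreal t} - {\<pi> \<in> space ?N. exit_limit K \<pi> < ennreal (t - s)}"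
  have [measurable]: "C \<in> sets ?N"
    unfolding C_def by (intro sets.Diff exit_limit_PiM K) (use s in auto)
  have "(\<lambda>\<pi>. \<pi> t) \<in> ?N \<rightarrow>\<^sub>M borel"
    using True by (intro measurable_component_singleton) auto
  from measurable_compose[OF this \<phi>]
  have [measurable]: "(\<lambda>\<pi>. \<phi> (\<pi> t)) \<in> borel_measurable ?N" .
  have \<Psi>: "(\<lambda>\<pi>. \<phi> (\<pi> t) * indicator C \<pi>) \<in> borel_measurable ?N" by measurable
  have C: "(\<lambda>s\<in>{0..t}. z s) \<in> C \<longleftrightarrow> exit_limit K z < ennreal t \<and> \<not> exit_limit K z < ennreal (t - s)" for z :: "real \<Rightarrow> real ^ 'n"
  proof -
    have "exit_limit K (\<lambda>s\<in>{0..t}. z s) < ennreal r \<longleftrightarrow> exit_limit K z < ennreal r" if "r \<le> t" for r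
      by (rule exit_limit_less_cong) (use that in auto)
    moreover have "(\<lambda>s\<in>{0..t}. z s) \<in> space ?N" by (simp add: space_PiM)
    ultimately show ?thesis using s by (simp add: C_def)
  qed
  have "EE (j x) (\<lambda>w. h0 x * indicator G (TC Y w t) * (\<phi> ((\<lambda>s\<in>{0..t}. TC Y w s) t) * indicator C (\<lambda>s\<in>{0..t}. TC Y w s))) =
    EE x (\<lambda>w. h0 (U t w) * (\<phi> ((\<lambda>s\<in>{0..t}. U s w) t) * indicator C (\<lambda>s\<in>{0..t}. U s w)))"
    by (rule nn_integral_h0[OF x Y U True \<Psi>])
  moreover have "indicator C (\<lambda>s\<in>{0..t}. z s) = (of_bool (exit_limit K z < ennreal t \<and> \<not> exit_limit K z < ennreal (t - s)) :: ennreal)" for z :: "real \<Rightarrow> real ^ 'n"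
    using C[of z] by (simp add: indicator_def)
  ultimately show ?thesis using True by (simp add: indicator_def mult.assoc)
next
  case False
  \<comment> \<open>For negative \<open>t\<close> the window is empty on both sides, since no time
    lies below \<open>ennreal t\<close>.\<close>
  then have "ennreal t = 0" by (simp add: ennreal_neg)
  then show ?thesis by simp
qed

text \<open>The stopping time is built from \<open>Z\<close>, which is adapted to the natural
  filtration exactly; a version agrees with it only outside a null set, and is put back under the
  integral.\<close>

lemma strong_markov_exit:
  assumes x: "x \<in> G" and U: "version x U" and K: "\<And>n. K n \<in> sets borel" "\<And>n. K n \<subseteq> G"
    and r: "0 \<le> r" and \<phi> [measurable]: "\<phi> \<in> borel_measurable borel"
  defines "T \<equiv> \<lambda>w. exit_limit K (traj U w)"
  shows "EE x (\<lambda>w. indicator {w. T w < \<infinity>} w * (h0 (U (enn2real (T w) + r) w) * \<phi> (U (enn2real (T w) + r) w))) =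
    EE x (\<lambda>w. indicator {w. T w < \<infinity>} w * (\<integral>\<^sup>+y. h0 y * \<phi> y \<partial>Ker r (U (enn2real (T w)) w)))"
proof -
  note xE = Some_in[OF x]
  define T' where "T' w = exit_limit K (traj Z w)" for w
  have T'n: "{w \<in> space M. T' w < ennreal u} \<in> sets (nat_filt (Some x) u)" for u
    unfolding T'_def by (rule natural_exit_limit[OF xE K])
  note st = stopping_time_optional[OF xE T'n]
  interpret filtration "space (Px x)" "aug (Some x)" by (rule filtration_aug)
  have pre: "space M \<in> sets (pre_sigma T')"
  proof -
    have "space (pre_sigma T') = space M" unfolding space_pre_sigma by (rule space_P[OF xE])
    from sets.top[of "pre_sigma T'", unfolded this] show ?thesis .
  qed
  have g: "(\<lambda>y. h0 y * \<phi> y) \<in> borel_measurable borel" by measurable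
  have ae: "AE w in Px x. T' w = T w \<and> w \<in> space M"
    using version_AE[OF U] AE_space
    by eventually_elim (simp add: T_def T'_def space_P[OF xE])
  have "EE x (\<lambda>w. indicator {w. T w < \<infinity>} w * (h0 (U (enn2real (T w) + r) w) * \<phi> (U (enn2real (T w) + r) w))) =
    EE x (\<lambda>w. indicator {w \<in> space M. T' w < \<infinity>} w * (indicator G (U (enn2real (T' w) + r) w) * (h0 (U (enn2real (T' w) + r) w) * \<phi> (U (enn2real (T' w) + r) w))))"
    by (intro nn_integral_cong_AE eventually_mono[OF ae]) (auto simp: h0_out split: split_indicator)
  also have "\<dots> = EE x (\<lambda>w. indicator {w \<in> space M. T' w < \<infinity>} w * (\<integral>\<^sup>+y. h0 y * \<phi> y \<partial>Ker r (U (enn2real (T' w)) w)))"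
    by (rule strong_markov_nn_integral[OF x U st pre sets.top r g])
  also have "\<dots> = EE x (\<lambda>w. indicator {w. T w < \<infinity>} w * (\<integral>\<^sup>+y. h0 y * \<phi> y \<partial>Ker r (U (enn2real (T w)) w)))"
    by (intro nn_integral_cong_AE eventually_mono[OF ae]) (auto split: split_indicator)
  finally show ?thesis .
qed

text \<open>The averaged identity holds for every Borel \<open>\<phi>\<close>; continuity of
  \<open>f\<close> serves to let the elapsed time tend to 0 on both sides. The bound in the second
  claim is found on the way, as the integrability needed for this limit.\<close>

lemma exit_law_continuous:
  fixes f :: "real ^ 'n \<Rightarrow> real"
  assumes x: "x \<in> G" and Y: "version (j x) Y" and U: "version x U"
    and K: "\<And>n. K n \<in> sets borel" "\<And>n. K n \<subseteq> G"
    and f: "continuous_on UNIV f" "\<And>y. 0 \<le> f y \<and> f y \<le> 1"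
  shows "(EE (j x) (\<lambda>w. h0 x * (indicator G (exit_pos K (TC Y w)) * ennreal (f (exit_pos K (TC Y w))))))
    = EE x (\<lambda>w. h0 (exit_pos K (traj U w)) * ennreal (f (exit_pos K (traj U w))))"
    and "(EE x (\<lambda>w. h0 (exit_pos K (traj U w)))) \<le> h0 x"
proof -
  interpret Q1: prob_space "Px (j x)" by (rule prob_P[OF Some_in[OF j_in[OF x]]])
  interpret Q2: prob_space "Px x" by (rule prob_P[OF Some_in[OF x]])
  define TW where "TW w = exit_limit K (TC Y w)" for w
  define TU where "TU w = exit_limit K (traj U w)" for w
  define eW where "eW r w = TC Y w (enn2real (TW w) + r)" for r w
  define eU where "eU w = U (enn2real (TU w)) w" for w
  have [measurable]: "TW \<in> rv (j x)" "TU \<in> rv x"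
    unfolding TW_def TU_def using exit_limit_measurable[OF time_change_measurable[OF Y] K(1)] exit_limit_measurable[OF version_measurable[OF U] K(1)] .
  have [measurable]: "eW r \<in> rv (j x)" for r
    unfolding eW_def by (rule time_change_random_time[OF Y]) measurable
  have [measurable]: "eU \<in> rv x"
    unfolding eU_def by (rule version_random_time[OF U]) measurable
  note [measurable] = time_change_joint[OF Y] version_joint[OF U]
  \<comment> \<open>Integrands at time \<open>r\<close> after the exit: \<open>A\<close> belongs to
    the time-changed process, \<open>C\<close> to the original one after the strong Markov property,
    and \<open>C0\<close> is the limit of \<open>C\<close> for \<phi> = 1.\<close>
  define A where "A \<phi> r w = indicator {w. TW w < \<infinity>} w * (h0 x * (indicator G (eW r w) * \<phi> (eW r w)))"
    for \<phi> :: "real ^ 'n \<Rightarrow> ennreal" and r w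
  define C where "C \<phi> r w = indicator {w. TU w < \<infinity>} w * Kh r \<phi> (eU w)"
    for \<phi> :: "real ^ 'n \<Rightarrow> ennreal" and r w
  define C0 where "C0 w = indicator {w. TU w < \<infinity>} w * h0 (eU w)" for w
  let ?one = "\<lambda>_ :: real ^ 'n. 1 :: ennreal"
  have windows: "(\<integral>\<^sup>+r\<in>{0<..s}. (EE (j x) (\<lambda>w. A \<phi> r w)) \<partial>lborel) = (\<integral>\<^sup>+r\<in>{0<..s}. (EE x (\<lambda>w. C \<phi> r w)) \<partial>lborel)"
    if \<phi> [measurable]: "\<phi> \<in> borel_measurable borel" and s: "0 < s" for \<phi> s
  proof -
    have "(\<integral>\<^sup>+r\<in>{0<..s}. (EE (j x) (\<lambda>w. A \<phi> r w)) \<partial>lborel) =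
      (\<integral>\<^sup>+t. (EE (j x) (\<lambda>w. h0 x * (indicator G (TC Y w t) * \<phi> (TC Y w t)) * indicator {w. TW w < ennreal t \<and> \<not> TW w < ennreal (t - s)} w)) \<partial>lborel)"
      unfolding A_def eW_def by (rule window_integral[symmetric]) (unfold_locales, measurable)
    also have "\<dots> = (\<integral>\<^sup>+t. (EE x (\<lambda>w. h0 (U t w) * \<phi> (U t w) * indicator {w. TU w < ennreal t \<and> \<not> TU w < ennreal (t - s)} w)) \<partial>lborel)"
      unfolding TW_def TU_def by (intro nn_integral_cong window_law[OF x Y U K(1) \<phi>]) (use s in simp)
    also have "\<dots> = (\<integral>\<^sup>+r\<in>{0<..s}. (EE x (\<lambda>w. indicator {w. TU w < \<infinity>} w * (h0 (U (enn2real (TU w) + r) w) * \<phi> (U (enn2real (TU w) + r) w)))) \<partial>lborel)"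
      by (rule window_integral) (unfold_locales, measurable)
    also have "\<dots> = (\<integral>\<^sup>+r\<in>{0<..s}. (EE x (\<lambda>w. C \<phi> r w)) \<partial>lborel)"
      using strong_markov_exit[OF x U K _ \<phi>] unfolding C_def TU_def eU_def
      by (intro nn_integral_cong) (simp split: split_indicator)
    finally show ?thesis .
  qed
  have Cm [measurable]: "C \<phi> r \<in> rv x"
    if [measurable]: "\<phi> \<in> borel_measurable borel" and r: "0 \<le> r" for \<phi> r
  proof -
    have [measurable]: "(\<lambda>w. Kh r \<phi> (eU w)) \<in> rv x"
      by (rule measurable_compose[OF _ nn_integral_Ker_measurable[OF r]]) measurable
    show ?thesis unfolding C_def by measurable
  qed
  have [measurable]: "C0 \<in> rv x" unfolding C0_def by measurable
  have A_le: "A \<phi> r w \<le> h0 x" if "\<And>y. \<phi> y \<le> 1" for \<phi> r w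
  proof -
    have "indicator G (eW r w) * \<phi> (eW r w) \<le> 1" using that by (simp split: split_indicator)
    from mult_left_mono[OF this, of "h0 x"] show ?thesis by (simp add: A_def split: split_indicator)
  qed
  have C_antimono: "C ?one r w \<le> C ?one r' w" if "0 < r'" "r' \<le> r" for r r' w
    unfolding C_def using semigroup_antimono[of r' r] that by (intro mult_left_mono) auto
  \<comment> \<open>For \<phi> = 1 the integrand \<open>C\<close> decreases in \<open>r\<close>, so
    its value at \<open>r\<close> is at most its average over \<open>(0,r]\<close>, which the
    averaged identity bounds by \<open>h0 x\<close>.\<close>
  have C1: "(EE x (\<lambda>w. C ?one r w)) \<le> h0 x" if r: "0 < r" for r
  proof -
    have "(EE x (\<lambda>w. C ?one r w)) * ennreal r = (\<integral>\<^sup>+r'\<in>{0<..r}. (EE x (\<lambda>w. C ?one r w)) \<partial>lborel)"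
      using r by (subst nn_integral_cmult_indicator) auto
    also have "\<dots> \<le> (\<integral>\<^sup>+r'\<in>{0<..r}. (EE x (\<lambda>w. C ?one r' w)) \<partial>lborel)"
      using C_antimono by (auto intro!: nn_integral_mono split: split_indicator)
    also have "\<dots> = (\<integral>\<^sup>+r'\<in>{0<..r}. (EE (j x) (\<lambda>w. A ?one r' w)) \<partial>lborel)"
      by (rule windows[symmetric]) (use r in auto)
    also have "\<dots> \<le> (\<integral>\<^sup>+r'\<in>{0<..r}. (EE (j x) (\<lambda>w. h0 x)) \<partial>lborel)"
      by (intro nn_integral_mono mult_right_mono A_le) auto
    also have "\<dots> = h0 x * ennreal r"
      using r by (subst nn_integral_cmult_indicator) (auto simp: Q1.emeasure_space_1)
    finally have "(EE x (\<lambda>w. C ?one r w)) * ennreal r \<le> h0 x * ennreal r" .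
    then show ?thesis
      using ennreal_mult_strict_right_mono[of "h0 x" "\<integral>\<^sup>+w. C ?one r w \<partial>Px x" "ennreal r"] r
      by (auto simp: not_less[symmetric])
  qed
  have C_lim: "((\<lambda>r. C (\<lambda>y. ennreal (g y)) r w) \<longlongrightarrow> C0 w * ennreal (g (eU w))) (at_right 0)"
    if g: "continuous_on UNIV g" "\<And>y. g y \<le> 1" for g w
    unfolding C_def C0_def using semigroup_tendsto[OF g] by (cases "TU w < \<infinity>") auto
  \<comment> \<open>Along \<open>1 / Suc n\<close> the functions \<open>C\<close> increase to
    \<open>C0\<close>; monotone convergence transfers the bound, and \<open>C0\<close> becomes the
    dominating function for general \<open>f\<close>.\<close>
  have C0_fin: "(EE x (\<lambda>w. C0 w)) \<le> h0 x"
  proof -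
    define R where "R n = 1 / real (Suc n)" for n
    have R: "0 < R n" for n by (simp add: R_def)
    have "R \<longlonglongrightarrow> 0" unfolding R_def using LIMSEQ_inverse_real_of_nat by (simp add: divide_inverse)
    then have Rf: "filterlim R (at_right 0) sequentially"
      unfolding filterlim_at using R by (auto intro!: always_eventually simp: less_imp_neq[symmetric])
    have inc: "incseq (\<lambda>n. C ?one (R n))"
      by (intro incseq_SucI le_funI C_antimono R) (simp add: R_def frac_le)
    have "C0 w = (SUP n. C ?one (R n) w)" for w
    proof (rule LIMSEQ_unique)
      show "(\<lambda>n. C ?one (R n) w) \<longlonglongrightarrow> C0 w"
        using filterlim_compose[OF C_lim[of "\<lambda>_. 1" w] Rf] by simp
      show "(\<lambda>n. C ?one (R n) w) \<longlonglongrightarrow> (SUP n. C ?one (R n) w)"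
        by (rule LIMSEQ_SUP) (use inc in \<open>auto simp: incseq_def le_fun_def\<close>)
    qed
    then have "EE x (\<lambda>w. C0 w) = EE x (\<lambda>w. (SUP n. C ?one (R n) w))" by simp
    also have "\<dots> = (SUP n. \<integral>\<^sup>+w. C ?one (R n) w \<partial>Px x)"
      by (rule nn_integral_monotone_convergence_SUP[OF inc Cm]) (use R in \<open>auto intro: less_imp_le\<close>)
    also have "\<dots> \<le> h0 x" by (intro SUP_least C1 R)
    finally show ?thesis .
  qed
  have [measurable]: "f \<in> borel_measurable borel" by (rule borel_measurable_continuous_onI[OF f(1)])
  let ?f = "\<lambda>y. ennreal (f y)"
  have fm [measurable]: "?f \<in> borel_measurable borel" by measurable
  have C_int: "((\<lambda>r. \<integral>\<^sup>+w. C ?f r w \<partial>Px x) \<longlongrightarrow> (EE x (\<lambda>w. C0 w * ?f (eU w)))) (at_right 0)"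
  proof (rule nn_integral_tendsto_at_right[where bd = C0])
    show "C ?f r \<in> rv x" if "0 < r" for r using Cm[OF fm] that by simp
    show "(EE x (\<lambda>w. C0 w)) < \<infinity>" using C0_fin h0_finite[of x] by simp
    show "AE w in Px x. C ?f r w \<le> C0 w" if "0 < r" for r
      unfolding C_def C0_def using semigroup_bound[OF _ fm, of r] f(2) that
      by (intro AE_I2 mult_left_mono) auto
  qed (use C_lim[OF f(1)] f(2) in auto)
  have A_int: "((\<lambda>r. \<integral>\<^sup>+w. A ?f r w \<partial>Px (j x)) \<longlongrightarrow> (EE (j x) (\<lambda>w. A ?f 0 w))) (at_right 0)"
  proof (rule nn_integral_tendsto_at_right[where bd = "\<lambda>_. h0 x"])
    show "(EE (j x) (\<lambda>w. h0 x)) < \<infinity>" using h0_finite[of x] by (simp add: Q1.emeasure_space_1)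
    show "AE w in Px (j x). A ?f r w \<le> h0 x" for r using A_le f(2) by simp
    show "AE w in Px (j x). ((\<lambda>r. A ?f r w) \<longlongrightarrow> A ?f 0 w) (at_right 0)"
    proof (rule AE_I2)
      fix w
      note good = version_good[OF Y, of w]
      have "((\<lambda>r. indicator G (eW r w) * ?f (eW r w)) \<longlongrightarrow> indicator G (eW 0 w) * ?f (eW 0 w)) (at_right 0)"
        using absorbed_path_tendsto[OF rc_time_change[OF good] absorbed_time_change[OF good] open_G zero_notin_G _ f(1), of "enn2real (TW w)"]
        by (simp add: eW_def)
      then show "((\<lambda>r. A ?f r w) \<longlongrightarrow> A ?f 0 w) (at_right 0)"
        unfolding A_def using h0_finite[of x] by (intro ennreal_tendsto_cmult) (auto split: split_indicator)
    qed
  qed (unfold A_def, measurable)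
  \<comment> \<open>Equal averages over all windows force equal limits at 0.\<close>
  have "EE (j x) (\<lambda>w. A ?f 0 w) = EE x (\<lambda>w. C0 w * ?f (eU w))"
    using averages_le[OF A_int C_int] averages_le[OF C_int A_int] windows[OF fm] by (auto intro: antisym)
  moreover have "A ?f 0 w = h0 x * (indicator G (exit_pos K (TC Y w)) * ?f (exit_pos K (TC Y w)))" for w
    using zero_notin_G by (auto simp: A_def eW_def exit_pos_def TW_def split: split_indicator)
  moreover have "C0 w * ?f (eU w) = h0 (exit_pos K (traj U w)) * ?f (exit_pos K (traj U w))"
    and C0: "C0 w = h0 (exit_pos K (traj U w))" for w
    using zero_notin_G by (auto simp: C0_def eU_def exit_pos_def TU_def h0_out)
  ultimately show "(EE (j x) (\<lambda>w. h0 x * (indicator G (exit_pos K (TC Y w)) * ?f (exit_pos K (TC Y w)))))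
    = EE x (\<lambda>w. h0 (exit_pos K (traj U w)) * ?f (exit_pos K (traj U w)))"
    by simp
  show "(EE x (\<lambda>w. h0 (exit_pos K (traj U w)))) \<le> h0 x"
    using C0_fin C0 by simp
qed

text \<open>The two sides define measures of \<open>\<phi>\<close> on the space of exit positions.
  The bound on the expectation of \<open>h0\<close> at the exit makes one of them finite, and then
  continuous functions with values in \<open>[0,1]\<close> suffice to identify them.\<close>

lemma exit_law:
  assumes x: "x \<in> G" and Y: "version (j x) Y" and U: "version x U"
    and K: "\<And>n. K n \<in> sets borel" "\<And>n. K n \<subseteq> G" and \<phi> [measurable]: "\<phi> \<in> borel_measurable borel"
  shows "(EE (j x) (\<lambda>w. h0 x * (indicator G (exit_pos K (TC Y w)) * \<phi> (exit_pos K (TC Y w)))))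
    = EE x (\<lambda>w. h0 (exit_pos K (traj U w)) * \<phi> (exit_pos K (traj U w)))"
proof -
  define eW where "eW w = exit_pos K (TC Y w)" for w
  define eU where "eU w = exit_pos K (traj U w)" for w
  have [measurable]: "eW \<in> rv (j x)"
    unfolding eW_def by (rule exit_pos_measurable[OF time_change_measurable[OF Y] rc_time_change[OF version_good[OF Y]] K(1)])
  have [measurable]: "eU \<in> rv x"
    unfolding eU_def by (rule exit_pos_measurable[OF version_measurable[OF U] version_rc[OF U] K(1)])
  define \<alpha> where "\<alpha> = distr (density (Px x) (\<lambda>w. h0 (eU w))) borel eU"
  define \<beta> where "\<beta> = distr (density (Px (j x)) (\<lambda>w. h0 x * indicator G (eW w))) borel eW"
  have \<alpha>: "(\<integral>\<^sup>+y. g y \<partial>\<alpha>) = EE x (\<lambda>w. h0 (eU w) * g (eU w))"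
    if [measurable]: "g \<in> borel_measurable borel" for g
    unfolding \<alpha>_def by (simp add: nn_integral_distr nn_integral_density)
  have \<beta>: "(\<integral>\<^sup>+y. g y \<partial>\<beta>) = EE (j x) (\<lambda>w. h0 x * (indicator G (eW w) * g (eW w)))"
    if [measurable]: "g \<in> borel_measurable borel" for g
    unfolding \<beta>_def by (simp add: nn_integral_distr nn_integral_density mult.assoc)
  note cont = exit_law_continuous[where K = K, OF x Y U K, folded eW_def eU_def]
  have "\<alpha> = \<beta>"
  proof (rule finite_borel_measure_eqI)
    show "sets \<alpha> = sets borel" "sets \<beta> = sets borel" by (simp_all add: \<alpha>_def \<beta>_def)
    have "emeasure \<alpha> UNIV = (\<integral>\<^sup>+y. 1 \<partial>\<alpha>)" by (simp add: \<alpha>_def)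
    also have "\<dots> = EE x (\<lambda>w. h0 (eU w))" by (subst \<alpha>) auto
    also have "\<dots> \<le> h0 x" using cont(2)[of "\<lambda>_. 0"] by simp
    finally show "emeasure \<alpha> UNIV \<noteq> \<infinity>" using h0_finite[of x] by auto
    fix f :: "real ^ 'n \<Rightarrow> real" assume f: "continuous_on UNIV f" "\<And>y. 0 \<le> f y \<and> f y \<le> 1"
    have [measurable]: "(\<lambda>y. ennreal (f y)) \<in> borel_measurable borel"
      using borel_measurable_continuous_onI[OF f(1)] by measurable
    show "(\<integral>\<^sup>+y. ennreal (f y) \<partial>\<alpha>) = (\<integral>\<^sup>+y. ennreal (f y) \<partial>\<beta>)"
      using cont(1)[OF f] by (simp add: \<alpha> \<beta>)
  qed
  then show ?thesis using \<alpha>[OF \<phi>] \<beta>[OF \<phi>] by (simp add: eW_def eU_def)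
qed

section \<open>Exit values and the Kelvin transform\<close>

lemma AE_exit_value:
  assumes x: "x \<in> G" and B: "openin (E_top S) B" "Some x \<in> B" and K: "exhaustion K (Some -` B \<inter> G)"
    and f: "\<forall>e\<in>E_bd S. f e = 0"
  shows "AE w in Px x. exit_value X f B w =
    (if exit_pos K (traj Z w) \<in> G then f (Some (exit_pos K (traj Z w))) else 0)"
  using AE_path[OF x] AE_contained[OF x K Int_lower2] AE_space
proof eventually_elim
  case (elim w)
  let ?z = "\<lambda>t. Z t w" and ?b = "Some -` B \<inter> G"
  have rc: "rc_path ?z" and ab: "absorbed_path G ?z" and z0: "Z 0 w = x" using elim by auto
  note cc = elim(2)
  have ob: "open ?b" by (rule open_Some_vimage[OF B(1)])
  have XB: "X s w \<in> B" if "Z s w \<in> ?b" for s using that Z_eq[of s w] by auto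
  have zb: "Z s w \<in> ?b" if "Z s w \<in> G" "X s w \<in> B" for s using that Z_eq[of s w] by auto
  show ?case
  proof (cases "exit_pos K ?z \<in> G")
    case True
    have "exit_pos K ?z \<noteq> 0" using True zero_notin_G by auto
    then obtain \<tau> where \<tau>: "exit_limit K ?z = ennreal \<tau>" "0 \<le> \<tau>" and e: "exit_pos K ?z = Z \<tau> w"
      by (rule exit_pos_obtain)
    then have zG: "Z \<tau> w \<in> G" using True by simp
    note \<tau>' = exit_limit_eqD[OF rc K cc ob \<tau>]
    \<comment> \<open>\<open>exit_time\<close> ignores time 0 and \<open>exit_limit\<close> does
      not; they are reconciled by the start inside \<open>B\<close>.\<close>
    have "\<tau> \<noteq> 0" using \<tau>'(1) z0 x B(2) by auto
    have "exit_time X B w = ennreal \<tau>"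
      unfolding exit_time_def
    proof (rule antisym)
      show "Inf {ennreal s |s. 0 < s \<and> X s w \<notin> B} \<le> ennreal \<tau>"
        using \<tau>'(1) zb zG \<open>\<tau> \<noteq> 0\<close> \<tau>(2) by (intro Inf_lower) auto
      show "ennreal \<tau> \<le> Inf {ennreal s |s. 0 < s \<and> X s w \<notin> B}"
      proof (rule Inf_greatest)
        fix u assume "u \<in> {ennreal s |s. 0 < s \<and> X s w \<notin> B}"
        then obtain s where s: "u = ennreal s" "0 < s" "X s w \<notin> B" by auto
        then have "\<tau> \<le> s" using \<tau>'(2)[of s] XB[of s] by (meson less_imp_le not_le)
        then show "ennreal \<tau> \<le> u" using s by (simp add: ennreal_leI)
      qed
    qed
    then show ?thesis using True e \<tau>(2) Z_eq[OF zG] by (simp add: exit_value_def at_time_def)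
  next
    case False
    \<comment> \<open>If \<open>X t\<close> were interior, the path would lie in \<open>?b\<close>
      on all of \<open>[0,t]\<close>, as otherwise \<open>exit_pos\<close> would be in
      \<open>G\<close>. The open set \<open>?b\<close> would then hold the path beyond
      \<open>t\<close>, so \<open>t\<close> could not be the exit time. Hence \<open>X t\<close> is
      on the boundary, where \<open>f\<close> vanishes.\<close>
    have "f (X t w) = 0" if t: "exit_time X B w = ennreal t" "0 \<le> t" for t
    proof (cases "Z t w \<in> G")
      case zG: True
      have b: "Z s w \<in> ?b" if s: "0 \<le> s" "s \<le> t" for s
      proof (rule ccontr)
        assume "Z s w \<notin> ?b"
        then have "exit_limit K ?z < ennreal r" if "t < r" for r
          using exit_limit_less_path[OF rc K cc, of r] s that by force
        then have "exit_limit K ?z \<le> ennreal t + ennreal e" if "0 < e" for e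
          using that t(2) by (simp add: less_imp_le flip: ennreal_plus)
        then have le: "exit_limit K ?z \<le> ennreal t" by (rule ennreal_le_epsilon)
        then have fin: "exit_limit K ?z < \<infinity>" by (simp add: le_less_trans)
        have "enn2real (exit_limit K ?z) \<le> t" using le t(2) by (rule enn2real_leI[rotated])
        then have "Z (enn2real (exit_limit K ?z)) w \<in> G"
          by (intro absorbed_mono[OF ab zG]) auto
        then show False using False fin by (simp add: exit_pos_def)
      qed
      obtain e where e: "e > t" "\<And>s. t \<le> s \<Longrightarrow> s < e \<Longrightarrow> Z s w \<in> ?b"
        using rc_path_open[OF rc ob b[OF t(2) order_refl]] by blast
      have "ennreal e \<le> exit_time X B w"
        unfolding exit_time_def
      proof (rule Inf_greatest)
        fix u assume "u \<in> {ennreal s |s. 0 < s \<and> X s w \<notin> B}"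
        then obtain s where s: "u = ennreal s" "0 < s" "X s w \<notin> B" by auto
        then have "e \<le> s" using b[of s] e(2)[of s] XB[of s] by (meson less_imp_le linear not_le)
        then show "ennreal e \<le> u" using s by (simp add: ennreal_leI)
      qed
      then show ?thesis using e(1) t by (simp add: ennreal_le_iff2)
    next
      case zG: False
      have "X t w \<in> E_set S"
        using measurable_space[OF X_measurable[OF t(2)], of w] elim(3) space_P[OF Some_in[OF x]] space_E by simp
      then show ?thesis using zG Z_in_iff[OF t(2)] f by (auto simp: E_bd_iff)
    qed
    then show ?thesis using False
      by (cases "exit_time X B w" rule: ennreal_cases) (auto simp: exit_value_def at_time_def)
  qed
qed

lemma interior_measurable:
  fixes f :: "(real ^ 'n) option \<Rightarrow> ereal"
  assumes "f \<in> borel_measurable EB"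
  shows "(\<lambda>bd. indicator G bd * e2ennreal (f (Some bd))) \<in> borel_measurable borel"
proof -
  have "(\<lambda>e. e2ennreal (f e)) \<in> borel_measurable EB"
    using assms by measurable
  from Some_measurable[OF this] show ?thesis
    by (subst (asm) borel_measurable_restrict_space_iff_ennreal) (auto simp: mult.commute)
qed

lemma exit_value_integral:
  assumes x: "x \<in> G" and B: "openin (E_top S) B" "Some x \<in> B" and K: "exhaustion K (Some -` B \<inter> G)"
    and f: "\<forall>e\<in>E_bd S. f e = 0" and U: "version x U"
  shows "(\<integral>\<^sup>+w. e2ennreal (exit_value X f B w) \<partial>cP (Some x)) =
    EE x (\<lambda>w. indicator G (exit_pos K (traj U w)) * e2ennreal (f (Some (exit_pos K (traj U w)))))"
  unfolding nn_integral_completion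
proof (rule nn_integral_cong_AE)
  show "AE w in Px x. e2ennreal (exit_value X f B w) =
     indicator G (exit_pos K (traj U w)) * e2ennreal (f (Some (exit_pos K (traj U w))))"
    using AE_exit_value[OF x B K f] version_AE[OF U]
    by eventually_elim (simp add: zero_ennreal.abs_eq[symmetric] split: split_indicator)
qed

lemma openin_I_image: "openin (E_top S) B \<Longrightarrow> openin (E_top S) (I ` B)"
proof -
  assume B: "openin (E_top S) B"
  have "I ` B = {e \<in> topspace (E_top S). I e \<in> B}"
    using openin_subset[OF B] I_in I_I unfolding E_set_def by (force simp: image_iff subset_iff)
  then show ?thesis using openin_continuous_map_preimage[OF I_continuous B] by simp
qed

text \<open>The exit law leads from the exit of \<open>X\<close> started at \<open>x\<close> to that
  of the time-changed process; the invariance of exit positions under the change of time leads on to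
  \<open>X\<close> started at \<open>j x\<close> and leaving the image of \<open>B\<close>. Only the
  positive part is treated, the negative part being the case of \<open>- f\<close>.\<close>

lemma kelvin_integral:
  assumes x: "x \<in> G" and B: "openin (E_top S) B" "Some x \<in> B"
    and fm: "f \<in> borel_measurable EB" and f: "\<forall>e\<in>E_bd S. f e = 0"
  shows "(\<integral>\<^sup>+w. e2ennreal (exit_value X (Kel f) B w) \<partial>cP (Some x)) =
    h0 x * (\<integral>\<^sup>+w. e2ennreal (exit_value X f (I ` B) w) \<partial>cP (Some (j x)))"
proof -
  let ?b = "Some -` B \<inter> G"
  have ob: "open ?b" by (rule open_Some_vimage[OF B(1)])
  have bG: "?b \<subseteq> G" by simp
  obtain K where K: "exhaustion K ?b" using ex_exhaustion[OF ob] .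
  have Kb: "K n \<in> sets borel" "K n \<subseteq> G" for n
    using exhaustion_borel[OF K] exhaustion_subset[OF K] by auto
  note Kj = exhaustion_image[OF K bG]
  have jb: "j ` ?b = Some -` (I ` B) \<inter> G"
  proof (intro equalityI subsetI)
    fix y assume "y \<in> j ` ?b"
    then obtain bd where bd: "Some bd \<in> B" "bd \<in> G" "y = j bd" by auto
    then have "Some y = I (Some bd)" using I_Some by simp
    then show "y \<in> Some -` (I ` B) \<inter> G" using bd j_in by auto
  next
    fix y assume y: "y \<in> Some -` (I ` B) \<inter> G"
    then obtain e where e: "e \<in> B" "Some y = I e" by auto
    then have "e \<in> E_set S" using openin_subset[OF B(1)] by (auto simp: E_set_def)
    then have "e = Some (j y)" using e(2) I_I I_Some[of y] y by (metis IntD2)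
    then show "y \<in> j ` ?b" using e(1) y j_in[of y] j_j[of y] by (auto intro!: image_eqI[of _ _ "j y"])
  qed
  have jbG: "j ` ?b \<subseteq> G" using jb by simp
  have jx: "j x \<in> G" by (rule j_in[OF x])
  have jxB: "Some (j x) \<in> I ` B" using B(2) I_Some[OF x] by (metis imageI)
  obtain U where U: "version x U" using ex_version[OF x exhaustion_L order_refl] by blast
  \<comment> \<open>Containment of \<open>Y\<close> in the transported sets is what makes its time
    change contained in the sets \<open>K n\<close>.\<close>
  obtain Y where Y: "version (j x) Y" "\<And>w. contained_path (\<lambda>n. j ` K n) (j ` ?b) (traj Y w)"
    using ex_version[OF jx Kj jbG] by blast
  define g where "g bd = indicator G bd * e2ennreal (f (Some bd))" for bd
  have g [measurable]: "g \<in> borel_measurable borel" unfolding g_def by (rule interior_measurable[OF fm])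
  \<comment> \<open>On \<open>G\<close> this is the positive part of \<open>f\<close> composed with
    the inversion; the cut-offs serve measurability on the whole space.\<close>
  define \<phi> where "\<phi> bd = g (indicator G bd *\<^sub>R j bd)" for bd
  have \<phi>: "\<phi> \<in> borel_measurable borel" unfolding \<phi>_def by (rule measurable_compose[OF j_borel g])
  have kb: "\<forall>e\<in>E_bd S. Kel f e = 0"
    using f I_boundary by (simp add: kelvin_transform_def)
  let ?eU = "\<lambda>w. exit_pos K (traj U w)"
  let ?eW = "\<lambda>w. exit_pos K (TC Y w)"
  let ?eY = "\<lambda>w. exit_pos (\<lambda>n. j ` K n) (traj Y w)"
  have "(\<integral>\<^sup>+w. e2ennreal (exit_value X (Kel f) B w) \<partial>cP (Some x)) =
    EE x (\<lambda>w. indicator G (?eU w) * e2ennreal (Kel f (Some (?eU w))))"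
    by (rule exit_value_integral[OF x B K kb U])
  also have "\<dots> = EE x (\<lambda>w. h0 (?eU w) * \<phi> (?eU w))"
  proof (rule nn_integral_cong)
    fix w
    show "indicator G (?eU w) * e2ennreal (Kel f (Some (?eU w))) =
      h0 (?eU w) * \<phi> (?eU w)"
      using j_in[of "?eU w"]
      by (auto simp: kelvin_transform_def h0_in h0_out \<phi>_def g_def I_Some e2ennreal_mult split: split_indicator)
  qed
  also have "\<dots> = EE (j x) (\<lambda>w. h0 x * (indicator G (?eW w) * \<phi> (?eW w)))"
    by (rule exit_law[OF x Y(1) U Kb \<phi>, symmetric])
  also have "\<dots> = EE (j x) (\<lambda>w. h0 x * (indicator G (?eY w) * e2ennreal (f (Some (?eY w)))))"
  proof (rule nn_integral_cong)
    fix w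
    note ep = exit_pos_time_change[OF version_good[OF Y(1)] K ob bG Y(2), of w]
    show "h0 x * (indicator G (?eW w) * \<phi> (?eW w)) =
      h0 x * (indicator G (?eY w) * e2ennreal (f (Some (?eY w))))"
    proof (cases "?eY w \<in> G")
      case True
      then show ?thesis using ep(2)[OF True] j_in[OF True] j_j[OF True] by (simp add: \<phi>_def g_def)
    next
      case False
      then have "?eW w \<notin> G" using ep(1) by simp
      then show ?thesis using False by simp
    qed
  qed
  also have "\<dots> = h0 x * (EE (j x) (\<lambda>w. indicator G (?eY w) * e2ennreal (f (Some (?eY w)))))"
  proof (rule nn_integral_cmult)
    have "(\<lambda>w. g (?eY w)) \<in> rv (j x)"
      by (rule measurable_compose[OF exit_pos_measurable[OF version_measurable[OF Y(1)] version_rc[OF Y(1)] exhaustion_borel[OF Kj]] g])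
    then show "(\<lambda>w. indicator G (?eY w) * e2ennreal (f (Some (?eY w)))) \<in> rv (j x)"
      by (simp add: g_def)
  qed
  also have "EE (j x) (\<lambda>w. indicator G (?eY w) * e2ennreal (f (Some (?eY w)))) =
     (\<integral>\<^sup>+w. e2ennreal (exit_value X f (I ` B) w) \<partial>cP (Some (j x)))"
    by (rule exit_value_integral[OF jx openin_I_image[OF B(1)] jxB Kj[unfolded jb] f Y(1), symmetric])
  finally show ?thesis .
qed

lemma exit_value_uminus: "- exit_value X f B w = exit_value X (\<lambda>e. - f e) B w"
  by (simp add: exit_value_def)

lemma kelvin_uminus: "Kel (\<lambda>e. - f e) = (\<lambda>e. - Kel f e)"
  by (simp add: kelvin_transform_def fun_eq_iff)

text \<open>The positive and the negative part are both multiplied by \<open>h0 x\<close>, which is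
  positive and finite. So one expectation exists exactly if the other does, and the difference
  scales, infinite values included.\<close>

lemma kelvin_expectation:
  assumes x: "x \<in> G" and B: "openin (E_top S) B" "Some x \<in> B"
    and fm: "f \<in> borel_measurable EB" and f: "\<forall>e\<in>E_bd S. f e = 0"
  shows "has_expectation (cP (Some x)) (exit_value X (Kel f) B) \<longleftrightarrow>
      has_expectation (cP (Some (j x))) (exit_value X f (I ` B))"
    and "ereal_expectation (cP (Some x)) (exit_value X (Kel f) B) =
      enn2ereal (h0 x) * ereal_expectation (cP (Some (j x))) (exit_value X f (I ` B))"
proof -
  note pos = kelvin_integral[OF x B fm f]
  have "(\<lambda>e. - f e) \<in> borel_measurable EB" using fm by measurable
  moreover have "\<forall>e\<in>E_bd S. - f e = 0" using f by simp
  ultimately have neg: "(\<integral>\<^sup>+w. e2ennreal (- exit_value X (Kel f) B w) \<partial>cP (Some x)) =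
    h0 x * (\<integral>\<^sup>+w. e2ennreal (- exit_value X f (I ` B) w) \<partial>cP (Some (j x)))"
    using kelvin_integral[OF x B, of "\<lambda>e. - f e"] unfolding exit_value_uminus kelvin_uminus by simp
  have fin: "h0 x * c < \<infinity> \<longleftrightarrow> c < \<infinity>" for c
    using h0_pos[OF x] h0_finite[of x] by (auto simp: ennreal_mult_less_top)
  show "has_expectation (cP (Some x)) (exit_value X (Kel f) B) \<longleftrightarrow>
      has_expectation (cP (Some (j x))) (exit_value X f (I ` B))"
    unfolding has_expectation_def pos neg fin ..
  obtain c where c: "enn2ereal (h0 x) = ereal c" "0 < c"
    using h0_pos[OF x] h0_finite[of x] by (cases "h0 x" rule: ennreal_cases) (auto simp: ennreal_less_zero_iff)
  have dist: "ereal c * p - ereal c * q = ereal c * (p - q)" for p q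
    using c(2) by (cases p; cases q) (auto simp: algebra_simps)
  show "ereal_expectation (cP (Some x)) (exit_value X (Kel f) B) =
      enn2ereal (h0 x) * ereal_expectation (cP (Some (j x))) (exit_value X f (I ` B))"
    unfolding ereal_expectation_def pos neg times_ennreal.rep_eq c(1) dist ..
qed

text \<open>A path frozen at a point of \<open>B\<close> never leaves \<open>B\<close>; its exit
  time is infinite and the exit value is 0 by definition.\<close>

lemma boundary_expectation:
  assumes x: "x \<in> E_bd S" and B: "x \<in> B"
  shows "has_expectation (cP x) (exit_value X f B)"
    and "ereal_expectation (cP x) (exit_value X f B) = 0"
proof -
  have ae: "AE w in P x. exit_value X f B w = 0"
    using absorbed_bd[OF x]
  proof eventually_elim
    case (elim w)
    then have "{ennreal s |s. 0 < s \<and> X s w \<notin> B} = {}" using B by auto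
    then have "exit_time X B w = \<infinity>" by (simp only: exit_time_def Inf_empty infinity_ennreal_def)
    then show ?case by (simp add: exit_value_def)
  qed
  have "(\<integral>\<^sup>+w. e2ennreal (g (exit_value X f B w)) \<partial>cP x) = (\<integral>\<^sup>+w. 0 \<partial>P x)" if "g 0 = 0" for g
    unfolding nn_integral_completion
    by (rule nn_integral_cong_AE) (use ae that in \<open>auto elim!: eventually_mono simp: zero_ennreal.abs_eq[symmetric]\<close>)
  from this[of "\<lambda>c. c"] this[of uminus]
  have 1: "(\<integral>\<^sup>+w. e2ennreal (exit_value X f B w) \<partial>cP x) = 0"
    and 2: "(\<integral>\<^sup>+w. e2ennreal (- exit_value X f B w) \<partial>cP x) = 0" by auto
  show "has_expectation (cP x) (exit_value X f B)"
    unfolding has_expectation_def 1 by simp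
  show "ereal_expectation (cP x) (exit_value X f B) = 0"
    unfolding ereal_expectation_def 1 2 by simp
qed

lemma kelvin_measurable:
  assumes "f \<in> borel_measurable EB"
  shows "Kel f \<in> borel_measurable EB"
proof -
  have [measurable]: "(\<lambda>e. f (I e)) \<in> borel_measurable EB"
    by (rule measurable_compose[OF I_measurable assms])
  show ?thesis unfolding kelvin_transform_def[abs_def] by measurable
qed

lemma I_image_image: "B \<subseteq> E_set S \<Longrightarrow> I ` (I ` B) = B"
  using I_I by (force simp: image_image)

text \<open>A continuous involution is a homeomorphism, so it commutes with closures and preserves
  compactness.\<close>

lemma compactly_contained_I:
  assumes B: "B \<subseteq> E_set S" and D: "D \<subseteq> E_set S" and cc: "compactly_contained S B (I ` D)"
  shows "compactly_contained S (I ` B) D"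
proof -
  have "homeomorphic_maps (E_top S) (E_top S) I I"
    using I_continuous I_I by (simp add: homeomorphic_maps_def E_set_def)
  then have hom: "homeomorphic_map (E_top S) (E_top S) I"
    using homeomorphic_maps_map by blast
  have eq: "E_top S closure_of (I ` B) = I ` (E_top S closure_of B)"
    using homeomorphic_map_closure_of[OF hom] B by (simp add: E_set_def)
  have "I ` (E_top S closure_of B) \<subseteq> I ` (I ` D)"
    using cc unfolding compactly_contained_def by (intro image_mono) blast
  then show ?thesis
    using cc image_compactin[OF _ I_continuous] I_image_image[OF D]
    unfolding compactly_contained_def eq by auto
qed

lemma kelvin_exit:
  assumes B: "openin (E_top S) B" "x \<in> B"
    and fm: "f \<in> borel_measurable EB" and f: "\<forall>e\<in>E_bd S. f e = 0"
    and ex: "has_expectation (cP (I x)) (exit_value X f (I ` B))"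
  shows "has_expectation (cP x) (exit_value X (Kel f) B) \<and>
    (ereal_expectation (cP (I x)) (exit_value X f (I ` B)) \<le> f (I x) \<longrightarrow>
      ereal_expectation (cP x) (exit_value X (Kel f) B) \<le> Kel f x) \<and>
    (ereal_expectation (cP (I x)) (exit_value X f (I ` B)) = f (I x) \<longrightarrow>
      ereal_expectation (cP x) (exit_value X (Kel f) B) = Kel f x)"
proof (cases "x \<in> E_int S")
  case True
  then obtain y where y: "x = Some y" "y \<in> G" by (auto simp: E_int_eq)
  note k = kelvin_expectation[OF y(2) B(1) B(2)[unfolded y] fm f]
  have "Kel f x = enn2ereal (h0 y) * f (Some (j y))"
    using y by (simp add: kelvin_transform_def h0_in I_Some)
  then show ?thesis using k ex I_Some[OF y(2)] unfolding y(1)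
    by (auto intro: ereal_mult_left_mono)
next
  case False
  moreover have "x \<in> E_set S" using B openin_subset by (auto simp: E_set_def)
  ultimately have bd: "x \<in> E_bd S" by (simp add: E_bd_iff)
  \<comment> \<open>The product is 0 even where \<open>h x\<close> is infinite, since zero times
    infinity is 0 in \<open>ereal\<close>.\<close>
  then have "Kel f x = 0" using f I_boundary by (simp add: kelvin_transform_def)
  then show ?thesis using boundary_expectation[OF bd B(2)] by simp
qed

end

theorem theorem1:
  fixes S :: "(real ^ 'n) set"
    and M :: "'w measure"
    and P :: "(real ^ 'n) option \<Rightarrow> 'w measure"
    and X :: "real \<Rightarrow> 'w \<Rightarrow> (real ^ 'n) option"
    and I :: "(real ^ 'n) option \<Rightarrow> (real ^ 'n) option"
    and h :: "(real ^ 'n) option \<Rightarrow> ennreal"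
    and v :: "(real ^ 'n) option \<Rightarrow> real"
    and f :: "(real ^ 'n) option \<Rightarrow> ereal"
    and D :: "(real ^ 'n) option set"
  assumes "state_space S"
    and "standard_process S M P X"
    and "inversion_property S P X I h v"
    and "openin (E_top S) D"
    and "D \<subseteq> E_h S h"
    and "f \<in> borel_measurable (E_borel S)"
    and "\<forall>x\<in>E_bd S. f x = 0"
  shows "(regular_harmonic S P X f D \<and> (\<forall>x\<in>E_set S - D. f x = 0)
            \<longrightarrow> regular_harmonic S P X (kelvin_transform I h f) (I ` D)) \<and>
         (superharmonic S P X f D
            \<longrightarrow> superharmonic S P X (kelvin_transform I h f) (I ` D))"
proof -
  interpret inverted_process S M P X I h v
    by unfold_locales (use assms in auto)
  note open_D = openin_I_image[OF assms(4)] and Kf = kelvin_measurable[OF assms(6)]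
  have DE: "D \<subseteq> E_set S" using openin_subset[OF assms(4)] by (simp add: E_set_def)
  show ?thesis
  proof (intro conjI impI)
    assume f: "regular_harmonic S P X f D \<and> (\<forall>x\<in>E_set S - D. f x = 0)"
    show "regular_harmonic S P X (kelvin_transform I h f) (I ` D)"
      unfolding regular_harmonic_def
    proof (intro conjI ballI open_D Kf)
      fix x assume x: "x \<in> I ` D"
      have "I x \<in> D" using x I_I DE by auto
      \<comment> \<open>The exit set is the image of \<open>D\<close>, whose own image under the
        involution is \<open>D\<close> again.\<close>
      then have ex: "has_expectation (completion (P (I x))) (exit_value X f (I ` (I ` D)))"
        and eq: "ereal_expectation (completion (P (I x))) (exit_value X f (I ` (I ` D))) = f (I x)"
        using f unfolding I_image_image[OF DE] regular_harmonic_def by auto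
      note k = kelvin_exit[OF open_D x assms(6,7) ex]
      show "has_expectation (completion (P x)) (exit_value X (kelvin_transform I h f) (I ` D))"
        "ereal_expectation (completion (P x)) (exit_value X (kelvin_transform I h f) (I ` D)) = kelvin_transform I h f x"
        using k eq by auto
    qed
  next
    assume f: "superharmonic S P X f D"
    show "superharmonic S P X (kelvin_transform I h f) (I ` D)"
      unfolding superharmonic_def
    proof (intro conjI allI impI ballI open_D Kf)
      fix B x assume B: "openin (E_top S) B \<and> compactly_contained S B (I ` D)" and x: "x \<in> B"
      then have oB: "openin (E_top S) B" and BE: "B \<subseteq> E_set S" using openin_subset by (auto simp: E_set_def)
      have "compactly_contained S (I ` B) D" using compactly_contained_I[OF BE DE] B by blast
      then have ex: "has_expectation (completion (P (I x))) (exit_value X f (I ` B))"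
        and le: "ereal_expectation (completion (P (I x))) (exit_value X f (I ` B)) \<le> f (I x)"
        using f openin_I_image[OF oB] x unfolding superharmonic_def by auto
      note k = kelvin_exit[OF oB x assms(6,7) ex]
      show "has_expectation (completion (P x)) (exit_value X (kelvin_transform I h f) B)"
        "ereal_expectation (completion (P x)) (exit_value X (kelvin_transform I h f) B) \<le> kelvin_transform I h f x"
        using k le by auto
    qed
  qed
qed

end
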